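(* Fix a positive integer $N$. Then, as $n\to\infty$, \[T_{0,N}(n)=\frac{e^{2\pi\sqrt{\frac n6}}\,n^{-\frac 12}}{4\pi N\sqrt{2}}\left[\log n-\log\left(\frac{\pi^2}{6}\right)+2\gamma_E-2\log N+O\!\left(n^{-\frac 12}\log n\right)\right],\] where $\gamma_E$ is the Euler–Mascheroni constant.
   Context: For a positive integer $N$ and a positive integer $n$, $T_{0,N}(n)$ denotes the total number of parts divisible by $N$ (counted with multiplicity) in all partitions of $n$; that is, $T_{0,N}(n)=\sum_{|\lambda|=n}\#\{j:\lambda_j\equiv 0\pmod N\}$, where the sum runs over all partitions $\lambda=(\lambda_0,\dots,\lambda_k)$ (non-increasing sequences of positive integers) with $\sum_j\lambda_j=n$. *)

theory Defs
  imports "HOL-Analysis.Analysis" "HOL-Library.Landau_Symbols"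
begin

definition partitions_of :: "nat \<Rightarrow> nat list set" where
  "partitions_of n =
     {xs. sorted_wrt (\<ge>) xs \<and> (\<forall>x\<in>set xs. 0 < x) \<and> sum_list xs = n}"

text \<open>Finiteness is needed for the sum defining \<open>T0\<close> below not to be zero by convention.\<close>

lemma finite_partitions_of: "finite (partitions_of n)"
proof (rule finite_subset)
  have "length xs \<le> sum_list xs" if "\<forall>x\<in>set xs. 0 < x" for xs :: "nat list"
    using that by (induction xs) (auto simp: Suc_le_eq add_strict_increasing)
  then show "partitions_of n \<subseteq> {xs. set xs \<subseteq> {..n} \<and> length xs \<le> n}"
    by (auto simp: partitions_of_def member_le_sum_list)
  show "finite {xs :: nat list. set xs \<subseteq> {..n} \<and> length xs \<le> n}"
    by (rule finite_lists_length_le) simp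
qed

definition T0 :: "nat \<Rightarrow> nat \<Rightarrow> nat" where
  "T0 N n = (\<Sum>xs\<in>partitions_of n. card {j. j < length xs \<and> xs ! j mod N = 0})"

end

(*  The generating function of T_{0,N} is P(q) D(q^N), where P is the partition generating function
    and D(q) = sum_j q^j / (1 - q^j). Put q = exp (-w) with w in the sector |Im w| <= Re w. With
    M(w) = log w - log (1 - exp (-w)), the sums of M and of its derivative over the multiples of w
    are compared with integrals by Taylor's theorem; as M'' = O(1 / (1 + |w|)^2), the total errors are
    O(|w|) and O(1) respectively. Together with Stirling's formula and the dilogarithm as an
    antiderivative this yields
      P(q) = exp (pi^2 / (6 w) + (log w) / 2 - (log (2 pi)) / 2) (1 + O(|w|)),
      D(q) = (gamma - log w) / w + O(1),
    without any modularity. Cauchy's formula on the circle Re w = a = pi / sqrt (6 n), a saddle point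
    expansion at w = a (1 + i y) and an exponentially small bound for |y| >= 1 then give the result.  *)

theory Submission
  imports Defs "HOL-Probability.Probability" "HOL-Real_Asymp.Real_Asymp"
begin

section \<open>Generating functions\<close>

text \<open>The bracket is of size log n, so the claim asks for a relative error of order n^(-1/2),
  the size of a and of 1 / (n a). All estimates are tuned to this: a factor 1 + O(|w|) is enough in
  P, and an additive O(1) is enough in D because its main term has size |log w| / |w|. The choice n
  a^2 = pi^2 / 6 removes the linear term in y from pi^2 / (6 w) + n w, and |y| <= 1 is exactly the
  sector. The terms odd in y have relative size (n a)^(-1/2), which is too large, so they are
  cancelled by symmetry rather than estimated. The sum of M over all multiples of w diverges, since
  M(w) grows like log w. Hence the comparisons are made for finite sums up to K, with log K! kept
  exactly; Stirling's formula cancels the terms that grow with K, and K tends to infinity only in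
  the resulting inequality. The constant pi^2 / 6 is the value of the dilogarithm at 1, and enters
  through the antiderivative of M at 0.\<close>

definition mset_partitions :: "nat \<Rightarrow> nat multiset set" where
  "mset_partitions n = {M. 0 \<notin># M \<and> sum_mset M = n}"

text \<open>Multisets are used because removing copies of a part is then plain subtraction. A list
  is recovered from its multiset by sorting; it is reversed because \<open>partitions_of\<close>
  lists the parts in decreasing order.\<close>

lemma bij_betw_mset_partitions: "bij_betw mset (partitions_of n) (mset_partitions n)"
proof (rule bij_betwI')
  fix xs ys assume "xs \<in> partitions_of n" "ys \<in> partitions_of n"
  then have s: "sorted (rev xs)" "sorted (rev ys)"
    by (auto simp: partitions_of_def sorted_wrt_rev)
  show "mset xs = mset ys \<longleftrightarrow> xs = ys"
  proof
    assume "mset xs = mset ys"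
    then have "mset (rev xs) = mset (rev ys)" by simp
    then have "rev xs = rev ys" using s
      by (metis properties_for_sort)
    then show "xs = ys" by simp
  qed simp
next
  fix xs assume "xs \<in> partitions_of n"
  then show "mset xs \<in> mset_partitions n"
    by (auto simp: partitions_of_def mset_partitions_def sum_mset_sum_list)
next
  fix M assume M: "M \<in> mset_partitions n"
  define xs where "xs = rev (sorted_list_of_multiset M)"
  have "mset xs = M" by (simp add: xs_def)
  moreover have "sorted_wrt (\<ge>) xs" by (simp add: xs_def sorted_wrt_rev)
  moreover have "\<forall>x\<in>set xs. 0 < x" using M
    by (auto simp: xs_def mset_partitions_def intro: gr0I)
  moreover have "sum_list xs = n"
    using M \<open>mset xs = M\<close> by (metis (mono_tags, lifting) mem_Collect_eq mset_partitions_def sum_mset_sum_list)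
  ultimately show "\<exists>xs\<in>partitions_of n. M = mset xs"
    by (auto simp: partitions_of_def)
qed

lemma finite_mset_partitions: "finite (mset_partitions n)"
  using bij_betw_finite[OF bij_betw_mset_partitions] finite_partitions_of by blast

definition num_partitions :: "nat \<Rightarrow> nat" where
  "num_partitions n = card (mset_partitions n)"

definition bounded_mset_partitions :: "nat \<Rightarrow> nat \<Rightarrow> nat multiset set" where
  "bounded_mset_partitions K n = {M. set_mset M \<subseteq> {1..K} \<and> sum_mset M = n}"

lemma bounded_mset_partitions_subset: "bounded_mset_partitions K n \<subseteq> mset_partitions n"
  by (auto simp: bounded_mset_partitions_def mset_partitions_def)

lemma finite_bounded_mset_partitions: "finite (bounded_mset_partitions K n)"
  using finite_subset[OF bounded_mset_partitions_subset finite_mset_partitions] .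

lemma member_le_sum_mset: "x \<in># M \<Longrightarrow> x \<le> sum_mset (M :: nat multiset)"
  by (metis le_add1 multi_member_split sum_mset.add_mset)

lemma bounded_mset_partitions_eq: "n \<le> K \<Longrightarrow> bounded_mset_partitions K n = mset_partitions n"
  unfolding bounded_mset_partitions_def mset_partitions_def
  by (auto simp: subset_iff Suc_le_eq intro!: gr0I dest: member_le_sum_mset)

text \<open>Taking away \<open>k\<close> copies of \<open>s\<close> is a bijection onto the
  partitions of n - k s; adding them back is the inverse.\<close>

lemma card_count_ge:
  assumes "s > 0"
  shows "card {M \<in> mset_partitions n. k \<le> count M s} =
     (if k * s \<le> n then num_partitions (n - k * s) else 0)"
proof -
  have le: "k * s \<le> n" if "M \<in> mset_partitions n" "k \<le> count M s" for M
  proof -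
    have "replicate_mset k s \<subseteq># M" using that by (simp add: count_le_replicate_mset_subset_eq)
    then obtain L where "M = replicate_mset k s + L" by (metis subset_mset.le_iff_add)
    then show ?thesis using that by (auto simp: mset_partitions_def sum_mset_replicate_mset)
  qed
  show ?thesis
  proof (cases "k * s \<le> n")
    case True
    have "bij_betw (\<lambda>L. L + replicate_mset k s) (mset_partitions (n - k * s))
       {M \<in> mset_partitions n. k \<le> count M s}"
    proof (rule bij_betw_byWitness[where f' = "\<lambda>M. M - replicate_mset k s"])
      show "\<forall>M\<in>{M \<in> mset_partitions n. k \<le> count M s}. M - replicate_mset k s + replicate_mset k s = M"
        by (auto simp: count_le_replicate_mset_subset_eq)
      show "(\<lambda>L. L + replicate_mset k s) ` mset_partitions (n - k * s)
         \<subseteq> {M \<in> mset_partitions n. k \<le> count M s}"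
        using True assms by (auto simp: mset_partitions_def split: if_splits)
      show "(\<lambda>M. M - replicate_mset k s) ` {M \<in> mset_partitions n. k \<le> count M s}
          \<subseteq> mset_partitions (n - k * s)"
      proof clarify
        fix M assume M: "M \<in> mset_partitions n" "k \<le> count M s"
        then obtain L where "M = replicate_mset k s + L"
          by (metis subset_mset.le_iff_add count_le_replicate_mset_subset_eq)
        then show "M - replicate_mset k s \<in> mset_partitions (n - k * s)" using M
          by (auto simp: mset_partitions_def sum_mset_replicate_mset)
      qed
    qed auto
    then show ?thesis using True by (simp add: num_partitions_def bij_betw_same_card)
  next
    case False
    then have "{M \<in> mset_partitions n. k \<le> count M s} = {}" using le by blast
    then show ?thesis using False by (simp only: card.empty if_False)
  qed
qed

lemma card_indices_eq: "card {j. j < length xs \<and> P (xs ! j)} = size (filter_mset P (mset xs))"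
  by (metis length_filter_conv_card mset_filter size_mset)

text \<open>A multiplicity is the number of k >= 1 that do not exceed it. After an exchange of sums,
  each pair (s, k) asks for the number of partitions containing s at least k times, which
  \<open>card_count_ge\<close> supplies.\<close>

lemma T0_eq_sum:
  assumes "N > 0"
  shows "T0 N n = (\<Sum>s\<in>{s\<in>{1..n}. N dvd s}. \<Sum>k\<in>{1..n}.
            (if k * s \<le> n then num_partitions (n - k * s) else 0))"
proof -
  let ?S = "{s\<in>{1..n}. N dvd s}"
  have size: "size (filter_mset (\<lambda>x. x mod N = 0) M) = (\<Sum>s\<in>?S. \<Sum>k\<in>{1..n}. of_bool (k \<le> count M s))"
    if M: "M \<in> mset_partitions n" for M
  proof -
    \<comment> \<open>Multiplicities are at most \<open>n\<close>, so k can run over the same range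
      1..n for all partitions and the sums can be exchanged.\<close>
    have le: "count M s \<le> n" for s
    proof (cases "s = 0")
      case False
      define c where "c = count M s"
      have "replicate_mset c s \<subseteq># M" by (simp add: c_def count_le_replicate_mset_subset_eq [symmetric])
      then obtain L where "M = replicate_mset c s + L" by (metis subset_mset.le_iff_add)
      then have "c * s \<le> n" using M by (auto simp: mset_partitions_def)
      moreover have "c * 1 \<le> c * s" using False by (intro mult_le_mono2) simp
      ultimately show ?thesis unfolding c_def by linarith
    qed (use M in \<open>auto simp: mset_partitions_def not_in_iff\<close>)
    have "size (filter_mset (\<lambda>x. x mod N = 0) M) = (\<Sum>s\<in>set_mset (filter_mset (\<lambda>x. x mod N = 0) M). count M s)"
      unfolding size_multiset_overloaded_eq by (intro sum.cong) auto
    also have "\<dots> = (\<Sum>s\<in>?S. count M s)"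
    proof (rule sum.mono_neutral_left)
      show "set_mset (filter_mset (\<lambda>x. x mod N = 0) M) \<subseteq> ?S"
        using M by (auto simp: mset_partitions_def Suc_le_eq intro!: gr0I dest: member_le_sum_mset)
    qed (auto simp: not_in_iff)
    also have "\<dots> = (\<Sum>s\<in>?S. \<Sum>k\<in>{1..n}. of_bool (k \<le> count M s))"
    proof (intro sum.cong refl)
      fix s
      have "(\<Sum>k\<in>{1..n}. of_bool (k \<le> count M s)) = card {k \<in> {1..n}. k \<le> count M s}"
        by (simp add: of_bool_def sum.If_cases Int_def)
      also have "{k \<in> {1..n}. k \<le> count M s} = {1..count M s}" using le[of s] by auto
      finally show "count M s = (\<Sum>k\<in>{1..n}. of_bool (k \<le> count M s))" by simp
    qed
    finally show ?thesis .
  qed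
  have "T0 N n = (\<Sum>xs\<in>partitions_of n. size (filter_mset (\<lambda>x. x mod N = 0) (mset xs)))"
    unfolding T0_def by (intro sum.cong refl card_indices_eq)
  also have "\<dots> = (\<Sum>M\<in>mset_partitions n. size (filter_mset (\<lambda>x. x mod N = 0) M))"
    by (rule sum.reindex_bij_betw[OF bij_betw_mset_partitions])
  also have "\<dots> = (\<Sum>M\<in>mset_partitions n. \<Sum>s\<in>?S. \<Sum>k\<in>{1..n}. of_bool (k \<le> count M s))"
    by (intro sum.cong refl size)
  also have "\<dots> = (\<Sum>s\<in>?S. \<Sum>k\<in>{1..n}. \<Sum>M\<in>mset_partitions n. of_bool (k \<le> count M s))"
    by (subst sum.swap, intro sum.cong refl, subst sum.swap, rule refl)
  also have "\<dots> = (\<Sum>s\<in>?S. \<Sum>k\<in>{1..n}. card {M \<in> mset_partitions n. k \<le> count M s})"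
    by (intro sum.cong refl) (simp add: of_bool_def sum.If_cases Int_def finite_mset_partitions)
  also have "\<dots> = (\<Sum>s\<in>?S. \<Sum>k\<in>{1..n}. (if k * s \<le> n then num_partitions (n - k * s) else 0))"
    by (intro sum.cong refl card_count_ge) auto
  finally show ?thesis .
qed

text \<open>Used for both generating functions. As the coefficients are nonnegative, boundedness of
  the \<open>G K\<close> at the real point |z| bounds all partial sums of the limit series there.
  That series then dominates the truncated ones, and Tannery's theorem gives the limit in
  \<open>K\<close>.\<close>

lemma truncated_power_series_limit:
  fixes a :: "nat \<Rightarrow> nat" and b :: "nat \<Rightarrow> nat \<Rightarrow> nat" and G :: "nat \<Rightarrow> complex \<Rightarrow> complex"
  assumes le: "\<And>K n. b K n \<le> a n"
    and eq: "\<And>K n. n \<le> K \<Longrightarrow> b K n = a n"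
    and sums: "\<And>K z. norm z < 1 \<Longrightarrow> (\<lambda>n. of_nat (b K n) * z ^ n) sums G K z"
    and bound: "\<And>x. 0 \<le> x \<Longrightarrow> x < 1 \<Longrightarrow> \<exists>B. \<forall>K. norm (G K (of_real x)) \<le> B"
    and z: "norm z < 1"
  shows "summable (\<lambda>n. norm (of_nat (a n) * z ^ n))"
    and "(\<lambda>K. G K z) \<longlonglongrightarrow> (\<Sum>n. of_nat (a n) * z ^ n)"
proof -
  define x where "x = norm z"
  obtain B where B: "\<And>K. norm (G K (of_real x)) \<le> B"
    using bound[of x] z by (auto simp: x_def)
  have summ: "summable (\<lambda>n. real (a n) * x ^ n)"
  proof (rule bounded_imp_summable)
    fix m
    have s: "(\<lambda>n. of_nat (b m n) * (of_real x) ^ n) sums (G m (of_real x) :: complex)"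
      by (rule sums) (use z in \<open>simp add: x_def\<close>)
    then have s': "(\<lambda>n. real (b m n) * x ^ n) sums Re (G m (of_real x))"
      using sums_Re[OF s] by (simp flip: of_real_power)
    \<comment> \<open>Choosing the truncation equal to the length of the partial sum makes the
      coefficients agree.\<close>
    have "(\<Sum>n\<le>m. real (a n) * x ^ n) = (\<Sum>n\<le>m. real (b m n) * x ^ n)"
      by (simp add: eq)
    also have "\<dots> \<le> (\<Sum>n. real (b m n) * x ^ n)"
      using s' by (intro sum_le_suminf) (auto simp: sums_iff x_def)
    also have "\<dots> = Re (G m (of_real x))" using s' by (simp add: sums_iff)
    also have "\<dots> \<le> B" using B[of m] complex_Re_le_cmod order_trans by blast
    finally show "(\<Sum>n\<le>m. real (a n) * x ^ n) \<le> B" .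
  qed (simp add: x_def)
  then show "summable (\<lambda>n. norm (of_nat (a n) * z ^ n))"
    by (simp add: norm_mult norm_power x_def)
  have "(\<lambda>K. \<Sum>n. of_nat (b K n) * z ^ n) \<longlonglongrightarrow> (\<Sum>n. of_nat (a n) * z ^ n)"
  proof (rule tannerys_theorem[THEN conjunct2, THEN conjunct2])
    show "(\<lambda>K. of_nat (b K n) * z ^ n) \<longlonglongrightarrow> of_nat (a n) * z ^ n" for n
      using eventually_ge_at_top[of n] by (intro tendsto_eventually eventually_mono[OF eventually_ge_at_top[of n]]) (simp add: eq)
    show "\<forall>\<^sub>F (n, K) in at_top \<times>\<^sub>F sequentially. norm (of_nat (b K n) * z ^ n) \<le> real (a n) * x ^ n"
      by (intro always_eventually)
        (auto simp: norm_mult norm_power x_def intro!: mult_right_mono le)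
  qed (use summ in auto)
  then show "(\<lambda>K. G K z) \<longlonglongrightarrow> (\<Sum>n. of_nat (a n) * z ^ n)"
    using sums[OF z] by (simp add: sums_iff)
qed

section \<open>Partitions into bounded parts and the finite products\<close>

definition num_bounded_partitions :: "nat \<Rightarrow> nat \<Rightarrow> nat" where
  "num_bounded_partitions K n = card (bounded_mset_partitions K n)"

lemma num_bounded_partitions_0: "num_bounded_partitions 0 n = of_bool (n = 0)"
proof -
  have "bounded_mset_partitions 0 n = (if n = 0 then {{#}} else {})"
    by (auto simp: bounded_mset_partitions_def)
  then show ?thesis by (simp add: num_bounded_partitions_def)
qed

text \<open>Either the part \<open>Suc K\<close> does not occur, or one copy of it can be
  removed.\<close>

lemma num_bounded_partitions_Suc:
  "num_bounded_partitions (Suc K) n = num_bounded_partitions K n + (if Suc K \<le> n then num_bounded_partitions (Suc K) (n - Suc K) else 0)"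
proof -
  let ?A = "{M \<in> bounded_mset_partitions (Suc K) n. Suc K \<in># M}"
  have *: "bounded_mset_partitions (Suc K) n = bounded_mset_partitions K n \<union> ?A"
    by (auto simp: bounded_mset_partitions_def subset_iff le_Suc_eq)
  have disj: "bounded_mset_partitions K n \<inter> ?A = {}"
    by (auto simp: bounded_mset_partitions_def subset_iff)
  have fin: "finite ?A" using finite_bounded_mset_partitions by simp
  have "card ?A = (if Suc K \<le> n then num_bounded_partitions (Suc K) (n - Suc K) else 0)"
  proof (cases "Suc K \<le> n")
    case True
    have "bij_betw (add_mset (Suc K)) (bounded_mset_partitions (Suc K) (n - Suc K)) ?A"
    proof (rule bij_betw_byWitness[where f' = "\<lambda>M. M - {#Suc K#}"])
      show "add_mset (Suc K) ` bounded_mset_partitions (Suc K) (n - Suc K) \<subseteq> ?A"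
        using True by (auto simp: bounded_mset_partitions_def)
      show "(\<lambda>M. M - {#Suc K#}) ` ?A \<subseteq> bounded_mset_partitions (Suc K) (n - Suc K)"
        by (auto simp: bounded_mset_partitions_def sum_mset.remove dest: in_diffD)
    qed auto
    then show ?thesis using True by (simp add: num_bounded_partitions_def bij_betw_same_card)
  next
    case False
    then have "?A = {}" using member_le_sum_mset by (auto simp: bounded_mset_partitions_def)
    then show ?thesis using False by (simp only: card.empty if_False)
  qed
  moreover have "num_bounded_partitions (Suc K) n = card (bounded_mset_partitions K n) + card ?A"
    unfolding num_bounded_partitions_def
    by (subst *, rule card_Un_disjoint[OF finite_bounded_mset_partitions fin disj])
  ultimately show ?thesis by (simp add: num_bounded_partitions_def)
qed

text \<open>Summing the recurrence against z^n gives Q = P + z^(K+1) Q, which is solved for Q. This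
  presupposes that Q converges; the same relation for partial sums at |z|, read as an inequality,
  supplies that.\<close>

lemma num_bounded_partitions_sums:
  fixes z :: complex
  assumes "norm z < 1"
  shows "summable (\<lambda>n. norm (of_nat (num_bounded_partitions K n) * z ^ n))"
    and "(\<lambda>n. of_nat (num_bounded_partitions K n) * z ^ n) sums (\<Prod>m=1..K. inverse (1 - z ^ m))"
proof (induction K)
  case 0
  have "(\<lambda>n. of_nat (num_bounded_partitions 0 n) * z ^ n) = (\<lambda>n. if n = 0 then 1 else 0)"
    by (auto simp: num_bounded_partitions_0)
  note eq = this
  have "(\<lambda>n. if n = 0 then 1 else (0::complex)) sums 1"
    using sums_single[of 0 "\<lambda>_. 1::complex"] by simp
  moreover have "(\<lambda>n. norm (if n = 0 then 1 else (0::complex))) sums 1"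
    using sums_single[of 0 "\<lambda>_. 1::real"] by (simp add: if_distrib cong: if_cong)
  ultimately show "(\<lambda>n. of_nat (num_bounded_partitions 0 n) * z ^ n) sums (\<Prod>m=1..0. inverse (1 - z ^ m))"
    "summable (\<lambda>n. norm (of_nat (num_bounded_partitions 0 n) * z ^ n))"
    unfolding eq fun_cong[OF eq] by (simp_all only: sums_iff) simp
next
  case (Suc K)
  define x where "x = norm z"
  have x: "0 \<le> x" "x < 1" using assms by (auto simp: x_def)
  have pw: "x ^ Suc K < 1" using x by (simp add: power_less_one_iff del: power_Suc)
  let ?p = "\<lambda>n. real (num_bounded_partitions K n) * x ^ n" and ?q = "\<lambda>n. real (num_bounded_partitions (Suc K) n) * x ^ n"
  have sp: "summable ?p" using Suc.IH(1) by (simp add: norm_mult norm_power x_def)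
  have q: "?q n = ?p n + (if Suc K \<le> n then x ^ Suc K * ?q (n - Suc K) else 0)" for n
    by (subst num_bounded_partitions_Suc) (simp add: algebra_simps flip: power_add del: power_Suc)
  \<comment> \<open>A shifted partial sum is a shorter partial sum, so for nonnegative terms it does
    not exceed the original one.\<close>
  have shift: "(\<Sum>n<m. if Suc K \<le> n then f (n - Suc K) else 0) \<le> (\<Sum>n<m. f n)"
    if "\<And>n. 0 \<le> f n" for f :: "nat \<Rightarrow> real" and m
  proof -
    have "(\<Sum>n<m. if Suc K \<le> n then f (n - Suc K) else 0) = (\<Sum>n\<in>{Suc K..<m}. f (n - Suc K))"
      by (rule sum.mono_neutral_cong_right) auto
    also have "\<dots> = (\<Sum>n<m - Suc K. f n)"
      by (rule sum.reindex_bij_witness[of _ "\<lambda>n. n + Suc K" "\<lambda>n. n - Suc K"]) auto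
    also have "\<dots> \<le> (\<Sum>n<m. f n)" by (rule sum_mono2) (use that in auto)
    finally show ?thesis .
  qed
  have "summable ?q"
  proof (rule summableI_nonneg_bounded[where x = "suminf ?p / (1 - x ^ Suc K)"])
    fix m
    have "(\<Sum>n<m. ?q n) = (\<Sum>n<m. ?p n) + (\<Sum>n<m. if Suc K \<le> n then x ^ Suc K * ?q (n - Suc K) else 0)"
      by (subst q) (rule sum.distrib)
    also have "\<dots> \<le> suminf ?p + (\<Sum>n<m. x ^ Suc K * ?q n)"
      using x by (intro add_mono sum_le_suminf[OF sp] shift) auto
    also have "\<dots> = suminf ?p + x ^ Suc K * (\<Sum>n<m. ?q n)" by (simp only: sum_distrib_left)
    finally have "(\<Sum>n<m. ?q n) * (1 - x ^ Suc K) \<le> suminf ?p" by (simp add: algebra_simps)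
    then show "(\<Sum>n<m. ?q n) \<le> suminf ?p / (1 - x ^ Suc K)"
      using pw by (subst pos_le_divide_eq) auto
  qed (use x in auto)
  then show s: "summable (\<lambda>n. norm (of_nat (num_bounded_partitions (Suc K) n) * z ^ n))"
    by (simp add: norm_mult norm_power x_def)
  let ?Q = "\<lambda>n. of_nat (num_bounded_partitions (Suc K) n) * z ^ n"
  have Qs: "?Q sums suminf ?Q" using summable_norm_cancel[OF s] by (simp add: sums_iff)
  have "(\<lambda>n. z ^ Suc K * ?Q n) sums (z ^ Suc K * suminf ?Q)" by (rule sums_mult[OF Qs])
  then have "(\<lambda>n. if Suc K \<le> n then z ^ Suc K * ?Q (n - Suc K) else 0) sums (z ^ Suc K * suminf ?Q)"
  proof (subst sums_mono_reindex[of "\<lambda>n. n + Suc K", symmetric])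
    fix n assume "n \<notin> range (\<lambda>n. n + Suc K)"
    then have "\<not> Suc K \<le> n" by (metis le_add_diff_inverse2 rangeI)
    then show "(if Suc K \<le> n then z ^ Suc K * ?Q (n - Suc K) else 0) = 0" by (simp only: if_False)
  qed (simp_all add: strict_mono_def)
  from sums_add[OF Suc.IH(2) this] have "?Q sums ((\<Prod>m=1..K. inverse (1 - z ^ m)) + z ^ Suc K * suminf ?Q)"
  proof (rule sums_cong[THEN iffD1, rotated])
    fix n show "of_nat (num_bounded_partitions K n) * z ^ n + (if Suc K \<le> n then z ^ Suc K * ?Q (n - Suc K) else 0) = ?Q n"
      by (subst num_bounded_partitions_Suc[of K n]) (simp add: algebra_simps flip: power_add del: power_Suc)
  qed
  then have "suminf ?Q = (\<Prod>m=1..K. inverse (1 - z ^ m)) + z ^ Suc K * suminf ?Q"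
    by (simp add: sums_iff)
  moreover have "z ^ Suc K \<noteq> 1"
    using pw by (metis less_irrefl norm_one norm_power x_def)
  ultimately have "suminf ?Q = (\<Prod>m=1..K. inverse (1 - z ^ m)) * inverse (1 - z ^ Suc K)"
    by (simp add: field_simps del: power_Suc)
  then show "?Q sums (\<Prod>m=1..Suc K. inverse (1 - z ^ m))" using Qs by simp
qed

lemma inverse_one_minus_le_exp:
  fixes u :: real
  assumes "0 \<le> u" "u < 1"
  shows "inverse (1 - u) \<le> exp (u / (1 - u))"
proof -
  have "inverse (1 - u) = 1 + u / (1 - u)" using assms by (simp add: field_simps)
  then show ?thesis using exp_ge_add_one_self by metis
qed

text \<open>A crude bound, but uniform in \<open>K\<close>, as
  \<open>truncated_power_series_limit\<close> requires. It serves the Lambert series directly and,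
  with N = 1 and \<open>inverse_one_minus_le_exp\<close>, the partition product.\<close>

lemma lambert_sum_le:
  fixes x :: real
  assumes "0 \<le> x" "x < 1" "N > 0"
  shows "(\<Sum>m=1..K. x ^ (N * m) / (1 - x ^ (N * m))) \<le> 1 / (1 - x) ^ 2"
proof -
  have "(\<Sum>m=1..K. x ^ (N * m) / (1 - x ^ (N * m))) \<le> (\<Sum>m=1..K. x ^ m / (1 - x))"
  proof (intro sum_mono frac_le diff_left_mono)
    fix m assume m: "m \<in> {1..K}"
    have "1 * m \<le> N * m" using assms(3) by (intro mult_right_mono) auto
    then have "m \<le> N * m" "1 \<le> N * m" using m by auto
    then show "x ^ (N * m) \<le> x ^ m" "x ^ (N * m) \<le> x"
      using assms power_decreasing[of m "N*m" x] power_decreasing[of 1 "N*m" x] by auto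
  qed (use assms in auto)
  also have "\<dots> = (\<Sum>m=1..K. x ^ m) / (1 - x)" by (simp add: sum_divide_distrib)
  also have "(\<Sum>m=1..K. x ^ m) \<le> (\<Sum>m. x ^ m)"
    by (intro sum_le_suminf) (use assms in \<open>auto intro: summable_geometric\<close>)
  also have "(\<Sum>m. x ^ m) = 1 / (1 - x)" using assms by (subst suminf_geometric) auto
  finally show ?thesis using assms by (simp add: divide_right_mono power2_eq_square)
qed

definition partition_gf :: "complex \<Rightarrow> complex" where
  "partition_gf z = (\<Sum>n. of_nat (num_partitions n) * z ^ n)"

lemma partition_gf_product:
  assumes z: "norm z < 1"
  shows "summable (\<lambda>n. norm (of_nat (num_partitions n) * z ^ n))"
    and "(\<lambda>K. \<Prod>m=1..K. inverse (1 - z ^ m)) \<longlonglongrightarrow> partition_gf z"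
proof -
  have le: "num_bounded_partitions K n \<le> num_partitions n" for K n
    unfolding num_bounded_partitions_def num_partitions_def
    by (intro card_mono finite_mset_partitions bounded_mset_partitions_subset)
  have eq: "n \<le> K \<Longrightarrow> num_bounded_partitions K n = num_partitions n" for K n
    by (simp add: num_bounded_partitions_def num_partitions_def bounded_mset_partitions_eq)
  have bd: "\<exists>B. \<forall>K. norm (\<Prod>m=1..K. inverse (1 - complex_of_real x ^ m)) \<le> B" if x: "0 \<le> x" "x < 1" for x
  proof (intro exI allI)
    fix K
    have xm: "0 \<le> x ^ m" "m \<ge> 1 \<Longrightarrow> x ^ m < 1" for m using x by (auto simp: power_less_one_iff)
    have "norm (\<Prod>m=1..K. inverse (1 - complex_of_real x ^ m)) = (\<Prod>m=1..K. inverse \<bar>1 - x ^ m\<bar>)"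
      unfolding prod_norm[symmetric]
    proof (intro prod.cong refl)
      fix m
      have "1 - complex_of_real x ^ m = of_real (1 - x ^ m)" by simp
      then show "norm (inverse (1 - complex_of_real x ^ m)) = inverse \<bar>1 - x ^ m\<bar>"
        by (simp only: norm_inverse norm_of_real)
    qed
    also have "\<dots> \<le> (\<Prod>m=1..K. exp (x ^ (1 * m) / (1 - x ^ (1 * m))))"
    proof (rule prod_mono)
      fix m assume "m \<in> {1..K}"
      then have "x ^ m < 1" using xm(2) by simp
      then have "\<bar>1 - x ^ m\<bar> = 1 - x ^ m" "0 \<le> inverse (1 - x ^ m)" by simp_all
      then show "0 \<le> inverse \<bar>1 - x ^ m\<bar> \<and> inverse \<bar>1 - x ^ m\<bar> \<le> exp (x ^ (1 * m) / (1 - x ^ (1 * m)))"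
        using inverse_one_minus_le_exp[OF xm(1) \<open>x ^ m < 1\<close>] by (simp only: mult_1 simp_thms)
    qed
    also have "\<dots> = exp (\<Sum>m=1..K. x ^ (1 * m) / (1 - x ^ (1 * m)))" by (simp add: exp_sum)
    also have "\<dots> \<le> exp (1 / (1 - x) ^ 2)" using lambert_sum_le[OF x, of 1 K] by simp
    finally show "norm (\<Prod>m=1..K. inverse (1 - complex_of_real x ^ m)) \<le> exp (1 / (1 - x) ^ 2)" .
  qed
  note * = truncated_power_series_limit[OF le eq num_bounded_partitions_sums(2) bd z]
  show "summable (\<lambda>n. norm (of_nat (num_partitions n) * z ^ n))" by (rule *(1))
  show "(\<lambda>K. \<Prod>m=1..K. inverse (1 - z ^ m)) \<longlonglongrightarrow> partition_gf z"
    unfolding partition_gf_def by (rule *(2))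
qed

section \<open>Divisor sums and the factorisation of the generating function\<close>

definition num_divisors_upto :: "nat \<Rightarrow> nat \<Rightarrow> nat \<Rightarrow> nat" where
  "num_divisors_upto N K i = (\<Sum>j=1..K. of_bool (i > 0 \<and> N * j dvd i))"

text \<open>For \<open>n\<close> > 0 the diagonal value \<open>num_divisors_upto N n n\<close> is
  the number of divisors of \<open>n\<close> that are multiples of \<open>N\<close>. The condition i
  > 0 in the definition excludes 0, which every N j divides.\<close>

lemma num_divisors_upto_eq:
  assumes "N > 0" "n \<le> K"
  shows "num_divisors_upto N K n = num_divisors_upto N n n"
  unfolding num_divisors_upto_def
proof (rule sum.mono_neutral_right)
  have "j \<le> n" if "0 < n" "N * j dvd n" for j
  proof -
    have "N * j \<le> n" using that by (auto dest: dvd_imp_le)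
    moreover have "1 * j \<le> N * j" using assms by (intro mult_right_mono) auto
    ultimately show ?thesis by linarith
  qed
  then show "\<forall>j\<in>{1..K} - {1..n}. of_bool (0 < n \<and> N * j dvd n) = (0::nat)" by auto
qed (use assms in auto)

lemma multiples_sums:
  fixes z :: complex
  assumes "norm z < 1" "s > 0"
  shows "(\<lambda>i. of_bool (i > 0 \<and> s dvd i) * z ^ i) sums (z ^ s / (1 - z ^ s))"
proof -
  have "norm (z ^ s) < 1" using assms by (simp add: norm_power power_less_one_iff)
  from sums_mult[OF geometric_sums[OF this], of "z ^ s"]
  have "(\<lambda>k. z ^ (s * Suc k)) sums (z ^ s / (1 - z ^ s))" 
    by (simp add: power_mult power_add)
  then have "(\<lambda>k. of_bool (s * Suc k > 0 \<and> s dvd s * Suc k) * z ^ (s * Suc k)) sums (z ^ s / (1 - z ^ s))"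
    using assms by simp
  then show ?thesis
  proof (rule sums_mono_reindex[THEN iffD1, rotated 2])
    show "strict_mono (\<lambda>k. s * Suc k)" using assms by (auto simp: strict_mono_def)
    fix n assume n: "n \<notin> range (\<lambda>k. s * Suc k)"
    have "\<not> (n > 0 \<and> s dvd n)"
    proof
      assume "n > 0 \<and> s dvd n"
      then obtain k where "n = s * k" "k > 0" by (auto elim!: dvdE)
      then have "n = s * Suc (k - 1)" by simp
      then show False using n by blast
    qed
    then show "of_bool (n > 0 \<and> s dvd n) * z ^ n = 0" by simp
  qed
qed

lemma divisor_series:
  fixes z :: complex
  assumes N: "N > 0" and z: "norm z < 1"
  shows "summable (\<lambda>i. norm (of_nat (num_divisors_upto N i i) * z ^ i))"
    and "(\<lambda>K. \<Sum>j=1..K. z ^ (N * j) / (1 - z ^ (N * j))) \<longlonglongrightarrow>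
       (\<Sum>i. of_nat (num_divisors_upto N i i) * z ^ i)"
proof -
  note eq = num_divisors_upto_eq[OF N]
  have le: "num_divisors_upto N K n \<le> num_divisors_upto N n n" for K n
  proof (cases "n \<le> K")
    case False
    then show ?thesis unfolding num_divisors_upto_def by (intro sum_mono2) auto
  qed (simp only: eq[symmetric] order_refl)
  have sums: "(\<lambda>n. of_nat (num_divisors_upto N K n) * z ^ n) sums (\<Sum>j=1..K. z ^ (N * j) / (1 - z ^ (N * j)))"
    if "norm z < 1" for K and z :: complex
  proof -
    have "(\<lambda>n. \<Sum>j=1..K. of_bool (n > 0 \<and> N * j dvd n) * z ^ n) sums (\<Sum>j=1..K. z ^ (N * j) / (1 - z ^ (N * j)))"
      by (intro sums_sum multiples_sums that) (use N in auto)
    then show ?thesis by (simp add: num_divisors_upto_def sum_distrib_right)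
  qed
  have bd: "\<exists>B. \<forall>K. norm (\<Sum>j=1..K. complex_of_real x ^ (N * j) / (1 - complex_of_real x ^ (N * j))) \<le> B"
    if x: "0 \<le> x" "x < 1" for x
  proof (intro exI allI)
    fix K
    have "(\<Sum>j=1..K. complex_of_real x ^ (N * j) / (1 - complex_of_real x ^ (N * j)))
      = of_real (\<Sum>j=1..K. x ^ (N * j) / (1 - x ^ (N * j)))" by simp
    moreover have "x ^ (N * j) \<le> 1" for j using x by (simp add: power_le_one)
    then have "0 \<le> (\<Sum>j=1..K. x ^ (N * j) / (1 - x ^ (N * j)))" using x by (intro sum_nonneg) auto
    ultimately show "norm (\<Sum>j=1..K. complex_of_real x ^ (N * j) / (1 - complex_of_real x ^ (N * j))) \<le> 1 / (1 - x) ^ 2"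
      using lambert_sum_le[OF x N, of K] by (simp only: norm_of_real abs_of_nonneg)
  qed
  note * = truncated_power_series_limit[where b = "num_divisors_upto N" and a = "\<lambda>n. num_divisors_upto N n n", OF le eq sums bd z]
  show "summable (\<lambda>i. norm (of_nat (num_divisors_upto N i i) * z ^ i))" by (rule *(1))
  show "(\<lambda>K. \<Sum>j=1..K. z ^ (N * j) / (1 - z ^ (N * j))) \<longlonglongrightarrow>
       (\<Sum>i. of_nat (num_divisors_upto N i i) * z ^ i)" by (rule *(2))
qed

text \<open>In \<open>T0_eq_sum\<close> the total i = k s of the removed copies becomes the
  summation variable. For fixed s, the k with k s <= n correspond to the positive multiples i <= n
  of s; writing s = N j then counts, for each i, the j with N j dividing i.\<close>

lemma T0_convolution:
  assumes N: "N > 0"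
  shows "T0 N n = (\<Sum>i\<le>n. num_divisors_upto N i i * num_partitions (n - i))"
proof -
  define g where "g s = (\<Sum>i\<le>n. of_bool (i > 0 \<and> s dvd i) * num_partitions (n - i))" for s
  have g: "(\<Sum>k\<in>{1..n}. (if k * s \<le> n then num_partitions (n - k * s) else 0)) = g s" if "s > 0" for s
  proof -
    have "(\<Sum>k\<in>{1..n}. (if k * s \<le> n then num_partitions (n - k * s) else 0))
       = (\<Sum>k\<in>{k\<in>{1..n}. k * s \<le> n}. num_partitions (n - k * s))"
      by (rule sum.mono_neutral_cong_right) auto
    also have "\<dots> = (\<Sum>i\<in>{i\<in>{..n}. i > 0 \<and> s dvd i}. num_partitions (n - i))"
      using that
      by (intro sum.reindex_bij_witness[of _ "\<lambda>i. i div s" "\<lambda>k. k * s"])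
         (auto simp: Suc_le_eq div_greater_zero_iff dvd_imp_le dvd_div_mult_self intro: div_le_dividend order_trans[OF div_le_dividend])
    also have "\<dots> = g s" unfolding g_def by (rule sum.mono_neutral_cong_left) auto
    finally show ?thesis .
  qed
  have "T0 N n = (\<Sum>s\<in>{s\<in>{1..n}. N dvd s}. g s)"
    unfolding T0_eq_sum[OF N] by (intro sum.cong refl g) auto
  also have "\<dots> = (\<Sum>j\<in>{j\<in>{1..n}. N * j \<le> n}. g (N * j))"
    using N by (intro sum.reindex_bij_witness[of _ "\<lambda>j. N * j" "\<lambda>s. s div N"])
       (auto simp: Suc_le_eq div_greater_zero_iff dvd_imp_le intro: order_trans[OF div_le_dividend])
  also have "\<dots> = (\<Sum>j\<in>{1..n}. g (N * j))"
  proof (rule sum.mono_neutral_left)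
    show "\<forall>j\<in>{1..n} - {j \<in> {1..n}. N * j \<le> n}. g (N * j) = 0"
      by (auto simp: g_def dest: dvd_imp_le)
  qed auto
  also have "\<dots> = (\<Sum>i\<le>n. (\<Sum>j=1..n. of_bool (i > 0 \<and> N * j dvd i)) * num_partitions (n - i))"
    unfolding g_def by (subst sum.swap) (simp add: sum_distrib_right)
  also have "\<dots> = (\<Sum>i\<le>n. num_divisors_upto N i i * num_partitions (n - i))"
  proof (intro sum.cong refl arg_cong2[where f = "(*)"])
    fix i assume "i \<in> {..n}"
    then show "(\<Sum>j=1..n. of_bool (i > 0 \<and> N * j dvd i)) = num_divisors_upto N i i"
      using num_divisors_upto_eq[OF N, of i n] by (simp add: num_divisors_upto_def)
  qed
  finally show ?thesis .
qed

definition divisor_gf :: "nat \<Rightarrow> complex \<Rightarrow> complex" where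
  "divisor_gf N z = (\<Sum>i. of_nat (num_divisors_upto N i i) * z ^ i)"

lemma T0_sums:
  fixes z :: complex
  assumes N: "N > 0" and z: "norm z < 1"
  shows "(\<lambda>n. of_nat (T0 N n) * z ^ n) sums (partition_gf z * divisor_gf N z)"
proof -
  have "(\<lambda>n. \<Sum>i\<le>n. (of_nat (num_divisors_upto N i i) * z ^ i) * (of_nat (num_partitions (n - i)) * z ^ (n - i)))
     sums (divisor_gf N z * partition_gf z)"
    unfolding divisor_gf_def partition_gf_def
    by (intro Cauchy_product_sums divisor_series(1)[OF N z] partition_gf_product(1)[OF z])
  also have "(\<lambda>n. \<Sum>i\<le>n. (of_nat (num_divisors_upto N i i) * z ^ i) * (of_nat (num_partitions (n - i)) * z ^ (n - i)))
    = (\<lambda>n. of_nat (T0 N n) * z ^ n)"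
    unfolding T0_convolution[OF N] of_nat_sum sum_distrib_right
    by (intro ext sum.cong refl) (simp add: algebra_simps flip: power_add)
  finally show ?thesis by (simp add: mult.commute)
qed

section \<open>Stirling's formula\<close>

text \<open>The successive differences are O(1 / n^2), so the sequence converges; Wallis' product
  identifies the limit.\<close>

lemma stirling_ln_fact:
  "(\<lambda>n. ln (fact n) - (real n + 1/2) * ln (real n) + real n) \<longlonglongrightarrow> ln (2 * pi) / 2"
proof -
  define u where "u n = ln (fact n :: real) - (real n + 1/2) * ln (real n) + real n" for n
  have "(\<lambda>n. 1 - (real n + 1/2) * ln (1 + 1 / real n)) \<in> O(\<lambda>n. 1 / real n ^ 2)"
    by real_asymp
  moreover have "eventually (\<lambda>n. u (Suc n) - u n = 1 - (real n + 1/2) * ln (1 + 1 / real n) - ln 1) sequentially"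
    using eventually_gt_at_top[of 0]
  proof eventually_elim
    case (elim n)
    have "1 + 1 / real n = real (Suc n) / real n" using elim by (simp add: field_simps)
    then have B: "ln (real (Suc n)) = ln (real n) + ln (1 + 1 / real n)"
      using elim by (simp add: ln_div)
    have F: "ln (fact (Suc n) :: real) = ln (real (Suc n)) + ln (fact n)"
      using elim by (simp add: ln_mult del: of_nat_Suc)
    show ?case unfolding u_def F B by (simp add: algebra_simps)
  qed
  ultimately have "(\<lambda>n. u (Suc n) - u n) \<in> O(\<lambda>n. 1 / real n ^ 2)"
    by (subst landau_o.big.in_cong) (auto elim!: eventually_mono)
  moreover have "summable (\<lambda>n. norm (1 / real n ^ 2))"
    using inverse_power_summable[of 2, where 'a = real] by (simp add: field_simps)
  ultimately have "summable (\<lambda>n. u (Suc n) - u n)"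
    by (rule summable_comparison_test_bigo[rotated])
  then have "convergent (\<lambda>n. \<Sum>k<n. u (Suc k) - u k)"
    by (simp add: summable_iff_convergent)
  moreover have "(\<Sum>k<n. u (Suc k) - u k) = u n - u 0" for n by (rule sum_lessThan_telescope)
  ultimately have "convergent (\<lambda>n. u n - u 0 + u 0)"
    by (intro convergent_add convergent_const) simp
  then obtain L where L: "u \<longlonglongrightarrow> L" by (auto simp: convergent_def)
  \<comment> \<open>Wallis' product is 2^(4n) n!^4 / ((2n)!^2 (2n + 1)), so its logarithm involves 4
    u(n) - 2 u(2n). This combination tends to 2 L, which determines L.\<close>
  have W: "ln (\<Prod>k=1..n. (4*real k^2) / (4*real k^2 - 1)) =
     4 * u n - 2 * u (2 * n) + ln (real n) - ln 2 - ln (2 * real n + 1)" if "n > 0" for n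
  proof -
    have "(\<Prod>k=1..n. (4*real k^2) / (4*real k^2 - 1)) = 2 ^ (4*n) * fact n ^ 4 / (fact (2*n) ^ 2 * (2 * real n + 1))"
    proof (induction n)
      case (Suc n)
      have A: "4 * real (Suc n) ^ 2 - 1 = (2 * real n + 1) * (2 * real (Suc n) + 1)"
        by (simp add: power2_eq_square algebra_simps)
      have "2 * Suc n = Suc (Suc (2 * n))" by simp
      then have F2: "fact (2 * Suc n) = 2 * real (Suc n) * (2 * real n + 1) * (fact (2 * n) :: real)"
        by (simp only: fact_Suc) (simp add: algebra_simps)
      have F1: "fact (Suc n) = real (Suc n) * (fact n :: real)" by simp
      have P: "2 ^ (4 * Suc n) = 16 * (2 ^ (4 * n) :: real)" by (simp add: power_add)
      have frac: "p * f ^ 4 / (g ^ 2 * a) * (4 * c ^ 2 / (a * b)) = 16 * p * (c * f) ^ 4 / ((2 * c * a * g) ^ 2 * b)"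
        if "g > 0" "a > 0" "b > 0" "c > 0" for a b c p f g :: real
        using that by (simp add: field_simps power2_eq_square power4_eq_xxxx)
      have "(\<Prod>k=1..Suc n. (4*real k^2) / (4*real k^2 - 1)) =
         (\<Prod>k=1..n. (4*real k^2) / (4*real k^2 - 1)) * (4 * real (Suc n) ^ 2 / (4 * real (Suc n) ^ 2 - 1))"
        by (subst prod.nat_ivl_Suc') (simp_all only: mult.commute le_add2 Suc_eq_plus1)
      also have "\<dots> = 16 * 2 ^ (4*n) * (real (Suc n) * fact n) ^ 4 /
          ((2 * real (Suc n) * (2 * real n + 1) * fact (2 * n)) ^ 2 * (2 * real (Suc n) + 1))"
        unfolding Suc.IH A by (rule frac) auto
      finally show ?case unfolding F1 F2 P .
    qed simp
    then show ?thesis using that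
      by (simp add: ln_div ln_mult ln_realpow u_def) (simp add: algebra_simps)
  qed
  have "(\<lambda>n. ln (\<Prod>k=1..n. (4*real k^2) / (4*real k^2 - 1))) \<longlonglongrightarrow> ln (pi / 2)"
    by (intro tendsto_ln wallis) simp
  moreover have "(\<lambda>n. 4 * u n - 2 * u (2 * n) + (ln (real n) - ln (2 * real n + 1)) - ln 2) \<longlonglongrightarrow> 4 * L - 2 * L + - ln 2 - ln 2"
  proof (intro tendsto_intros L)
    show "(\<lambda>n. u (2 * n)) \<longlonglongrightarrow> L"
      by (rule LIMSEQ_subseq_LIMSEQ[OF L, unfolded o_def]) (simp add: strict_mono_def)
    show "(\<lambda>n. ln (real n) - ln (2 * real n + 1)) \<longlonglongrightarrow> - ln 2" by real_asymp
  qed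
  then have "(\<lambda>n. ln (\<Prod>k=1..n. (4*real k^2) / (4*real k^2 - 1))) \<longlonglongrightarrow> 4 * L - 2 * L + - ln 2 - ln 2"
  proof (rule Lim_transform_eventually)
    show "\<forall>\<^sub>F n in sequentially. 4 * u n - 2 * u (2 * n) + (ln (real n) - ln (2 * real n + 1)) - ln 2 =
      ln (\<Prod>k=1..n. (4*real k^2) / (4*real k^2 - 1))"
      using eventually_gt_at_top[of 0]
    proof eventually_elim
      case (elim n)
      show ?case unfolding W[OF elim] by simp
    qed
  qed
  ultimately have "ln (pi / 2) = 4 * L - 2 * L + - ln 2 - ln 2" by (rule LIMSEQ_unique)
  then have "L = ln (2 * pi) / 2" by (simp add: ln_mult ln_div)
  with L show ?thesis by (simp add: u_def[abs_def])
qed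

section \<open>The generating functions near the point 1\<close>

text \<open>In this wedge |w| and Re w are comparable. It is convex and closed under positive
  multiples, so it contains the segments from n w to (n + 1) w on which Taylor's theorem is
  applied.\<close>

definition sector :: "complex set" where
  "sector = {w. 0 < Re w \<and> \<bar>Im w\<bar> \<le> Re w}"

lemma convex_sector: "convex sector"
proof (rule convexI)
  fix x y u v assume *: "x \<in> sector" "y \<in> sector" "0 \<le> u" "0 \<le> v" "u + v = (1::real)"
  have "Re (u *\<^sub>R x + v *\<^sub>R y) > 0"
    using convexD[OF convex_halfspace_Re_gt[of 0], of x y u v] * by (simp add: sector_def)
  moreover have "\<bar>u * Im x + v * Im y\<bar> \<le> u * \<bar>Im x\<bar> + v * \<bar>Im y\<bar>"
    using * abs_triangle_ineq[of "u * Im x" "v * Im y"] by (simp add: abs_mult)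
  moreover have "\<dots> \<le> u * Re x + v * Re y"
    using * by (intro add_mono mult_left_mono) (auto simp: sector_def)
  ultimately show "u *\<^sub>R x + v *\<^sub>R y \<in> sector" by (simp add: sector_def)
qed

text \<open>The sharp constant is sqrt 2; 3/2 is a convenient rational bound for it.\<close>

lemma norm_le_sector: "w \<in> sector \<Longrightarrow> norm w \<le> 3/2 * Re w"
proof -
  assume w: "w \<in> sector"
  then have "Im w ^ 2 \<le> Re w ^ 2" by (simp add: sector_def abs_le_square_iff [symmetric])
  moreover have "(3/2 * Re w) ^ 2 = 9/4 * Re w ^ 2" by (simp add: power_mult_distrib power_divide)
  moreover have "0 \<le> Re w ^ 2" by simp
  ultimately have "norm w ^ 2 \<le> (3/2 * Re w) ^ 2" unfolding cmod_power2 by linarith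
  then show ?thesis by (rule power2_le_imp_le) (use w in \<open>auto simp: sector_def\<close>)
qed

lemma sector_scale: "w \<in> sector \<Longrightarrow> n > 0 \<Longrightarrow> of_nat n * w \<in> sector"
  by (simp add: sector_def abs_mult)

lemma of_real_in_sector: "t > 0 \<Longrightarrow> of_real t \<in> sector"
  by (simp add: sector_def)

text \<open>The logarithmic singularity of \<open>- Ln (1 - exp (- w))\<close> at 0 is split off, so that \<open>log_quot\<close>
  has bounded derivatives near 0; the sum of the remaining \<open>Ln (n w)\<close> is given by Stirling's formula.\<close>

definition log_quot :: "complex \<Rightarrow> complex" where
  "log_quot w = Ln w - Ln (1 - exp (- w))"

definition log_quot' :: "complex \<Rightarrow> complex" where
  "log_quot' w = 1 / w - 1 / (exp w - 1)"

definition log_quot'' :: "complex \<Rightarrow> complex" where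
  "log_quot'' w = exp w / (exp w - 1) ^ 2 - 1 / w ^ 2"

section \<open>Derivatives and bounds of \<open>log_quot\<close> in the sector\<close>

lemma exp_ne_1: "Re w > 0 \<Longrightarrow> exp w \<noteq> (1::complex)"
  by (metis norm_exp_eq_Re exp_eq_one_iff less_irrefl norm_one)

lemma one_minus_exp_nonpos: "Re w > 0 \<Longrightarrow> 1 - exp (- w) \<notin> \<real>\<^sub>\<le>\<^sub>0"
proof -
  assume "Re w > 0"
  then have "norm (exp (- w)) < 1" by simp
  then have "Re (exp (- w)) < 1" using complex_Re_le_cmod[of "exp (-w)"] by linarith
  then have "Re (1 - exp (- w)) > 0" unfolding minus_complex.simps one_complex.simps by linarith
  then show ?thesis by (auto simp: complex_nonpos_Reals_iff)
qed

lemma log_quot_deriv: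
  assumes "Re w > 0"
  shows "(log_quot has_field_derivative log_quot' w) (at w within A)"
    and "(log_quot' has_field_derivative log_quot'' w) (at w within A)"
proof -
  have ne: "exp w - 1 \<noteq> 0" "w \<noteq> 0" "w \<notin> \<real>\<^sub>\<le>\<^sub>0"
    using assms exp_ne_1 by (auto simp: complex_nonpos_Reals_iff)
  have ne': "1 - exp (- w) \<noteq> 0" using ne by (auto simp: exp_minus field_simps)
  have "(log_quot has_field_derivative (1 / w - (exp (- w)) / (1 - exp (- w)))) (at w within A)"
    unfolding log_quot_def
    using ne one_minus_exp_nonpos[OF assms] ne'
    by (auto intro!: derivative_eq_intros simp: divide_inverse)
  also have "exp (- w) / (1 - exp (- w)) = 1 / (exp w - 1)"
    using ne ne' by (simp add: exp_minus field_simps)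
  finally show "(log_quot has_field_derivative log_quot' w) (at w within A)"
    by (simp add: log_quot'_def)
  show "(log_quot' has_field_derivative log_quot'' w) (at w within A)"
    unfolding log_quot'_def log_quot''_def using ne
    by (auto intro!: derivative_eq_intros simp: field_simps power2_eq_square)
qed

lemma exp_minus_1_lower:
  assumes "w \<in> sector"
  shows "norm (exp w - 1) \<ge> exp (Re w) - 1" "norm (exp w - 1) \<ge> norm w / 2"
proof -
  show *: "norm (exp w - 1) \<ge> exp (Re w) - 1"
    using norm_triangle_ineq2[of "exp w" 1] by simp
  have "exp (Re w) - 1 \<ge> Re w" using exp_ge_add_one_self[of "Re w"] by linarith
  moreover have "Re w > 0" using assms by (simp add: sector_def)
  ultimately show "norm (exp w - 1) \<ge> norm w / 2"
    using * norm_le_sector[OF assms] by linarith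
qed

lemma exp_Re_le_3: "norm w \<le> 1 \<Longrightarrow> exp \<bar>Re w\<bar> \<le> 3"
proof -
  assume "norm w \<le> 1"
  then have "\<bar>Re w\<bar> \<le> 1" using abs_Re_le_cmod[of w] by linarith
  then have "exp \<bar>Re w\<bar> \<le> exp 1" by simp
  then show ?thesis using exp_le by linarith
qed

text \<open>Near 0 the poles cancel: over the common denominator w (exp w - 1) the numerator exp w -
  1 - w is O(|w|^2). For |w| > 1 the two terms are bounded separately.\<close>

lemma log_quot'_bound:
  assumes w: "w \<in> sector"
  shows "norm (log_quot' w) \<le> 6"
proof -
  have pos: "norm w > 0" "w \<noteq> 0" using w by (auto simp: sector_def)
  have ne: "exp w - 1 \<noteq> 0" using exp_ne_1 w by (auto simp: sector_def)
  show ?thesis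
  proof (cases "norm w \<le> 1")
    case True
    have "norm (exp w - 1 - w) \<le> exp \<bar>Re w\<bar> * norm w ^ 2"
      using Taylor_exp[of w 1] by (simp add: numeral_2_eq_2 algebra_simps)
    also have "\<dots> \<le> 3 * norm w ^ 2" by (intro mult_right_mono exp_Re_le_3 True) auto
    finally have A: "norm (exp w - 1 - w) \<le> 3 * norm w ^ 2" .
    have "log_quot' w = (exp w - 1 - w) / (w * (exp w - 1))"
      using pos ne by (simp add: log_quot'_def field_simps)
    then have "norm (log_quot' w) = norm (exp w - 1 - w) / (norm w * norm (exp w - 1))"
      by (simp add: norm_divide norm_mult)
    also have "\<dots> \<le> 3 * norm w ^ 2 / (norm w * (norm w / 2))"
      using pos by (intro frac_le A mult_left_mono exp_minus_1_lower(2)[OF w]) auto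
    also have "\<dots> = 6" using pos by (simp add: power2_eq_square)
    finally show ?thesis .
  next
    case False
    have "norm (log_quot' w) \<le> norm (1 / w) + norm (1 / (exp w - 1))"
      unfolding log_quot'_def by (rule norm_triangle_ineq4)
    also have "\<dots> \<le> 1 / 1 + 1 / (1/2)"
      unfolding norm_divide norm_one
      using exp_minus_1_lower(2)[OF w] False by (intro add_mono divide_left_mono mult_pos_pos) auto
    finally show ?thesis by simp
  qed
qed

text \<open>The decay 1 / |w|^2 is what makes the errors summable over the multiples of w. For |w|
  <= 1 the double poles cancel; for |w| > 1 each of the two terms has this decay.\<close>

lemma log_quot''_bound:
  assumes w: "w \<in> sector"
  shows "norm (log_quot'' w) \<le> 96 / (1 + norm w) ^ 2"
proof -
  have pos: "norm w > 0" "w \<noteq> 0" "Re w > 0" using w by (auto simp: sector_def)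
  have ne: "exp w - 1 \<noteq> 0" using exp_ne_1 w by (auto simp: sector_def)
  have p1: "0 < (1 + norm w) ^ 2" by (intro zero_less_power add_pos_nonneg) auto
  show ?thesis
  proof (cases "norm w \<le> 1")
    case True
    define s where "s = exp w - 1 - w - w ^ 2 / 2"
    have "norm s \<le> exp \<bar>Re w\<bar> * norm w ^ 3 / 2"
      using Taylor_exp[of w 2] by (simp add: numeral_2_eq_2 numeral_3_eq_3 algebra_simps s_def)
    also have "\<dots> \<le> 3 * norm w ^ 3 / 2" by (intro divide_right_mono mult_right_mono exp_Re_le_3 True) auto
    finally have S: "norm s \<le> 3 / 2 * norm w ^ 3" by simp
    have e: "exp w = s + 1 + w + w^2/2" by (simp add: s_def)
    \<comment> \<open>The terms in w^2, w^3 and s w^2 cancel; what remains is of order |w|^4, the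
      size of the denominator.\<close>
    have "exp w * w ^ 2 - (exp w - 1) ^ 2 = w ^ 4 / 4 - 2 * s * w - s ^ 2"
      unfolding e by (simp add: power2_eq_square power4_eq_xxxx field_simps)
    then have "norm (exp w * w ^ 2 - (exp w - 1) ^ 2) \<le> norm (w ^ 4 / 4) + norm (2 * s * w) + norm (s ^ 2)"
      by (metis add_right_mono norm_triangle_ineq4 order_trans)
    also have "\<dots> = norm w ^ 4 / 4 + 2 * norm s * norm w + norm s ^ 2"
      by (simp add: norm_mult norm_power norm_divide)
    also have "\<dots> \<le> norm w ^ 4 / 4 + 2 * (3 / 2 * norm w ^ 3) * norm w + (3 / 2 * norm w ^ 3) ^ 2"
      by (intro add_mono mult_right_mono mult_left_mono S power_mono) auto
    also have "\<dots> = norm w ^ 4 * (13 / 4 + 9 / 4 * norm w ^ 2)"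
      by (simp add: power2_eq_square power3_eq_cube power4_eq_xxxx algebra_simps)
    also have "\<dots> \<le> norm w ^ 4 * (13 / 4 + 9 / 4 * 1)"
      using True by (intro mult_left_mono add_mono power_le_one) auto
    finally have A: "norm (exp w * w ^ 2 - (exp w - 1) ^ 2) \<le> norm w ^ 4 * 6"
      by (rule order_trans) (simp add: mult_left_mono)
    have "log_quot'' w = (exp w * w ^ 2 - (exp w - 1) ^ 2) / (w ^ 2 * (exp w - 1) ^ 2)"
      using pos ne by (simp add: log_quot''_def field_simps)
    then have "norm (log_quot'' w) = norm (exp w * w ^ 2 - (exp w - 1) ^ 2) / (norm w ^ 2 * norm (exp w - 1) ^ 2)"
      by (simp add: norm_divide norm_mult norm_power)
    also have "\<dots> \<le> (norm w ^ 4 * 6) / (norm w ^ 2 * (norm w / 2) ^ 2)"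
      using pos by (intro frac_le A mult_left_mono power_mono exp_minus_1_lower(2)[OF w]) auto
    also have "\<dots> = 96 / 2 ^ 2" using pos by (simp add: power2_eq_square power4_eq_xxxx)
    also have "\<dots> \<le> 96 / (1 + norm w) ^ 2"
      using True by (intro divide_left_mono power_mono mult_pos_pos p1) auto
    finally show ?thesis .
  next
    case False
    define x where "x = Re w"
    have x: "x > 0" using pos by (simp add: x_def)
    have ex: "exp x \<ge> 1 + x + x ^ 2 / 2" using exp_lower_Taylor_quadratic[of x] x by simp
    have ex1: "x \<le> exp x - 1" using exp_ge_add_one_self[of x] by linarith
    have "norm (exp w / (exp w - 1) ^ 2) \<le> exp x / (exp x - 1) ^ 2"
      unfolding norm_divide norm_power norm_exp_eq_Re x_def [symmetric]
      using x exp_minus_1_lower(1)[OF w, folded x_def] by (intro divide_left_mono power_mono mult_pos_pos) auto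
    \<comment> \<open>Split so that each term is O(1 / x^2): the first by exp x - 1 >= x^2 / 2, the
      second by exp x - 1 >= x.\<close>
    also have "exp x / (exp x - 1) ^ 2 = 1 / (exp x - 1) + 1 / (exp x - 1) ^ 2"
      using x by (simp add: divide_simps power2_eq_square)
    also have "\<dots> \<le> 1 / (x ^ 2 / 2) + 1 / x ^ 2"
      using x ex ex1 by (intro add_mono divide_left_mono power_mono mult_pos_pos ex1) simp_all
    also have "\<dots> = 3 / x ^ 2" using x by (simp add: field_simps)
    also have "\<dots> \<le> 3 / (2/3 * norm w) ^ 2"
      using norm_le_sector[OF w] pos x by (intro divide_left_mono power_mono mult_pos_pos) (auto simp: x_def)
    finally have A: "norm (exp w / (exp w - 1) ^ 2) \<le> 27/4 / norm w ^ 2" by (simp add: power_mult_distrib power_divide)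
    have "norm (log_quot'' w) \<le> norm (exp w / (exp w - 1) ^ 2) + norm (1 / w ^ 2)"
      unfolding log_quot''_def by (rule norm_triangle_ineq4)
    also have "\<dots> \<le> 27/4 / norm w ^ 2 + 1 / norm w ^ 2"
      using A by (simp add: norm_divide norm_power)
    also have "\<dots> = 31 / (2 * norm w) ^ 2" using pos by (simp add: power_mult_distrib)
    also have "\<dots> \<le> 96 / (1 + norm w) ^ 2"
      using False pos by (intro frac_le power_mono p1) auto
    finally show ?thesis .
  qed
qed

lemma closed_segment_sector:
  "a \<in> sector \<Longrightarrow> b \<in> sector \<Longrightarrow> closed_segment a b \<subseteq> sector"
  by (rule closed_segment_subset[OF _ _ convex_sector])

text \<open>Estimates have to be anchored at 0, which is not in \<open>sector\<close>. This carries
  limits of real functions at 0+ over to complex functions along the positive axis.\<close>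

lemma tendsto_of_real_at_right:
  fixes f :: "complex \<Rightarrow> complex"
  assumes "((\<lambda>t. g t) \<longlongrightarrow> c) (at_right (0::real))" "\<And>t. t > 0 \<Longrightarrow> f (of_real t) = of_real (g t)"
  shows "((\<lambda>t. f (of_real t)) \<longlongrightarrow> of_real c) (at_right (0::real))"
  using tendsto_of_real[OF assms(1), where 'a = complex]
  by (rule Lim_transform_eventually) (simp add: eventually_at_right_field assms(2) exI[of _ 1])

lemma log_quot_of_real:
  assumes "t > 0"
  shows "log_quot (of_real t) = of_real (ln t - ln (1 - exp (- t)))"
proof -
  have "1 - exp (- complex_of_real t) = of_real (1 - exp (- t))"
    by (metis exp_of_real of_real_1 of_real_diff of_real_minus)
  moreover have "Ln (complex_of_real (1 - exp (- t))) = of_real (ln (1 - exp (- t)))"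
    using assms by (intro Ln_of_real) simp
  ultimately show ?thesis using assms by (simp only: log_quot_def Ln_of_real of_real_diff)
qed

text \<open>\<open>log_quot\<close> tends to 0 at 0+ and its derivative is at most 6 in norm. The
  mean value inequality is applied between w and a real t > 0, and then t tends to 0.\<close>

lemma log_quot_bound:
  assumes w: "w \<in> sector"
  shows "norm (log_quot w) \<le> 6 * norm w"
proof (rule tendsto_le)
  have "((\<lambda>t::real. ln t - ln (1 - exp (- t))) \<longlongrightarrow> 0) (at_right 0)" by real_asymp
  then have "((\<lambda>t. log_quot (of_real t)) \<longlongrightarrow> of_real 0) (at_right (0::real))"
    by (rule tendsto_of_real_at_right[where f = log_quot]) (rule log_quot_of_real)
  then have "((\<lambda>t. norm (log_quot w - log_quot (of_real t))) \<longlongrightarrow> norm (log_quot w - of_real 0)) (at_right (0::real))"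
    by (intro tendsto_intros)
  then show "((\<lambda>t. norm (log_quot w - log_quot (of_real t))) \<longlongrightarrow> norm (log_quot w)) (at_right (0::real))"
    by simp
  have "((\<lambda>t. 6 * norm (w - of_real t)) \<longlongrightarrow> 6 * norm (w - of_real 0)) (at_right (0::real))"
    by (intro tendsto_intros)
  then show "((\<lambda>t. 6 * norm (w - of_real t)) \<longlongrightarrow> 6 * norm w) (at_right (0::real))" by simp
  have "norm (log_quot w - log_quot (of_real t)) \<le> 6 * norm (w - of_real t)" if "t > 0" for t
    using field_differentiable_bound[OF convex_sector, of log_quot log_quot' 6 "w" "of_real t"]
      log_quot_deriv(1) log_quot'_bound w of_real_in_sector[OF that] by (auto simp: sector_def)
  then show "\<forall>\<^sub>F t in at_right 0. norm (log_quot w - log_quot (of_real t)) \<le> 6 * norm (w - of_real t)"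
    by (simp add: eventually_at_right_field exI[of _ 1])
qed simp

section \<open>The dilogarithm and the antiderivative of \<open>log_quot\<close>\<close>

definition dilog :: "complex \<Rightarrow> complex" where
  "dilog z = (\<Sum>n. z ^ n / of_nat n ^ 2)"

lemma summable_dilog_norm: "summable (\<lambda>n. 1 / real n ^ 2)"
  using inverse_power_summable[of 2, where 'a = real] by (simp add: field_simps)

lemma dilog_deriv:
  assumes "norm z < 1" "z \<noteq> 0"
  shows "(dilog has_field_derivative (- Ln (1 - z) / z)) (at z)"
proof -
  let ?c = "\<lambda>n. 1 / of_nat n ^ 2 :: complex"
  have "summable (\<lambda>n. ?c n * 1 ^ n)"
    using summable_dilog_norm summable_of_real[of "\<lambda>n. 1 / real n ^ 2", where 'a = complex] by simp
  then have "((\<lambda>z. \<Sum>n. ?c n * z ^ n) has_field_derivative (\<Sum>n. diffs ?c n * z ^ n)) (at z)"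
    by (rule termdiffs_strong) (use assms in auto)
  moreover have "(\<Sum>n. diffs ?c n * z ^ n) = - Ln (1 - z) / z"
  proof -
    have "(\<lambda>n. - ((- (- z)) ^ n) / of_nat n) sums ln (1 + - z)"
      by (rule Ln_series') (use assms in simp)
    then have "(\<lambda>n. - (z ^ Suc n) / of_nat (Suc n)) sums Ln (1 - z)"
      by (subst sums_Suc_iff) simp
    then have "(\<lambda>n. (- 1 / z) * (- (z ^ Suc n) / of_nat (Suc n))) sums ((- 1 / z) * Ln (1 - z))"
      by (rule sums_mult)
    moreover have "(- 1 / z) * (- (z ^ Suc n) / of_nat (Suc n)) = diffs ?c n * z ^ n" for n
      using assms by (simp add: diffs_def power2_eq_square field_simps del: of_nat_Suc)
    ultimately show ?thesis by (simp add: sums_iff)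
  qed
  ultimately show ?thesis by (simp add: dilog_def[abs_def])
qed

text \<open>The closed disc matters: exp (-w) tends to the boundary point 1 as w tends to 0.\<close>

lemma continuous_on_dilog: "continuous_on (cball 0 1) dilog"
proof -
  have "uniform_limit (cball 0 1) (\<lambda>n x. \<Sum>i<n. x ^ i / of_nat i ^ 2) (\<lambda>x. \<Sum>i. x ^ i / of_nat i ^ 2 :: complex) sequentially"
    by (rule Weierstrass_m_test[OF _ summable_dilog_norm])
       (auto simp: norm_divide norm_power intro!: divide_right_mono power_le_one)
  then show ?thesis unfolding dilog_def[abs_def]
    by (rule uniform_limit_theorem[rotated]) 
      (auto intro!: always_eventually continuous_intros simp: divide_inverse)
qed

lemma dilog_1: "dilog 1 = of_real (pi ^ 2 / 6)"
proof -
  have "(\<lambda>n. 1 / (real n + 1) ^ 2) sums (pi ^ 2 / 6)" using inverse_squares_sums by (simp add: add.commute)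
  then have "(\<lambda>n. 1 / real n ^ 2) sums (pi ^ 2 / 6)"
    using sums_Suc_iff[of "\<lambda>n. 1 / real n ^ 2" "pi ^ 2 / 6"] by (simp add: add.commute)
  then have "(\<lambda>n. of_real (1 / real n ^ 2) :: complex) sums of_real (pi ^ 2 / 6)"
    by (subst sums_of_real_iff)
  then show ?thesis by (simp add: dilog_def sums_iff)
qed

lemma dilog_0: "dilog 0 = 0"
proof -
  \<comment> \<open>The term n = 0 is 1 / 0, which is 0 by the convention for division by
    zero.\<close>
  have "(\<lambda>n. 0 ^ n / of_nat n ^ 2 :: complex) = (\<lambda>_. 0)"
    by (rule ext, rename_tac n, case_tac n) auto
  then show ?thesis by (simp add: dilog_def)
qed

text \<open>The first two terms integrate \<open>Ln\<close>, and the derivative of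
  \<open>dilog (exp (- w))\<close> is Ln (1 - exp (-w)). The limit at 0 is -pi^2 / 6, so pi^2 / 6
  has to be added to obtain the integral from 0.\<close>

definition log_quot_int :: "complex \<Rightarrow> complex" where
  "log_quot_int w = w * Ln w - w - dilog (exp (- w))"

lemma log_quot_int_deriv:
  assumes "Re w > 0"
  shows "(log_quot_int has_field_derivative log_quot w) (at w within A)"
proof -
  have "w \<notin> \<real>\<^sub>\<le>\<^sub>0" "w \<noteq> 0" using assms by (auto simp: complex_nonpos_Reals_iff)
  moreover have "norm (exp (- w)) < 1" using assms by simp
  then have "((\<lambda>w. dilog (exp (- w))) has_field_derivative (- Ln (1 - exp (- w)) / exp (- w)) * (exp (- w) * - 1)) (at w)"
    by (intro DERIV_chain2[OF dilog_deriv]) (auto intro!: derivative_eq_intros)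
  ultimately have "(log_quot_int has_field_derivative log_quot w) (at w)"
    unfolding log_quot_int_def[abs_def] log_quot_def
    by (auto intro!: derivative_eq_intros)
  then show ?thesis by (rule has_field_derivative_at_within)
qed

text \<open>On the segment from w to a small t > 0 the derivative \<open>log_quot\<close> is at most
  6 |w| in norm, and the length of the segment tends to |w|.\<close>

lemma log_quot_int_bound:
  assumes w: "w \<in> sector"
  shows "norm (log_quot_int w + of_real (pi ^ 2 / 6)) \<le> 6 * norm w ^ 2"
proof (rule tendsto_le)
  have "((\<lambda>t::real. exp (- t)) \<longlongrightarrow> 1) (at_right 0)" by real_asymp
  then have "((\<lambda>t. exp (- complex_of_real t)) \<longlongrightarrow> of_real 1) (at_right (0::real))"
    by (rule tendsto_of_real_at_right[where f = "\<lambda>t. exp (- t)"]) (metis exp_of_real of_real_minus)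
  then have "((\<lambda>t. dilog (exp (- of_real t))) \<longlongrightarrow> dilog 1) (at_right (0::real))"
    using continuous_on_dilog
    by (intro continuous_on_tendsto_compose[OF continuous_on_dilog])
       (auto simp: eventually_at_right_field intro!: exI[of _ 1])
  moreover have "((\<lambda>t::real. t * ln t - t) \<longlongrightarrow> 0) (at_right 0)" by real_asymp
  then have "((\<lambda>t. of_real t * Ln (of_real t) - of_real t) \<longlongrightarrow> of_real 0) (at_right (0::real))"
    by (rule tendsto_of_real_at_right[where f = "\<lambda>t. t * Ln t - t"]) (simp add: Ln_of_real)
  ultimately have *: "((\<lambda>t. log_quot_int (of_real t)) \<longlongrightarrow> of_real 0 - dilog 1) (at_right (0::real))"
    unfolding log_quot_int_def by (intro tendsto_intros)
  have "((\<lambda>t. norm (log_quot_int w - log_quot_int (of_real t))) \<longlongrightarrow> norm (log_quot_int w - (of_real 0 - dilog 1))) (at_right (0::real))"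
    by (intro tendsto_intros *)
  then show "((\<lambda>t. norm (log_quot_int w - log_quot_int (of_real t))) \<longlongrightarrow> norm (log_quot_int w + of_real (pi ^ 2 / 6))) (at_right (0::real))"
    by (simp add: dilog_1)
  have "((\<lambda>t. (6 * norm w) * norm (w - of_real t)) \<longlongrightarrow> (6 * norm w) * norm (w - of_real 0)) (at_right (0::real))"
    by (intro tendsto_intros)
  then show "((\<lambda>t. (6 * norm w) * norm (w - of_real t)) \<longlongrightarrow> 6 * norm w ^ 2) (at_right (0::real))"
    by (simp add: power2_eq_square mult.assoc)
  have "norm (log_quot_int w - log_quot_int (of_real t)) \<le> (6 * norm w) * norm (w - of_real t)"
    if t: "t > 0" "t < norm w" for t
  proof (rule field_differentiable_bound[of "closed_segment w (of_real t)"])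
    note sub = closed_segment_sector[OF w of_real_in_sector[OF t(1)]]
    fix z assume z: "z \<in> closed_segment w (of_real t)"
    then have zs: "z \<in> sector" using sub by blast
    then show "(log_quot_int has_field_derivative log_quot z) (at z within closed_segment w (of_real t))"
      by (intro log_quot_int_deriv) (simp add: sector_def)
    have "closed_segment w (of_real t) \<subseteq> cball 0 (norm w)"
      using t by (intro closed_segment_subset) auto
    then have "norm z \<le> norm w" using z by auto
    then show "norm (log_quot z) \<le> 6 * norm w" using log_quot_bound[OF zs] by linarith
  qed auto
  then show "\<forall>\<^sub>F t in at_right 0. norm (log_quot_int w - log_quot_int (of_real t)) \<le> (6 * norm w) * norm (w - of_real t)"
    using w by (auto simp: eventually_at_right_field sector_def intro!: exI[of _ "norm w"])
qed simp

section \<open>Comparison of sums with integrals\<close>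

lemma trapezoid_error:
  assumes "a \<in> sector" "b \<in> sector" and B: "\<And>w. w \<in> closed_segment a b \<Longrightarrow> norm (log_quot'' w) \<le> B"
  shows "norm ((b - a) * (log_quot a + log_quot b) / 2 - (log_quot_int b - log_quot_int a)) \<le> B * norm (b - a) ^ 3"
    and "norm (log_quot b - log_quot a - (b - a) * log_quot' b) \<le> B * norm (b - a) ^ 2"
proof -
  have sub: "Re w > 0" if "w \<in> closed_segment a b" for w
    using closed_segment_sector[OF assms(1,2)] that by (auto simp: sector_def)
  have 1: "norm (log_quot_int b - (log_quot_int a + log_quot a * (b - a) + log_quot' a * (b - a) ^ 2 / 2)) \<le> B * norm (b - a) ^ 3 / 2"
  proof -
    let ?f = "\<lambda>i::nat. if i = 0 then log_quot_int else if i = 1 then log_quot else if i = 2 then log_quot' else log_quot''"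
    have "norm (?f 0 b - (\<Sum>i\<le>2. ?f i a * (b - a) ^ i / fact i)) \<le> B * norm (b - a) ^ Suc 2 / fact 2"
      by (rule complex_Taylor[of "closed_segment a b"])
         (auto simp: log_quot_int_deriv log_quot_deriv sub B)
    then show ?thesis by (simp add: numeral_2_eq_2 numeral_3_eq_3)
  qed
  have 2: "norm (log_quot b - (log_quot a + log_quot' a * (b - a))) \<le> B * norm (b - a) ^ 2"
  proof -
    let ?f = "\<lambda>i::nat. if i = 0 then log_quot else if i = 1 then log_quot' else log_quot''"
    have "norm (?f 0 b - (\<Sum>i\<le>1. ?f i a * (b - a) ^ i / fact i)) \<le> B * norm (b - a) ^ Suc 1 / fact 1"
      by (rule complex_Taylor[of "closed_segment a b"])
         (auto simp: log_quot_int_deriv log_quot_deriv sub B)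
    then show ?thesis by (simp add: numeral_2_eq_2)
  qed
  \<comment> \<open>The expansion is around \<open>b\<close> because the sum of
    \<open>log_quot'\<close> in \<open>sum_log_quot'\<close> is compared step by step at right
    endpoints.\<close>
  have 3: "norm (log_quot a - (log_quot b + log_quot' b * (a - b))) \<le> B * norm (a - b) ^ 2"
  proof -
    let ?f = "\<lambda>i::nat. if i = 0 then log_quot else if i = 1 then log_quot' else log_quot''"
    have "norm (?f 0 a - (\<Sum>i\<le>1. ?f i b * (a - b) ^ i / fact i)) \<le> B * norm (a - b) ^ Suc 1 / fact 1"
      by (rule complex_Taylor[of "closed_segment a b"])
         (auto simp: log_quot_int_deriv log_quot_deriv sub B)
    then show ?thesis by (simp add: numeral_2_eq_2)
  qed
  define X where "X = log_quot b - (log_quot a + log_quot' a * (b - a))"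
  define Y where "Y = log_quot_int b - (log_quot_int a + log_quot a * (b - a) + log_quot' a * (b - a) ^ 2 / 2)"
  \<comment> \<open>The combination is chosen so that \<open>log_quot' a\<close> cancels: it enters
    X with the factor -(b - a) and Y with -(b - a)^2 / 2.\<close>
  have "(b - a) * (log_quot a + log_quot b) / 2 - (log_quot_int b - log_quot_int a) = (b - a) / 2 * X - Y"
    by (simp add: X_def Y_def field_simps power2_eq_square)
  also have "norm \<dots> \<le> norm ((b - a) / 2 * X) + norm Y" by (rule norm_triangle_ineq4)
  also have "\<dots> \<le> norm (b - a) / 2 * (B * norm (b - a) ^ 2) + B * norm (b - a) ^ 3 / 2"
    using 1 mult_left_mono[OF 2, of "norm (b - a) / 2"]
    by (intro add_mono) (simp_all add: norm_mult norm_divide X_def Y_def)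
  also have "\<dots> = B * norm (b - a) ^ 3" by (simp add: power2_eq_square power3_eq_cube)
  finally show "norm ((b - a) * (log_quot a + log_quot b) / 2 - (log_quot_int b - log_quot_int a)) \<le> B * norm (b - a) ^ 3" .
  have "norm (log_quot b - log_quot a - (b - a) * log_quot' b) = norm (log_quot a - (log_quot b + log_quot' b * (a - b)))"
    by (subst norm_minus_cancel [symmetric]) (simp add: algebra_simps)
  with 3 show "norm (log_quot b - log_quot a - (b - a) * log_quot' b) \<le> B * norm (b - a) ^ 2"
    by (simp add: norm_minus_commute)
qed

lemma norm_log_quot''_segment:
  assumes w: "w \<in> sector" and n: "n > 0" and z: "z \<in> closed_segment (of_nat n * w) (of_nat (Suc n) * w)"
  shows "norm (log_quot'' z) \<le> 96 / (1 + real n * norm w) ^ 2"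
proof -
  have zs: "z \<in> sector"
    using closed_segment_sector[OF sector_scale[OF w n] sector_scale[OF w, of "Suc n"]] z by (auto simp del: of_nat_Suc)
  obtain u where u: "0 \<le> u" "u \<le> 1" "z = (1 - u) *\<^sub>R (of_nat n * w) + u *\<^sub>R (of_nat (Suc n) * w)"
    using z by (auto simp: closed_segment_def)
  then have "z = of_real (real n + u) * w" by (simp add: scaleR_conv_of_real algebra_simps)
  then have "norm z = (real n + u) * norm w" using u by (simp only: norm_mult norm_of_real)
  then have "norm z \<ge> real n * norm w" using u by (simp add: mult_right_mono)
  then have "96 / (1 + norm z) ^ 2 \<le> 96 / (1 + real n * norm w) ^ 2"
    by (intro divide_left_mono power_mono mult_pos_pos zero_less_power add_pos_nonneg) auto
  then show ?thesis using log_quot''_bound[OF zs] by linarith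
qed

text \<open>The sum of the right sides telescopes to at most 1, so the accumulated error is bounded
  uniformly in the number of terms and in t.\<close>

lemma inverse_square_le_telescope:
  fixes t :: real
  assumes "t > 0"
  shows "t / (1 + real (Suc n) * t) ^ 2 \<le> 1 / (1 + real n * t) - 1 / (1 + real (Suc n) * t)"
proof -
  define a b where "a = 1 + real n * t" and "b = 1 + real (Suc n) * t"
  have ab: "0 < a" "a \<le> b" "b - a = t" using assms by (auto simp: a_def b_def algebra_simps add_pos_nonneg)
  have "t / b ^ 2 \<le> t / (a * b)"
    using ab assms by (intro divide_left_mono) (auto simp: power2_eq_square)
  also have "\<dots> = 1 / a - 1 / b" using ab by (simp add: field_simps)
  finally show ?thesis by (simp add: a_def b_def)
qed

text \<open>The trapezoidal rule with step w on the segment from 0 to K w, divided by w. The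
  constant is 9 + 96: the first step, where the bounds near 0 give 6/2 + 6, and the telescoped
  errors of the others.\<close>

lemma sum_log_quot:
  assumes w: "w \<in> sector" and K: "K > 0"
  shows "norm ((\<Sum>n=1..K. log_quot (of_nat n * w)) -
           (log_quot (of_nat K * w) / 2 + (log_quot_int (of_nat K * w) + of_real (pi ^ 2 / 6)) / w)) \<le> 105 * norm w"
proof -
  define R where "R K = (\<Sum>n=1..K. log_quot (of_nat n * w)) -
           (log_quot (of_nat K * w) / 2 + (log_quot_int (of_nat K * w) + of_real (pi ^ 2 / 6)) / w)" for K
  define t where "t = norm w"
  have t: "t > 0" "w \<noteq> 0" using w by (auto simp: t_def sector_def)
  have "norm (R (Suc n)) \<le> 9 * t + 96 * t * (1 - 1 / (1 + real n * t))" for n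
  proof (induction n)
    case 0
    have "R 1 = log_quot w / 2 - (log_quot_int w + of_real (pi ^ 2 / 6)) / w" by (simp add: R_def)
    then have "norm (R 1) \<le> norm (log_quot w / 2) + norm ((log_quot_int w + of_real (pi ^ 2 / 6)) / w)"
      by (metis norm_triangle_ineq4)
    also have "\<dots> \<le> 6 * t / 2 + 6 * t ^ 2 / t"
      unfolding norm_divide t_def
      using log_quot_bound[OF w] log_quot_int_bound[OF w] by (intro add_mono divide_right_mono) auto
    also have "\<dots> = 9 * t" using t by (simp add: power2_eq_square)
    finally show ?case by simp
  next
    case (Suc n)
    let ?a = "of_nat (Suc n) * w" and ?b = "of_nat (Suc (Suc n)) * w"
    have ba: "?b - ?a = w" by (simp add: algebra_simps)
    have "norm ((?b - ?a) * (log_quot ?a + log_quot ?b) / 2 - (log_quot_int ?b - log_quot_int ?a))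
        \<le> 96 / (1 + real (Suc n) * t) ^ 2 * norm (?b - ?a) ^ 3"
      unfolding t_def using norm_log_quot''_segment[OF w, of "Suc n"]
      by (intro trapezoid_error sector_scale w) auto
    then have A: "norm (w * (log_quot ?a + log_quot ?b) / 2 - (log_quot_int ?b - log_quot_int ?a))
        \<le> 96 / (1 + real (Suc n) * t) ^ 2 * t ^ 3" unfolding ba t_def .
    have "R (Suc (Suc n)) - R (Suc n) = (w * (log_quot ?a + log_quot ?b) / 2 - (log_quot_int ?b - log_quot_int ?a)) / w"
      using t unfolding R_def by (simp add: field_simps del: of_nat_Suc)
    then have "norm (R (Suc (Suc n)) - R (Suc n)) = norm (w * (log_quot ?a + log_quot ?b) / 2 - (log_quot_int ?b - log_quot_int ?a)) / t"
      by (simp only: norm_divide t_def)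
    also have "\<dots> \<le> (96 / (1 + real (Suc n) * t) ^ 2 * t ^ 3) / t"
      using A t by (intro divide_right_mono) auto
    also have "\<dots> = 96 * t * (t / (1 + real (Suc n) * t) ^ 2)" using t by (simp add: power3_eq_cube)
    also have "\<dots> \<le> 96 * t * (1 / (1 + real n * t) - 1 / (1 + real (Suc n) * t))"
      using t by (intro mult_left_mono inverse_square_le_telescope) auto
    finally have "norm (R (Suc (Suc n)) - R (Suc n)) \<le> 96 * t * (1 / (1 + real n * t) - 1 / (1 + real (Suc n) * t))" .
    then have "norm (R (Suc (Suc n))) \<le> norm (R (Suc n)) + 96 * t * (1 / (1 + real n * t) - 1 / (1 + real (Suc n) * t))"
      using norm_triangle_sub[of "R (Suc (Suc n))" "R (Suc n)"] by linarith
    also have "\<dots> \<le> 9 * t + 96 * t * (1 - 1 / (1 + real n * t)) + 96 * t * (1 / (1 + real n * t) - 1 / (1 + real (Suc n) * t))"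
      using Suc.IH by simp
    also have "\<dots> = 9 * t + 96 * t * (1 - 1 / (1 + real (Suc n) * t))" by (simp add: algebra_simps)
    finally show ?case .
  qed
  from this[of "K - 1"] have "norm (R K) \<le> 9 * t + 96 * t * (1 - 1 / (1 + real (K - 1) * t))" using K by simp
  also have "\<dots> \<le> 9 * t + 96 * t * 1"
    using t by (intro add_left_mono mult_left_mono) (auto simp: add_nonneg_nonneg)
  finally show ?thesis by (simp add: R_def t_def)
qed

text \<open>A right Riemann sum for the integral of \<open>log_quot'\<close> from 0, which is
  \<open>log_quot (of_nat K * w)\<close> since \<open>log_quot\<close> tends to 0 at 0. The first
  step contributes 6 + 6, the telescoped errors 96.\<close>

lemma sum_log_quot':
  assumes w: "w \<in> sector" and K: "K > 0"
  shows "norm ((\<Sum>n=1..K. log_quot' (of_nat n * w)) - log_quot (of_nat K * w) / w) \<le> 108"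
proof -
  define R where "R K = (\<Sum>n=1..K. log_quot' (of_nat n * w)) - log_quot (of_nat K * w) / w" for K
  define t where "t = norm w"
  have t: "t > 0" "w \<noteq> 0" using w by (auto simp: t_def sector_def)
  have "norm (R (Suc n)) \<le> 12 + 96 * (1 - 1 / (1 + real n * t))" for n
  proof (induction n)
    case 0
    have "R 1 = log_quot' w - log_quot w / w" by (simp add: R_def)
    then have "norm (R 1) \<le> norm (log_quot' w) + norm (log_quot w / w)"
      by (metis norm_triangle_ineq4)
    also have "\<dots> \<le> 6 + 6 * t / t"
      unfolding norm_divide t_def
      using log_quot_bound[OF w] log_quot'_bound[OF w] by (intro add_mono divide_right_mono) auto
    also have "\<dots> = 12" using t by simp
    finally show ?case by simp
  next
    case (Suc n)
    let ?a = "of_nat (Suc n) * w" and ?b = "of_nat (Suc (Suc n)) * w"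
    have ba: "?b - ?a = w" by (simp add: algebra_simps)
    have "norm (log_quot ?b - log_quot ?a - (?b - ?a) * log_quot' ?b)
        \<le> 96 / (1 + real (Suc n) * t) ^ 2 * norm (?b - ?a) ^ 2"
      unfolding t_def using norm_log_quot''_segment[OF w, of "Suc n"]
      by (intro trapezoid_error sector_scale w) auto
    then have A: "norm (log_quot ?b - log_quot ?a - w * log_quot' ?b)
        \<le> 96 / (1 + real (Suc n) * t) ^ 2 * t ^ 2" unfolding ba t_def .
    have "R (Suc (Suc n)) - R (Suc n) = - (log_quot ?b - log_quot ?a - w * log_quot' ?b) / w"
      using t unfolding R_def by (simp add: field_simps del: of_nat_Suc)
    then have "norm (R (Suc (Suc n)) - R (Suc n)) = norm (log_quot ?b - log_quot ?a - w * log_quot' ?b) / t"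
      by (simp only: norm_divide norm_minus_cancel t_def)
    also have "\<dots> \<le> (96 / (1 + real (Suc n) * t) ^ 2 * t ^ 2) / t"
      using A t by (intro divide_right_mono) auto
    also have "\<dots> = 96 * (t / (1 + real (Suc n) * t) ^ 2)" using t by (simp add: power2_eq_square)
    also have "\<dots> \<le> 96 * (1 / (1 + real n * t) - 1 / (1 + real (Suc n) * t))"
      using t by (intro mult_left_mono inverse_square_le_telescope) auto
    finally have "norm (R (Suc (Suc n)) - R (Suc n)) \<le> 96 * (1 / (1 + real n * t) - 1 / (1 + real (Suc n) * t))" .
    then have "norm (R (Suc (Suc n))) \<le> norm (R (Suc n)) + 96 * (1 / (1 + real n * t) - 1 / (1 + real (Suc n) * t))"
      using norm_triangle_sub[of "R (Suc (Suc n))" "R (Suc n)"] by linarith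
    then show ?case using Suc.IH by (simp add: algebra_simps)
  qed
  from this[of "K - 1"] have "norm (R K) \<le> 12 + 96 * (1 - 1 / (1 + real (K - 1) * t))" using K by simp
  also have "\<dots> \<le> 12 + 96 * 1"
    using t by (intro add_left_mono mult_left_mono) (auto simp: add_nonneg_nonneg)
  finally show ?thesis by (simp add: R_def)
qed

section \<open>Asymptotics of the two generating functions\<close>

lemma Ln_of_nat_times:
  assumes "w \<in> sector" "n > 0"
  shows "Ln (of_nat n * w) = of_real (ln (real n)) + Ln w"
proof -
  have "w \<noteq> 0" using assms by (auto simp: sector_def)
  then show ?thesis using Ln_times_of_real[of "real n" w] assms by simp
qed

lemma exp_sector_norm: "w \<in> sector \<Longrightarrow> norm (exp (- w)) < 1"
  by (simp add: sector_def)

lemma tendsto_exp_of_nat_mult: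
  assumes "w \<in> sector"
  shows "(\<lambda>K. exp (- (of_nat K * w))) \<longlonglongrightarrow> 0"
proof -
  have "(\<lambda>K. exp (- w) ^ K) \<longlonglongrightarrow> 0"
    by (rule LIMSEQ_power_zero) (use exp_sector_norm[OF assms] in simp)
  then show ?thesis by (simp flip: exp_of_nat_mult)
qed

lemma tendsto_Ln_one_minus:
  assumes "w \<in> sector"
  shows "(\<lambda>K. Ln (1 - exp (- (of_nat K * w)))) \<longlonglongrightarrow> 0"
proof -
  have "(\<lambda>K. Ln (1 - exp (- (of_nat K * w)))) \<longlonglongrightarrow> Ln (1 - 0)"
    by (intro tendsto_intros tendsto_exp_of_nat_mult assms) auto
  then show ?thesis by simp
qed

text \<open>The logarithm of sqrt (w / (2 pi)) exp (pi^2 / (6 w)). The modular transformation of the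
  eta function has a further -w / 24, which here is part of the relative error O(|w|).\<close>

definition eta_main :: "complex \<Rightarrow> complex" where
  "eta_main w = of_real (pi ^ 2 / 6) / w + Ln w / 2 - of_real (ln (2 * pi) / 2)"

text \<open>The product up to K is exactly exp (\<open>eta_main w\<close> + \<open>s K\<close> +
  \<open>err K\<close>), where \<open>s K\<close> tends to 0, while \<open>err K\<close> is known
  only to be at most 105 |w| in norm. So exp (-\<open>s K\<close>) is multiplied in, the deviation
  from 1 is bounded at fixed K, and the limit is taken in the inequality.\<close>

lemma partition_gf_asymp:
  assumes w: "w \<in> sector" "norm w \<le> 1"
  shows "norm (partition_gf (exp (- w)) * exp (- eta_main w) - 1) \<le> 105 * exp 105 * norm w"
proof -
  have w0: "w \<noteq> 0" using w by (auto simp: sector_def)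
  define err where "err K = (\<Sum>n=1..K. log_quot (of_nat n * w)) -
           (log_quot (of_nat K * w) / 2 + (log_quot_int (of_nat K * w) + of_real (pi ^ 2 / 6)) / w)" for K
  \<comment> \<open>Everything that depends on K apart from the trapezoid error: the Stirling
    remainder and the exponentially small boundary terms at K w.\<close>
  define s where "s K = of_real (ln (2 * pi) / 2 - (ln (fact K) - (real K + 1/2) * ln (real K) + real K))
      - dilog (exp (- (of_nat K * w))) / w - Ln (1 - exp (- (of_nat K * w))) / 2" for K :: nat
  have s0: "s \<longlonglongrightarrow> 0"
  proof -
    have "(\<lambda>K. dilog (exp (- (of_nat K * w)))) \<longlonglongrightarrow> dilog 0"
      using w(1) by (intro continuous_on_tendsto_compose[OF continuous_on_dilog] tendsto_exp_of_nat_mult)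
         (auto simp: sector_def intro!: always_eventually)
    then have B: "(\<lambda>K. dilog (exp (- (of_nat K * w))) / w) \<longlonglongrightarrow> dilog 0 / w"
      by (rule tendsto_divide[OF _ tendsto_const w0])
    have A: "(\<lambda>K. complex_of_real (ln (2 * pi) / 2 - (ln (fact K) - (real K + 1/2) * ln (real K) + real K)))
       \<longlonglongrightarrow> of_real (ln (2 * pi) / 2 - ln (2 * pi) / 2)"
      by (intro tendsto_of_real tendsto_diff[OF tendsto_const stirling_ln_fact])
    have C: "(\<lambda>K. Ln (1 - exp (- (of_nat K * w))) / 2) \<longlonglongrightarrow> 0 / 2"
      by (rule tendsto_divide[OF tendsto_Ln_one_minus[OF w(1)] tendsto_const]) simp
    have "s \<longlonglongrightarrow> of_real (ln (2 * pi) / 2 - ln (2 * pi) / 2) - dilog 0 / w - 0 / 2"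
      unfolding s_def by (rule tendsto_diff[OF tendsto_diff[OF A B] C])
    then show ?thesis by (simp add: dilog_0)
  qed
  have fact: "(\<Sum>n=1..K. Ln (of_nat n * w)) = of_real (ln (fact K)) + of_nat K * Ln w" for K
  proof (induction K)
    case (Suc K)
    have "ln (fact (Suc K) :: real) = ln (real (Suc K)) + ln (fact K)"
      by (simp add: ln_mult del: of_nat_Suc)
    then show ?case using Suc.IH Ln_of_nat_times[OF w(1), of "Suc K"]
      by (simp add: algebra_simps del: of_nat_Suc fact_Suc) (simp add: algebra_simps)
  qed simp
  have prod: "(\<Prod>m=1..K. inverse (1 - exp (- w) ^ m)) = exp (eta_main w + s K + err K)" if K: "K > 0" for K
  proof -
    have "(\<Prod>m=1..K. inverse (1 - exp (- w) ^ m)) = (\<Prod>m=1..K. exp (- Ln (1 - exp (- (of_nat m * w)))))"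
    proof (intro prod.cong refl)
      fix m assume "m \<in> {1..K}"
      then have "of_nat m * w \<in> sector" using w by (intro sector_scale) auto
      then have ne: "1 - exp (- (of_nat m * w)) \<noteq> 0"
        using one_minus_exp_nonpos[of "of_nat m * w"] by (auto simp: sector_def)
      then show "inverse (1 - exp (- w) ^ m) = exp (- Ln (1 - exp (- (of_nat m * w))))"
      proof -
        have "exp (- w) ^ m = exp (- (of_nat m * w))" by (simp flip: exp_of_nat_mult)
        then show ?thesis
          by (simp only: exp_minus[of "Ln (1 - exp (- (of_nat m * w)))"] exp_Ln[OF ne])
      qed
    qed
    also have "\<dots> = exp (\<Sum>m=1..K. log_quot (of_nat m * w) - Ln (of_nat m * w))"
      by (simp add: exp_sum log_quot_def)
    \<comment> \<open>By \<open>Ln_of_nat_times\<close> the terms K Ln w cancel, and those in log K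
      combine with log K! to the Stirling remainder in \<open>s K\<close>.\<close>
    also have "(\<Sum>m=1..K. log_quot (of_nat m * w) - Ln (of_nat m * w)) = eta_main w + s K + err K"
      unfolding sum_subtractf fact err_def eta_main_def s_def
      using w0 Ln_of_nat_times[OF w(1) K]
      by (simp add: log_quot_def log_quot_int_def field_simps)
    finally show ?thesis .
  qed
  have "(\<lambda>K. norm ((\<Prod>m=1..K. inverse (1 - exp (- w) ^ m)) * exp (- eta_main w) * exp (- s K) - 1))
     \<longlonglongrightarrow> norm (partition_gf (exp (- w)) * exp (- eta_main w) * exp (- 0) - 1)"
    by (intro tendsto_intros partition_gf_product(2) s0 exp_sector_norm w)
  moreover have "\<forall>\<^sub>F K in sequentially. norm ((\<Prod>m=1..K. inverse (1 - exp (- w) ^ m)) * exp (- eta_main w) * exp (- s K) - 1)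
       \<le> 105 * exp 105 * norm w"
    using eventually_gt_at_top[of 0]
  proof eventually_elim
    case (elim K)
    have e: "norm (err K) \<le> 105 * norm w" unfolding err_def by (rule sum_log_quot[OF w(1) elim])
    have "(\<Prod>m=1..K. inverse (1 - exp (- w) ^ m)) * exp (- eta_main w) * exp (- s K) = exp (err K)"
      unfolding prod[OF elim] by (simp flip: exp_add)
    moreover have "norm (exp (err K) - 1) \<le> exp \<bar>Re (err K)\<bar> * norm (err K)"
      using Taylor_exp[of "err K" 0] by simp
    moreover have "\<dots> \<le> exp 105 * (105 * norm w)"
      using e w(2) abs_Re_le_cmod[of "err K"] by (intro mult_mono) auto
    ultimately show ?case by (simp add: mult_ac)
  qed
  ultimately show ?thesis by (simp add: tendsto_upperbound)
qed

text \<open>With v = N w, each term is 1 / (exp (j v) - 1) = 1 / (j v) -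
  \<open>log_quot' (of_nat j * v)\<close>. The first parts sum to H_K / v, the second to (log K + Ln
  v) / v up to bounded and vanishing terms, so Euler's constant appears in the difference.\<close>

lemma divisor_gf_asymp:
  assumes w: "w \<in> sector" and N: "N > 0"
  shows "norm (divisor_gf N (exp (- w)) - (euler_mascheroni - Ln (of_nat N * w)) / (of_nat N * w)) \<le> 108"
proof -
  define v where "v = of_nat N * w"
  have v: "v \<in> sector" "v \<noteq> 0" using sector_scale[OF w N] N by (auto simp: v_def sector_def)
  \<comment> \<open>This is minus the error in \<open>sum_log_quot'\<close>, arranged so that its
    limit in \<open>K\<close> is visible.\<close>
  define f where "f K = (\<Sum>j=1..K. exp (- w) ^ (N * j) / (1 - exp (- w) ^ (N * j)))
     - (of_real (harm K - ln (real K)) - Ln v + Ln (1 - exp (- (of_nat K * v)))) / v" for K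
  have f: "f \<longlonglongrightarrow> divisor_gf N (exp (- w)) - (of_real euler_mascheroni - Ln v + 0) / v"
    unfolding f_def divisor_gf_def
    by (intro tendsto_intros divisor_series(2) N exp_sector_norm w euler_mascheroni_LIMSEQ tendsto_Ln_one_minus v)
  have "(\<lambda>K. norm (f K)) \<longlonglongrightarrow> norm (divisor_gf N (exp (- w)) - (euler_mascheroni - Ln v) / v)"
    using tendsto_norm[OF f] by simp
  moreover have "\<forall>\<^sub>F K in sequentially. norm (f K) \<le> 108"
    using eventually_gt_at_top[of 0]
  proof eventually_elim
    case (elim K)
    have "(\<Sum>j=1..K. exp (- w) ^ (N * j) / (1 - exp (- w) ^ (N * j))) = (\<Sum>j=1..K. 1 / of_nat j / v - log_quot' (of_nat j * v))"
    proof (intro sum.cong refl)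
      fix j assume "j \<in> {1..K}"
      then have "of_nat j * v \<in> sector" using v by (intro sector_scale) auto
      then have "exp (of_nat j * v) \<noteq> 1" by (intro exp_ne_1) (auto simp: sector_def)
      moreover have "exp (- w) ^ (N * j) = exp (- (of_nat j * v))"
        by (simp add: v_def mult_ac flip: exp_of_nat_mult)
      ultimately show "exp (- w) ^ (N * j) / (1 - exp (- w) ^ (N * j)) = 1 / of_nat j / v - log_quot' (of_nat j * v)"
        by (simp add: log_quot'_def exp_minus field_simps)
    qed
    also have "\<dots> = of_real (harm K) / v - (\<Sum>j=1..K. log_quot' (of_nat j * v))"
      by (simp add: sum_subtractf harm_def sum_distrib_right divide_inverse of_real_inverse)
    finally have E: "(\<Sum>j=1..K. exp (- w) ^ (N * j) / (1 - exp (- w) ^ (N * j))) =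
      of_real (harm K) / v - (\<Sum>j=1..K. log_quot' (of_nat j * v))" .
    have "f K = - ((\<Sum>j=1..K. log_quot' (of_nat j * v)) - log_quot (of_nat K * v) / v)"
      unfolding f_def E log_quot_def Ln_of_nat_times[OF v(1) elim]
      by (simp add: diff_divide_distrib add_divide_distrib)
    then have "norm (f K) = norm ((\<Sum>j=1..K. log_quot' (of_nat j * v)) - log_quot (of_nat K * v) / v)"
      by (simp only: norm_minus_cancel)
    then show ?case using sum_log_quot'[OF v(1) elim] by simp
  qed
  ultimately show ?thesis by (simp add: tendsto_upperbound v_def)
qed

section \<open>Minor arcs\<close>

text \<open>Both logarithms are expanded: log |1 - w| - log (1 - |w|) is the sum of the terms (|w|^n
  - Re (w^n)) / n, all nonnegative, of which only n = 1 is kept.\<close>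

lemma inverse_norm_one_minus_le:
  fixes w :: complex
  assumes "norm w < 1"
  shows "inverse (norm (1 - w)) \<le> inverse (1 - norm w) * exp (Re w - norm w)"
proof -
  have ne: "1 - w \<noteq> 0" using assms by auto
  have s: "(\<lambda>n. v ^ n / of_nat n) sums (- Ln (1 - v))" if "norm v < 1" for v :: complex
  proof -
    have "(\<lambda>n. - ((- (- v)) ^ n) / of_nat n) sums ln (1 + - v)"
      by (rule Ln_series') (use that in simp)
    from sums_minus[OF this] show ?thesis by simp
  qed
  have "(\<lambda>n. Re (w ^ n / of_nat n)) sums Re (- Ln (1 - w))"
    by (rule sums_Re[OF s[OF assms]])
  moreover have "Re (Ln (1 - w)) = ln (norm (1 - w))" using ne by simp
  ultimately have 1: "(\<lambda>n. Re (w ^ n) / real n) sums (- ln (norm (1 - w)))" by simp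
  have "(\<lambda>n. Re (of_real (norm w) ^ n / of_nat n)) sums Re (- Ln (1 - of_real (norm w)))"
    by (rule sums_Re[OF s]) (use assms in simp)
  moreover have "Ln (1 - of_real (norm w)) = of_real (ln (1 - norm w))"
    using assms Ln_of_real[of "1 - norm w"] by simp
  moreover have "Re (of_real (norm w) ^ n / of_nat n) = norm w ^ n / real n" for n
    by (simp flip: of_real_power)
  ultimately have 2: "(\<lambda>n. norm w ^ n / real n) sums (- ln (1 - norm w))" by simp
  have "norm w - Re w \<le> - ln (1 - norm w) - (- ln (norm (1 - w)))"
  proof (rule sums_le)
    show "(\<lambda>n. if n = 1 then norm w - Re w else 0) sums (norm w - Re w)"
      using sums_single[of 1 "\<lambda>_. norm w - Re w"] by simp
    show "(\<lambda>n. norm w ^ n / real n - Re (w ^ n) / real n) sums (- ln (1 - norm w) - (- ln (norm (1 - w))))"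
      by (rule sums_diff[OF 2 1])
    show "(if n = 1 then norm w - Re w else 0) \<le> norm w ^ n / real n - Re (w ^ n) / real n" for n
      using complex_Re_le_cmod[of "w ^ n"] by (auto simp: norm_power divide_right_mono)
  qed
  then have "- ln (norm (1 - w)) \<le> - ln (1 - norm w) + (Re w - norm w)" by linarith
  then have "exp (- ln (norm (1 - w))) \<le> exp (- ln (1 - norm w) + (Re w - norm w))" by simp
  also have "exp (- ln (1 - norm w) + (Re w - norm w)) = inverse (1 - norm w) * exp (Re w - norm w)"
    unfolding exp_add using assms by (simp add: exp_minus)
  also have "exp (- ln (norm (1 - w))) = inverse (norm (1 - w))"
    using ne by (simp add: exp_minus)
  finally show ?thesis .
qed

text \<open>\<open>inverse_norm_one_minus_le\<close> for z^m is multiplied over all m; the savings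
  Re (z^m) - |z|^m add up to geometric series.\<close>

lemma partition_gf_minor:
  assumes z: "norm z < 1"
  shows "norm (partition_gf z) \<le> norm (partition_gf (of_real (norm z)))
      * exp (norm z / norm (1 - z) - norm z / (1 - norm z))"
proof -
  define r where "r = norm z"
  have r: "0 \<le> r" "r < 1" "norm (complex_of_real r) < 1" using z by (auto simp: r_def)
  have geo: "(\<lambda>K. \<Sum>m=1..K. v ^ m) \<longlonglongrightarrow> v / (1 - v)" if "norm v < 1" for v :: complex
  proof -
    have "(\<lambda>n. v ^ Suc n) sums (v * (1 / (1 - v)))"
      using sums_mult[OF geometric_sums[OF that], of v] by simp
    then have "(\<lambda>K. \<Sum>n<K. v ^ Suc n) \<longlonglongrightarrow> v / (1 - v)" by (simp add: sums_def)
    then show ?thesis by (simp only: One_nat_def sum.atLeast1_atMost_eq)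
  qed
  define g where "g K = Re (\<Sum>m=1..K. z ^ m) - Re (\<Sum>m=1..K. of_real r ^ m)" for K
  have "g \<longlonglongrightarrow> Re (z / (1 - z)) - Re (of_real r / (1 - of_real r))"
    unfolding g_def by (intro tendsto_intros geo z r)
  also have "Re (of_real r / (1 - of_real r)) = r / (1 - r)"
  proof -
    have "complex_of_real r / (1 - of_real r) = of_real (r / (1 - r))" by simp
    then show ?thesis by (simp only: Re_complex_of_real)
  qed
  finally have g: "g \<longlonglongrightarrow> Re (z / (1 - z)) - r / (1 - r)" .
  have le: "norm (\<Prod>m=1..K. inverse (1 - z ^ m)) \<le> norm (\<Prod>m=1..K. inverse (1 - complex_of_real r ^ m)) * exp (g K)" for K
  proof -
    have "norm (\<Prod>m=1..K. inverse (1 - z ^ m)) = (\<Prod>m=1..K. inverse (norm (1 - z ^ m)))"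
      by (simp add: norm_inverse flip: prod_norm)
    also have "\<dots> \<le> (\<Prod>m=1..K. inverse (1 - r ^ m) * exp (Re (z ^ m) - r ^ m))"
    proof (rule prod_mono)
      fix m assume "m \<in> {1..K}"
      then have "norm (z ^ m) < 1" using r by (simp add: norm_power power_less_one_iff r_def)
      from inverse_norm_one_minus_le[OF this]
      show "0 \<le> inverse (norm (1 - z ^ m)) \<and> inverse (norm (1 - z ^ m)) \<le> inverse (1 - r ^ m) * exp (Re (z ^ m) - r ^ m)"
        by (simp add: norm_power r_def)
    qed
    also have "\<dots> = (\<Prod>m=1..K. inverse (1 - r ^ m)) * exp (g K)"
    proof -
      have "g K = (\<Sum>m=1..K. Re (z ^ m) - r ^ m)"
        unfolding g_def by (simp add: sum_subtractf flip: of_real_power)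
      then show ?thesis by (simp add: prod.distrib exp_sum)
    qed
    also have "(\<Prod>m=1..K. inverse (1 - r ^ m)) \<le> norm (\<Prod>m=1..K. inverse (1 - complex_of_real r ^ m))"
    proof -
      have "(\<Prod>m=1..K. inverse (1 - complex_of_real r ^ m)) = of_real (\<Prod>m=1..K. inverse (1 - r ^ m))" by simp
      then show ?thesis by (simp only: norm_of_real)
    qed
    finally show ?thesis by (simp add: mult_right_mono)
  qed
  have "norm (partition_gf z) \<le> norm (partition_gf (of_real r)) * exp (Re (z / (1 - z)) - r / (1 - r))"
  proof (rule tendsto_le)
    show "(\<lambda>K. norm (\<Prod>m=1..K. inverse (1 - z ^ m))) \<longlonglongrightarrow> norm (partition_gf z)"
      by (intro tendsto_norm partition_gf_product(2) z)
    show "(\<lambda>K. norm (\<Prod>m=1..K. inverse (1 - complex_of_real r ^ m)) * exp (g K))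
       \<longlonglongrightarrow> norm (partition_gf (of_real r)) * exp (Re (z / (1 - z)) - r / (1 - r))"
      by (intro tendsto_intros partition_gf_product(2) r g)
  qed (use le in auto)
  also have "\<dots> \<le> norm (partition_gf (of_real r)) * exp (r / norm (1 - z) - r / (1 - r))"
    using complex_Re_le_cmod[of "z / (1 - z)"] by (intro mult_left_mono) (auto simp: norm_divide r_def)
  finally show ?thesis by (simp add: r_def)
qed

text \<open>The trivial bound from nonnegative coefficients; the exponential saving comes from the
  other factor.\<close>

lemma divisor_gf_minor:
  assumes N: "N > 0" and z: "norm z < 1"
  shows "norm (divisor_gf N z) \<le> norm (divisor_gf N (of_real (norm z)))"
proof -
  let ?f = "\<lambda>i. real (num_divisors_upto N i i) * norm z ^ i"
  have s: "summable ?f" using divisor_series(1)[OF N z] by (simp add: norm_mult norm_power)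
  have "norm (divisor_gf N z) \<le> suminf ?f"
    unfolding divisor_gf_def
    using summable_norm[OF divisor_series(1)[OF N z]] by (simp add: norm_mult norm_power)
  also have "complex_of_real (suminf ?f) = divisor_gf N (of_real (norm z))"
    using suminf_of_real[OF s, where 'a = complex] by (simp add: divisor_gf_def)
  then have "suminf ?f \<le> norm (divisor_gf N (of_real (norm z)))"
    by (metis abs_ge_self norm_of_real)
  finally show ?thesis .
qed

text \<open>Since |th| >= a, the point z is farther from 1 than |z| is, by a fixed factor: |1 - z|
  >= (11/10) (1 - |z|). The difference is then at most -1/11 of |z| / (1 - |z|), and the latter is
  at least 1 / (3 a).\<close>

lemma minor_arc_exponent:
  assumes a: "0 < a" "a \<le> 1" and th: "a \<le> \<bar>th\<bar>" "\<bar>th\<bar> \<le> pi" and z: "z = exp (- (of_real a + \<i> * of_real th))"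
  shows "norm z / norm (1 - z) - norm z / (1 - norm z) \<le> - (1 / 33) / a"
proof -
  define r where "r = exp (- a)"
  have r: "0 < r" "r < 1" "norm z = r" using a by (auto simp: r_def z)
  have r3: "r \<ge> 1 / 3"
  proof -
    have "exp a \<le> 3" using a exp_le by (meson exp_le_cancel_iff order_trans)
    then show ?thesis by (simp add: r_def exp_minus field_simps)
  qed
  have "1 - r \<le> a" using exp_ge_add_one_self[of "- a"] by (simp add: r_def)
  \<comment> \<open>11/24 = 1/2 - 1/24, by a^4 <= a^2 in the expansion of the cosine.\<close>
  have cos_a: "cos th \<le> 1 - a ^ 2 * (11/24)"
  proof -
    have "cos th = cos \<bar>th\<bar>" by simp
    also have "\<dots> \<le> cos a" using a th pi_gt3 by (intro cos_monotone_0_pi_le) auto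
    also have "\<dots> \<le> 1 - a ^ 2 / 2 + a ^ 4 / 24"
    proof -
      obtain t where t: "cos a = (\<Sum>m<4. cos_coeff m * a ^ m) + cos (t + 1/2 * real 4 * pi) / fact 4 * a ^ 4"
        using Maclaurin_cos_expansion2[of a 4] a by auto
      moreover have "(\<Sum>m<4. cos_coeff m * a ^ m) = 1 - a ^ 2 / 2"
        by (simp add: cos_coeff_def lessThan_nat_numeral fact_numeral)
      moreover have "cos (t + 1/2 * real 4 * pi) / fact 4 * a ^ 4 \<le> 1 / 24 * a ^ 4"
        using a by (intro mult_right_mono) (auto simp: fact_numeral divide_right_mono)
      ultimately show ?thesis by simp
    qed
    also have "a ^ 4 \<le> a ^ 2" using a by (intro power_decreasing) auto
    finally show ?thesis by simp
  qed
  have nz: "norm (1 - z) ^ 2 = (1 - r) ^ 2 + 2 * r * (1 - cos th)"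
  proof -
    have "Re z = r * cos th" "Im z = - (r * sin th)" by (auto simp: z r_def Re_exp Im_exp)
    then have "norm (1 - z) ^ 2 = (1 - r * cos th) ^ 2 + (r * sin th) ^ 2" by (simp add: cmod_power2)
    also have "\<dots> = 1 - 2 * r * cos th + r ^ 2 * (sin th ^ 2 + cos th ^ 2)"
      by algebra
    also have "\<dots> = (1 - r) ^ 2 + 2 * r * (1 - cos th)"
      by (simp only: sin_cos_squared_add) (simp add: power2_eq_square algebra_simps)
    finally show ?thesis .
  qed
  \<comment> \<open>The gain is (11/36) a^2, and 11/36 >= 21/100 = (11/10)^2 - 1, while a >= 1 -
    r.\<close>
  have "2 * r * (1 - cos th) \<ge> 2 * (1 / 3) * (a ^ 2 * (11 / 24))"
    using r3 cos_a by (intro mult_mono) auto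
  moreover have "a ^ 2 \<ge> (1 - r) ^ 2" using r \<open>1 - r \<le> a\<close> by (intro power_mono) auto
  moreover have "(11 / 10 * (1 - r)) ^ 2 = 121 / 100 * (1 - r) ^ 2"
    by (simp only: power_mult_distrib) (simp add: power_divide)
  ultimately have "norm (1 - z) ^ 2 \<ge> (11 / 10 * (1 - r)) ^ 2"
    using nz zero_le_power2[of "1 - r"] by linarith
  then have n: "norm (1 - z) \<ge> 11 / 10 * (1 - r)" by (rule power2_le_imp_le) simp
  have "r / norm (1 - z) \<le> r / (11 / 10 * (1 - r))"
    using n r by (intro divide_left_mono mult_pos_pos) auto
  also have "\<dots> = 10 / 11 * (r / (1 - r))" by simp
  finally have "r / norm (1 - z) - r / (1 - r) \<le> - (1 / 11) * (r / (1 - r))" by linarith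
  moreover have "(1 / 3) / a \<le> r / (1 - r)" using r r3 \<open>1 - r \<le> a\<close> by (intro frac_le) auto
  moreover have "(1 / 3) / a = 11 * ((1 / 33) / a)" "- (1 / 33) / a = - ((1 / 33) / a)" by simp_all
  ultimately have "r / norm (1 - z) - r / (1 - r) \<le> - (1 / 33) / a" by linarith
  then show ?thesis using r by simp
qed

section \<open>Integral formulas\<close>

lemma gaussian_has_integral:
  fixes \<mu> :: real
  assumes "\<mu> > 0"
  shows "((\<lambda>x. exp (- \<mu> * x ^ 2)) has_integral sqrt (pi / \<mu>)) UNIV"
proof -
  define \<sigma> where "\<sigma> = 1 / sqrt (2 * \<mu>)"
  have \<sigma>: "\<sigma> > 0" "\<sigma> ^ 2 = 1 / (2 * \<mu>)" using assms by (auto simp: \<sigma>_def power_divide)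
  have "(normal_density 0 \<sigma> has_integral 1) UNIV"
    using has_integral_integral_lborel[OF integrable_normal_density[OF \<sigma>(1), of 0]] integral_normal_density[OF \<sigma>(1), of 0]
    by simp
  from has_integral_mult_right[OF this, of "sqrt (pi / \<mu>)"]
  have "((\<lambda>x. sqrt (pi / \<mu>) * normal_density 0 \<sigma> x) has_integral sqrt (pi / \<mu>)) UNIV" by simp
  moreover have "sqrt (pi / \<mu>) * normal_density 0 \<sigma> x = exp (- \<mu> * x ^ 2)" for x
    using assms unfolding normal_density_def \<sigma>(2) by (simp add: field_simps)
  ultimately show ?thesis by simp
qed

lemma fourier_exp_has_integral:
  fixes k :: int
  shows "((\<lambda>x. exp (\<i> * of_int k * of_real x)) has_integral (if k = 0 then 2 * pi else 0)) {-pi..pi}"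
proof (cases "k = 0")
  case True
  then show ?thesis using has_integral_const_real[of "1::complex" "-pi" pi]
    by (simp add: scaleR_conv_of_real)
next
  case False
  define F where "F z = exp (\<i> * of_int k * z) / (\<i> * of_int k)" for z :: complex
  have "(F has_field_derivative exp (\<i> * of_int k * z)) (at z)" for z
    using False unfolding F_def by (auto intro!: derivative_eq_intros)
  then have "((\<lambda>x. F (of_real x)) has_vector_derivative exp (\<i> * of_int k * of_real x)) (at x within {-pi..pi})" for x
    by (intro has_vector_derivative_real_field)
  then have "((\<lambda>x. exp (\<i> * of_int k * of_real x)) has_integral (F (of_real pi) - F (of_real (- pi)))) {-pi..pi}"
    by (intro fundamental_theorem_of_calculus) auto
  moreover have "exp (\<i> * of_int k * of_real pi) = exp (\<i> * of_int k * of_real (- pi))"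
    unfolding exp_eq by (intro exI[of _ k]) (simp add: algebra_simps)
  then have "F (of_real pi) = F (of_real (- pi))" by (simp only: F_def)
  ultimately show ?thesis using False by simp
qed

text \<open>Cauchy's coefficient formula on the circle |z| = exp (-a), with z = exp (-(a + i x)).
  The series converges uniformly there, so it is integrated term by term and the exponentials are
  orthogonal.\<close>

lemma power_series_coeff_integral:
  fixes c :: "nat \<Rightarrow> complex" and F :: "complex \<Rightarrow> complex"
  assumes sums: "\<And>z. norm z < 1 \<Longrightarrow> (\<lambda>n. c n * z ^ n) sums F z" and a: "a > 0"
  shows "((\<lambda>x. F (exp (- (of_real a + \<i> * of_real x))) * exp (of_nat n * (of_real a + \<i> * of_real x)))
    has_integral (2 * pi * c n)) {-pi..pi}"
proof -
  define t where "t m x = c m * exp (- (of_real a + \<i> * of_real x)) ^ m * exp (of_nat n * (of_real a + \<i> * of_real x))" for m x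
  let ?G = "\<lambda>x. F (exp (- (of_real a + \<i> * of_real x))) * exp (of_nat n * (of_real a + \<i> * of_real x))"
  have Gsum: "(\<Sum>m. t m x) = ?G x" for x
    using sums_mult2[OF sums[of "exp (- (of_real a + \<i> * of_real x))"]] a
    by (simp add: t_def sums_iff)
  have summ: "summable (\<lambda>m. norm (c m) * exp (- a) ^ m * exp (real n * a))"
  proof -
    \<comment> \<open>Convergence at the larger radius exp (-a / 2) gives absolute convergence at
      exp (-a).\<close>
    have "summable (\<lambda>m. c m * (of_real (exp (- a / 2))) ^ m)"
      using sums[of "of_real (exp (- a / 2))"] a by (simp add: sums_iff)
    then have "summable (\<lambda>m. norm (c m * of_real (exp (- a)) ^ m))"
      by (rule powser_insidea) (use a in simp)
    then have "summable (\<lambda>m. norm (c m) * exp (- a) ^ m)" by (simp add: norm_mult norm_power)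
    then show ?thesis by (rule summable_mult2)
  qed
  have "uniform_limit {-pi..pi} (\<lambda>M x. \<Sum>m<M. t m x) (\<lambda>x. \<Sum>m. t m x) sequentially"
    by (rule Weierstrass_m_test[OF _ summ]) (simp add: t_def norm_mult norm_power)
  then have lim: "uniform_limit (cbox (-pi) pi) (\<lambda>M x. \<Sum>m<M. t m x) ?G sequentially"
    by (simp add: Gsum)
  have cont: "continuous_on (cbox (-pi) pi) (\<lambda>x. \<Sum>m<M. t m x)" for M
    unfolding t_def by (intro continuous_intros)
  obtain I J where IJ: "\<And>M. ((\<lambda>x. \<Sum>m<M. t m x) has_integral I M) (cbox (-pi) pi)"
      "(?G has_integral J) (cbox (-pi) pi)" "I \<longlonglongrightarrow> J"
    by (rule uniform_limit_integral_cbox[OF lim cont]) auto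
  have t_int: "((\<lambda>x. t m x) has_integral (if m = n then 2 * pi * c n else 0)) {-pi..pi}" for m
  proof -
    let ?k = "int n - int m"
    have "t m x = (c m * exp (of_real (a * of_int ?k))) * exp (\<i> * of_int ?k * of_real x)" for x
      unfolding t_def mult.assoc exp_of_nat_mult [symmetric] exp_add [symmetric]
      by (simp add: algebra_simps)
    then have "(\<lambda>x. t m x) = (\<lambda>x. (c m * exp (of_real (a * of_int ?k))) * exp (\<i> * of_int ?k * of_real x))"
      by (rule ext)
    moreover have "((\<lambda>x. (c m * exp (of_real (a * of_int ?k))) * exp (\<i> * of_int ?k * of_real x)) has_integral
       (c m * exp (of_real (a * of_int ?k))) * (if ?k = 0 then 2 * pi else 0)) {-pi..pi}"
      by (intro has_integral_mult_right fourier_exp_has_integral)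
    moreover have "(c m * exp (of_real (a * of_int ?k))) * (if ?k = 0 then 2 * pi else 0) = (if m = n then 2 * pi * c n else 0)"
      by auto
    ultimately show ?thesis by (simp only:)
  qed
  have "I M = 2 * pi * c n" if "M > n" for M
  proof -
    have "((\<lambda>x. \<Sum>m<M. t m x) has_integral (\<Sum>m<M. if m = n then 2 * pi * c n else 0)) (cbox (-pi) pi)"
      using t_int by (intro has_integral_sum) auto
    then have "I M = (\<Sum>m<M. if m = n then 2 * pi * c n else 0)"
      using IJ(1) has_integral_unique by blast
    then show ?thesis using that by simp
  qed
  then have "I \<longlonglongrightarrow> 2 * pi * c n"
    by (intro tendsto_eventually eventually_mono[OF eventually_gt_at_top[of n]])
  then have "J = 2 * pi * c n" using IJ(3) LIMSEQ_unique by blast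
  then show ?thesis using IJ(2) by simp
qed

section \<open>Saddle point expansion\<close>

text \<open>On the segment from 0 to i y the real part of 1 + z is 1, so the second derivative of Ln
  (1 + z) is at most 1 in norm there.\<close>

lemma Ln_one_plus_imag:
  fixes y :: real
  shows "norm (Ln (1 + \<i> * y) - \<i> * y) \<le> y ^ 2"
proof -
  let ?f = "\<lambda>i::nat. if i = 0 then (\<lambda>z. Ln (1 + z)) else if i = 1 then (\<lambda>z. 1 / (1 + z)) else (\<lambda>z. - 1 / (1 + z) ^ 2)"
  have re: "Re x = 0" if "x \<in> closed_segment 0 (\<i> * y)" for x
    using that by (auto simp: closed_segment_def)
  have ne: "1 + x \<notin> \<real>\<^sub>\<le>\<^sub>0" "1 + x \<noteq> 0" if "Re x = 0" for x
    using that by (auto simp: complex_nonpos_Reals_iff complex_eq_iff)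
  have "norm (?f 0 (\<i> * y) - (\<Sum>i\<le>1. ?f i 0 * (\<i> * y - 0) ^ i / fact i)) \<le> 1 * norm (\<i> * y - 0) ^ Suc 1 / fact 1"
  proof (rule complex_Taylor[of "closed_segment 0 (\<i> * y)"])
    show "(?f i has_field_derivative ?f (Suc i) x) (at x within closed_segment 0 (\<i> * y))"
      if "x \<in> closed_segment 0 (\<i> * y)" "i \<le> 1" for i x
    proof (cases "i = 0")
      case True
      then show ?thesis using ne[OF re[OF that(1)]] by (auto intro!: derivative_eq_intros simp: divide_inverse)
    next
      case False
      then have "i = 1" using that by simp
      then show ?thesis using ne[OF re[OF that(1)]]
        by (auto intro!: derivative_eq_intros simp: power2_eq_square)
    qed
    show "norm (?f (Suc 1) x) \<le> 1" if "x \<in> closed_segment 0 (\<i> * y)" for x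
    proof -
      have "1 \<le> norm (1 + x)" using complex_Re_le_cmod[of "1 + x"] re[OF that] by simp
      then have "1 \<le> norm (1 + x) ^ 2" by (rule one_le_power)
      then show ?thesis by (simp add: norm_divide norm_power divide_simps)
    qed
  qed auto
  then show ?thesis by (simp add: norm_mult power2_eq_square)
qed

text \<open>The factors w^(1/2) of P and 1 / w of D combine to w^(-1/2), whose dependence on y is
  \<open>exp (- l / 2)\<close>; \<open>L - l\<close> is the numerator of D. To first order l = i y,
  and (1 - i y / 2) (L - i y) = L - i (L / 2 + 1) y + O(y^2).\<close>

lemma amplitude_expansion:
  fixes y L :: real and l a :: complex
  assumes y: "\<bar>y\<bar> \<le> 1"
  defines "l \<equiv> Ln (1 + \<i> * y)"
  defines "a \<equiv> exp (- l / 2) * (L - l)"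
  shows "norm l \<le> 2 * \<bar>y\<bar>"
    and "norm (exp (- l / 2)) \<le> 3"
    and "norm a \<le> 6 * (1 + \<bar>L\<bar>)"
    and "norm (a - (L - \<i> * (L / 2 + 1) * y)) \<le> 9 * (1 + \<bar>L\<bar>) * y ^ 2"
    and "norm (a - L) \<le> 10 * (1 + \<bar>L\<bar>) * \<bar>y\<bar>"
proof -
  define q where "q = l - \<i> * y"
  have y2: "y ^ 2 \<le> \<bar>y\<bar>" using y by (metis abs_ge_zero mult_left_le power2_abs power2_eq_square)
  have q: "norm q \<le> y ^ 2" unfolding q_def l_def by (rule Ln_one_plus_imag)
  have lq: "l = \<i> * y + q" by (simp add: q_def)
  have "norm l \<le> norm (\<i> * y) + norm q" unfolding lq by (rule norm_triangle_ineq)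
  then show l: "norm l \<le> 2 * \<bar>y\<bar>" using q y2 by (simp add: norm_mult)
  have re: "\<bar>Re (- l / 2)\<bar> \<le> 1" using abs_Re_le_cmod[of "- l / 2"] l y by (simp add: norm_divide)
  have e3: "exp \<bar>Re (- l / 2)\<bar> \<le> 3" using re exp_le by (meson exp_le_cancel_iff order_trans)
  have "norm (exp (- l / 2)) = exp (Re (- l / 2))" by (rule norm_exp_eq_Re)
  also have "\<dots> \<le> exp \<bar>Re (- l / 2)\<bar>" by simp
  finally show E: "norm (exp (- l / 2)) \<le> 3" using e3 by linarith
  have Ll: "norm (of_real L - l) \<le> \<bar>L\<bar> + 2 * \<bar>y\<bar>"
    using norm_triangle_ineq4[of "of_real L" l] l by simp
  then have Ll': "norm (of_real L - l) \<le> 2 * (1 + \<bar>L\<bar>)" using y by simp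
  have "norm a \<le> 3 * (2 * (1 + \<bar>L\<bar>))"
    unfolding a_def norm_mult by (intro mult_mono E Ll') auto
  then show "norm a \<le> 6 * (1 + \<bar>L\<bar>)" by simp
  define p where "p = exp (- l / 2) - 1 + l / 2"
  have "norm p \<le> exp \<bar>Re (- l / 2)\<bar> * norm (- l / 2) ^ 2"
    using Taylor_exp[of "- l / 2" 1] by (simp add: p_def numeral_2_eq_2 algebra_simps)
  also have "\<dots> \<le> 3 * \<bar>y\<bar> ^ 2"
    using e3 l by (intro mult_mono power_mono) (auto simp: norm_divide)
  finally have p: "norm p \<le> 3 * y ^ 2" by simp
  define r where "r = - (of_real L * q / 2) - q + \<i> * y * l / 2 + q * l / 2 + p * (L - l)"
  have ar: "a = L - \<i> * (L / 2 + 1) * y + r"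
  proof -
    have "exp (- l / 2) = 1 - l / 2 + p" by (simp add: p_def)
    then have "a = (1 - l / 2 + p) * (L - l)" by (simp add: a_def)
    also have "\<dots> = L - \<i> * (L / 2 + 1) * y + r"
      unfolding r_def by (simp add: lq field_simps)
    finally show ?thesis .
  qed
  have "norm r \<le> norm (of_real L * q / 2) + norm q + norm (\<i> * y * l / 2) + norm (q * l / 2) + norm (p * (L - l))"
    unfolding r_def by (intro order_trans[OF norm_triangle_ineq] add_mono order_trans[OF norm_triangle_ineq4] order_refl) simp_all
  also have "\<dots> \<le> \<bar>L\<bar> * y ^ 2 / 2 + y ^ 2 + \<bar>y\<bar> * (2 * \<bar>y\<bar>) / 2 + y ^ 2 * 2 / 2 + 3 * y ^ 2 * (\<bar>L\<bar> + 2)"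
  proof (intro add_mono)
    show "norm (of_real L * q / 2) \<le> \<bar>L\<bar> * y ^ 2 / 2" using q by (simp add: norm_mult norm_divide mult_left_mono)
    show "norm (\<i> * y * l / 2) \<le> \<bar>y\<bar> * (2 * \<bar>y\<bar>) / 2" using mult_left_mono[OF l, of "\<bar>y\<bar>"] by (simp add: norm_mult norm_divide)
    show "norm (q * l / 2) \<le> y ^ 2 * 2 / 2"
      unfolding norm_mult norm_divide using q l y by (intro divide_mono mult_mono) auto
    show "norm (p * (L - l)) \<le> 3 * y ^ 2 * (\<bar>L\<bar> + 2)"
      unfolding norm_mult using p Ll y by (intro mult_mono) auto
  qed (rule q)
  also have "\<dots> = (7/2 * \<bar>L\<bar> + 9) * y ^ 2" by (simp add: field_simps power2_eq_square)
  also have "\<dots> \<le> 9 * (1 + \<bar>L\<bar>) * y ^ 2" by (intro mult_right_mono) auto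
  finally have r: "norm r \<le> 9 * (1 + \<bar>L\<bar>) * y ^ 2" .
  show "norm (a - (L - \<i> * (L / 2 + 1) * y)) \<le> 9 * (1 + \<bar>L\<bar>) * y ^ 2"
    using r by (simp add: ar)
  have "norm (a - L) = norm (r - \<i> * (L / 2 + 1) * y)" by (simp add: ar)
  also have "\<dots> \<le> norm r + norm (\<i> * (L / 2 + 1) * y)" by (rule norm_triangle_ineq4)
  also have "\<dots> \<le> 9 * (1 + \<bar>L\<bar>) * \<bar>y\<bar> + (1 + \<bar>L\<bar>) * \<bar>y\<bar>"
  proof (rule add_mono)
    show "norm r \<le> 9 * (1 + \<bar>L\<bar>) * \<bar>y\<bar>" by (rule order_trans[OF r mult_left_mono[OF y2]]) simp
    have "norm (\<i> * (L / 2 + 1) * y) = \<bar>L / 2 + 1\<bar> * \<bar>y\<bar>"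
      by (simp only: norm_mult norm_ii norm_of_real mult_1)
    also have "\<dots> \<le> (1 + \<bar>L\<bar>) * \<bar>y\<bar>" by (intro mult_right_mono) auto
    finally show "norm (\<i> * (L / 2 + 1) * y) \<le> (1 + \<bar>L\<bar>) * \<bar>y\<bar>" .
  qed
  finally show "norm (a - L) \<le> 10 * (1 + \<bar>L\<bar>) * \<bar>y\<bar>" by (simp add: algebra_simps)
qed

text \<open>A single term of the exponential series at v / 4, hence the constants 4^k k!. Powers of
  v are thus paid for with part of the Gaussian decay.\<close>

lemma power_le_exp:
  fixes v :: real
  assumes "v \<ge> 0"
  shows "v \<le> 4 * exp (v / 4)" "v ^ 2 \<le> 32 * exp (v / 4)" "v ^ 3 \<le> 384 * exp (v / 4)"
proof -
  have "(v / 4) ^ k / fact k \<le> exp (v / 4)" for k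
  proof -
    define x where "x = v / 4"
    have x: "x \<ge> 0" using assms by (simp add: x_def)
    have "x ^ n /\<^sub>R fact n = x ^ n / fact n" for n by (simp add: divide_inverse_commute)
    then have s: "(\<lambda>n. x ^ n / fact n) sums exp x" using exp_converges[of x] by (simp only:)
    have "(\<Sum>n\<in>{k}. x ^ n / fact n) \<le> (\<Sum>n. x ^ n / fact n)"
      by (rule sum_le_suminf[OF sums_summable[OF s]]) (use x in auto)
    then have "x ^ k / fact k \<le> exp x" using sums_unique[OF s] by simp
    then show ?thesis by (simp only: x_def)
  qed
  from this[of 1] this[of 2] this[of 3]
  show "v \<le> 4 * exp (v / 4)" "v ^ 2 \<le> 32 * exp (v / 4)" "v ^ 3 \<le> 384 * exp (v / 4)"
    by (simp_all add: power_divide fact_numeral)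
qed

lemma exp_quarter_mult_exp_half: "exp (v / 4) * exp (- v / 2) = exp (- (v::real) / 4)"
  by (simp flip: exp_add)

text \<open>With v = kappa y^2 the exponent is -v + u, where u is i kappa y^3 up to O(kappa y^4).
  The remainder consists of exp u - 1 - u, of u (a - L), and of the errors in the expansions of u
  and a. Since y^2 = v / kappa, each is bounded by a power of v times (1 + |L|) / kappa, besides the
  decay.\<close>

lemma saddle_expansion:
  fixes y L \<kappa> :: real and l X :: complex
  assumes y: "\<bar>y\<bar> \<le> 1" and \<kappa>: "\<kappa> > 0"
  defines "l \<equiv> Ln (1 + \<i> * y)"
  defines "X \<equiv> exp (- \<kappa> * y ^ 2 / (1 + \<i> * y)) * exp (- l / 2)"
  shows "norm X \<le> 3 * exp (- (\<kappa> * y ^ 2) / 2)"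
    and "norm (X * (L - l) - exp (- \<kappa> * y ^ 2) * (L - \<i> * (L / 2 + 1) * y + \<i> * \<kappa> * L * y ^ 3))
       \<le> 5000 * (1 + \<bar>L\<bar>) / \<kappa> * exp (- (\<kappa> * y ^ 2) / 4)"
proof -
  define v where "v = \<kappa> * y ^ 2"
  define E where "E = exp (- v)"
  define a where "a = exp (- l / 2) * (L - l)"
  note amp = amplitude_expansion(1,2)[OF y, folded l_def] amplitude_expansion(3-5)[OF y, of L, folded l_def, folded a_def]
  have v: "v \<ge> 0" using \<kappa> by (simp add: v_def)
  define u where "u = \<i> * \<kappa> * y ^ 3 / (1 + \<i> * y)"
  have ne: "1 + \<i> * y \<noteq> 0" by (simp add: complex_eq_iff)
  have n1: "norm (1 + \<i> * y) \<ge> 1" using complex_Re_le_cmod[of "1 + \<i> * y"] by simp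
  have split: "- \<kappa> * y ^ 2 / (1 + \<i> * y) = - of_real v + u"
    using ne by (simp add: u_def v_def field_simps power2_eq_square power3_eq_cube)
  have yy: "1 + y * y \<noteq> 0" using zero_le_square[of y] by linarith
  have Reu: "Re u = \<kappa> * y ^ 4 / (1 + y ^ 2)"
    using yy by (simp add: u_def Re_divide cmod_power2 power2_eq_square power4_eq_xxxx power3_eq_cube)
  have Reu0: "Re u \<ge> 0" using \<kappa> by (simp add: Reu add_pos_nonneg)
  \<comment> \<open>The real part of the exponent is exactly -v / (1 + y^2), so at least half of the
    decay survives for |y| <= 1.\<close>
  have half: "- v + Re u \<le> - v / 2"
  proof -
    have "- v + Re u = - (v / (1 + y ^ 2))"
      unfolding Reu v_def using yy by (simp add: field_simps power2_eq_square power4_eq_xxxx)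
    moreover have "v / 2 \<le> v / (1 + y ^ 2)"
      using v y by (intro divide_left_mono mult_pos_pos) (auto simp: add_pos_nonneg abs_square_le_1)
    ultimately show ?thesis by linarith
  qed
  have EX: "norm (exp (- \<kappa> * y ^ 2 / (1 + \<i> * y))) \<le> exp (- v / 2)"
    using half unfolding split by simp
  have "norm X \<le> exp (- v / 2) * 3"
    unfolding X_def norm_mult by (intro mult_mono EX amp(2)) auto
  then show "norm X \<le> 3 * exp (- (\<kappa> * y ^ 2) / 2)" by (simp add: v_def)
  have nu: "norm u \<le> \<kappa> * \<bar>y\<bar> ^ 3"
  proof -
    have "norm u = \<kappa> * \<bar>y\<bar> ^ 3 / norm (1 + \<i> * y)"
      using \<kappa> by (simp add: u_def norm_divide norm_mult norm_power)
    also have "\<dots> \<le> \<kappa> * \<bar>y\<bar> ^ 3 / 1" using n1 \<kappa> by (intro divide_left_mono) auto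
    finally show ?thesis by simp
  qed
  have nu': "norm (u - \<i> * \<kappa> * y ^ 3) \<le> \<kappa> * y ^ 4"
  proof -
    have "u - \<i> * \<kappa> * y ^ 3 = \<kappa> * y ^ 4 / (1 + \<i> * y)"
      using ne by (simp add: u_def field_simps power4_eq_xxxx power3_eq_cube)
    then have "norm (u - \<i> * \<kappa> * y ^ 3) = \<kappa> * y ^ 4 / norm (1 + \<i> * y)"
      using \<kappa> by (simp add: norm_divide norm_mult norm_power)
    also have "\<dots> \<le> \<kappa> * y ^ 4 / 1" using n1 \<kappa> by (intro divide_left_mono) auto
    finally show ?thesis by simp
  qed
  have T1: "norm (of_real E * (exp u - 1 - u) * a) \<le> exp (- v / 2) * (v ^ 3 / \<kappa>) * (6 * (1 + \<bar>L\<bar>))"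
    unfolding norm_mult
  proof (rule mult_mono[OF _ amp(3)])
    have "norm (exp u - 1 - u) \<le> exp (Re u) * norm u ^ 2"
      using Taylor_exp[of u 1] Reu0 by (simp add: numeral_2_eq_2 algebra_simps)
    also have "\<dots> \<le> exp (Re u) * (\<kappa> * \<bar>y\<bar> ^ 3) ^ 2"
      by (intro mult_left_mono power_mono nu) auto
    also have "(\<kappa> * \<bar>y\<bar> ^ 3) ^ 2 = v ^ 3 / \<kappa>"
      using \<kappa> by (simp add: v_def power_mult_distrib eval_nat_numeral)
    finally have "norm (exp u - 1 - u) \<le> exp (Re u) * (v ^ 3 / \<kappa>)" .
    then have "E * norm (exp u - 1 - u) \<le> E * (exp (Re u) * (v ^ 3 / \<kappa>))"
      by (intro mult_left_mono) (auto simp: E_def)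
    also have "\<dots> = exp (- v + Re u) * (v ^ 3 / \<kappa>)" by (simp only: E_def exp_add mult.assoc)
    also have "\<dots> \<le> exp (- v / 2) * (v ^ 3 / \<kappa>)"
      using half v \<kappa> by (intro mult_right_mono) auto
    finally show "norm (of_real E :: complex) * norm (exp u - 1 - u) \<le> exp (- v / 2) * (v ^ 3 / \<kappa>)"
      by (simp add: E_def)
  qed (use v \<kappa> in auto)
  have T2: "norm (of_real E * (u * (a - L) + (u - \<i> * \<kappa> * y ^ 3) * L + (a - (L - \<i> * (L / 2 + 1) * y))))
     \<le> exp (- v / 2) * ((11 * v ^ 2 / \<kappa> + 9 * v / \<kappa>) * (1 + \<bar>L\<bar>))"
    unfolding norm_mult
  proof (intro mult_mono)
    have "norm (u * (a - L) + (u - \<i> * \<kappa> * y ^ 3) * L + (a - (L - \<i> * (L / 2 + 1) * y)))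
      \<le> norm (u * (a - L)) + norm ((u - \<i> * \<kappa> * y ^ 3) * L) + norm (a - (L - \<i> * (L / 2 + 1) * y))"
      by (intro norm_triangle_mono order_refl)
    also have "\<dots> \<le> \<kappa> * \<bar>y\<bar> ^ 3 * (10 * (1 + \<bar>L\<bar>) * \<bar>y\<bar>) + \<kappa> * y ^ 4 * (1 + \<bar>L\<bar>) + 9 * (1 + \<bar>L\<bar>) * y ^ 2"
      using \<kappa> nu nu' amp unfolding norm_mult by (intro add_mono mult_mono) auto
    also have "\<kappa> * \<bar>y\<bar> ^ 3 * (10 * (1 + \<bar>L\<bar>) * \<bar>y\<bar>) = 10 * \<kappa> * (\<bar>y\<bar> ^ 3 * \<bar>y\<bar>) * (1 + \<bar>L\<bar>)"
      by (simp only: mult_ac)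
    also have "\<bar>y\<bar> ^ 3 * \<bar>y\<bar> = y ^ 4" using power_even_abs[of 4 y] by (simp add: eval_nat_numeral mult_ac)
    also have "10 * \<kappa> * y ^ 4 * (1 + \<bar>L\<bar>) + \<kappa> * y ^ 4 * (1 + \<bar>L\<bar>) + 9 * (1 + \<bar>L\<bar>) * y ^ 2
       = (11 * (\<kappa> * y ^ 4) + 9 * y ^ 2) * (1 + \<bar>L\<bar>)"
      by (simp add: algebra_simps)
    also have "\<kappa> * y ^ 4 = v ^ 2 / \<kappa>" using \<kappa> by (simp add: v_def power_mult_distrib eval_nat_numeral)
    also have "y ^ 2 = v / \<kappa>" using \<kappa> by (simp add: v_def)
    finally show "norm (u * (a - L) + (u - \<i> * \<kappa> * y ^ 3) * L + (a - (L - \<i> * (L / 2 + 1) * y)))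
       \<le> (11 * v ^ 2 / \<kappa> + 9 * v / \<kappa>) * (1 + \<bar>L\<bar>)" by simp
    show "norm (of_real E :: complex) \<le> exp (- v / 2)" using v by (simp add: E_def)
  qed auto
  have "X * (L - l) - exp (- \<kappa> * y ^ 2) * (L - \<i> * (L / 2 + 1) * y + \<i> * \<kappa> * L * y ^ 3)
    = of_real E * (exp u - 1 - u) * a + of_real E * (u * (a - L) + (u - \<i> * \<kappa> * y ^ 3) * L + (a - (L - \<i> * (L / 2 + 1) * y)))"
  proof -
    have "X * (L - l) = of_real E * exp u * a"
      unfolding X_def split exp_add by (simp add: a_def E_def exp_of_real mult_ac flip: of_real_minus)
    moreover have "exp (- \<kappa> * y ^ 2) = E" by (simp add: E_def v_def)
    ultimately show ?thesis by (simp add: algebra_simps)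
  qed
  also have "norm \<dots> \<le> exp (- v / 2) * (v ^ 3 / \<kappa>) * (6 * (1 + \<bar>L\<bar>)) + exp (- v / 2) * ((11 * v ^ 2 / \<kappa> + 9 * v / \<kappa>) * (1 + \<bar>L\<bar>))"
    by (rule norm_triangle_mono[OF T1 T2])
  also have "\<dots> = (6 * v ^ 3 + 11 * v ^ 2 + 9 * v) * (exp (- v / 2) * ((1 + \<bar>L\<bar>) / \<kappa>))"
    using \<kappa> by (simp add: field_simps)
  \<comment> \<open>6 * 384 + 11 * 32 + 9 * 4 = 2692 is below 5000.\<close>
  also have "\<dots> \<le> (5000 * exp (v / 4)) * (exp (- v / 2) * ((1 + \<bar>L\<bar>) / \<kappa>))"
    using power_le_exp[OF v] \<kappa> by (intro mult_right_mono) (auto, smt (verit) exp_gt_zero)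
  also have "\<dots> = 5000 * ((1 + \<bar>L\<bar>) / \<kappa>) * (exp (v / 4) * exp (- v / 2))" by (simp add: mult_ac)
  finally show "norm (X * (L - l) - exp (- \<kappa> * y ^ 2) * (L - \<i> * (L / 2 + 1) * y + \<i> * \<kappa> * L * y ^ 3))
       \<le> 5000 * (1 + \<bar>L\<bar>) / \<kappa> * exp (- (\<kappa> * y ^ 2) / 4)"
    unfolding exp_quarter_mult_exp_half v_def by simp
qed

section \<open>The integrand on the major and minor arcs\<close>

definition T0_integrand :: "nat \<Rightarrow> nat \<Rightarrow> complex \<Rightarrow> complex" where
  "T0_integrand N n w = partition_gf (exp (- w)) * divisor_gf N (exp (- w)) * exp (of_nat n * w)"

text \<open>The main term at w = a without its logarithmic factor: exp (pi^2 / (6 a) + n a) = exp (2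
  n a) at the saddle point, sqrt (a / (2 pi)) from P and 1 / (N a) from D.\<close>

definition major_const :: "nat \<Rightarrow> nat \<Rightarrow> real \<Rightarrow> real" where
  "major_const N n a = exp (2 * (real n * a)) * exp (ln a / 2 - ln (2 * pi) / 2) / (real N * a)"

lemma major_const_pos: "N > 0 \<Longrightarrow> a > 0 \<Longrightarrow> major_const N n a > 0"
  by (simp add: major_const_def)

text \<open>With c = 1 + i y, the exponential part is n a (1 / c + c) = n a (2 + (c - 1)^2 / c),
  because pi^2 / 6 = n a^2. The factor N w is split off to cancel the denominator of D.\<close>

lemma saddle_exponent:
  fixes a y :: real and l w :: complex
  assumes a: "a > 0" "real n * a ^ 2 = pi ^ 2 / 6" and N: "N > 0"
  defines "l \<equiv> Ln (1 + \<i> * y)" and "w \<equiv> of_real a * (1 + \<i> * y)"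
  shows "exp (eta_main w + of_nat n * w) = major_const N n a * 
     (exp (- (real n * a) * y ^ 2 / (1 + \<i> * y)) * exp (- l / 2)) * (of_nat N * w)"
proof -
  have ne: "1 + \<i> * y \<noteq> 0" by (simp add: complex_eq_iff)
  have lw: "Ln w = of_real (ln a) + l"
    unfolding w_def l_def using Ln_times_of_real[of a "1 + \<i> * y"] a ne Ln_of_real[of a] by simp
  have F: "of_real (pi ^ 2 / 6) / w + of_nat n * w = of_real (2 * (real n * a)) + (- (real n * a) * y ^ 2 / (1 + \<i> * y))"
  proof -
    define c where "c = 1 + \<i> * y"
    have "of_real (y ^ 2) = - ((c - 1) ^ 2)" by (simp add: c_def power_mult_distrib)
    moreover have "of_real (real n * a ^ 2) / (of_real a * c) + of_nat n * (of_real a * c)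
      = of_real (2 * (real n * a)) + (- (real n * a) * (- ((c - 1) ^ 2)) / c)"
      using ne a(1) unfolding c_def [symmetric] by (simp add: field_simps power2_eq_square)
    ultimately show ?thesis unfolding a(2) [symmetric] w_def c_def [symmetric]
      by (simp only: of_real_power of_real_mult of_real_minus of_real_of_nat_eq)
  qed
  have "eta_main w + of_nat n * w = (of_real (pi ^ 2 / 6) / w + of_nat n * w)
      + of_real (ln a / 2 - ln (2 * pi) / 2) + (- l / 2) + l"
    unfolding eta_main_def lw by (simp add: add_divide_distrib algebra_simps)
  then have "eta_main w + of_nat n * w = of_real (2 * (real n * a)) + (- (real n * a) * y ^ 2 / (1 + \<i> * y))
      + of_real (ln a / 2 - ln (2 * pi) / 2) + (- l / 2) + l"
    unfolding F .
  then have "exp (eta_main w + of_nat n * w) = of_real (exp (2 * (real n * a))) * exp (- (real n * a) * y ^ 2 / (1 + \<i> * y))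
      * of_real (exp (ln a / 2 - ln (2 * pi) / 2)) * exp (- l / 2) * (1 + \<i> * y)"
    using ne by (simp only: exp_add exp_of_real) (simp add: l_def)
  also have "\<dots> = major_const N n a * (exp (- (real n * a) * y ^ 2 / (1 + \<i> * y)) * exp (- l / 2)) * (of_nat N * w)"
    unfolding major_const_def w_def using a(1) N by simp
  finally show ?thesis .
qed

text \<open>P has a relative error \<open>\<rho>\<close> = O(a) and D an absolute error
  \<open>\<delta>\<close> = O(1), which becomes O(a) after multiplication by N w. The constants use
  |w| <= (3/2) a: 158 >= 105 * 3/2 and 486 = 3 * (3/2) * 108.\<close>

lemma major_arc:
  fixes a y :: real and l X :: complex
  assumes a: "0 < a" "a \<le> 1 / 2" "real n * a ^ 2 = pi ^ 2 / 6" and N: "N > 0" and y: "\<bar>y\<bar> \<le> 1"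
  defines "L \<equiv> euler_mascheroni - ln (real N * a)" and "l \<equiv> Ln (1 + \<i> * y)"
  defines "X \<equiv> exp (- (real n * a) * y ^ 2 / (1 + \<i> * y)) * exp (- l / 2)"
  shows "norm (T0_integrand N n (of_real a * (1 + \<i> * y)) - major_const N n a * (X * (L - l)))
    \<le> major_const N n a * ((6 * (158 * exp 105) + 486 * (1 + 158 * exp 105) * real N) * a * (1 + \<bar>L\<bar>) * exp (- (real n * a * y ^ 2) / 2))"
proof -
  define w where "w = of_real a * (1 + \<i> * y)"
  define B where "B = 158 * exp (105::real)"
  define K where "K = major_const N n a"
  have K: "K > 0" using major_const_pos N a by (simp add: K_def)
  have B: "B > 0" by (simp add: B_def)
  have ne: "1 + \<i> * y \<noteq> 0" by (simp add: complex_eq_iff)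
  have w: "w \<in> sector" "w \<noteq> 0" using a y ne by (auto simp: sector_def w_def abs_mult)
  have nw: "norm w \<le> 3/2 * a" using norm_le_sector[OF w(1)] by (simp add: w_def)
  have "n \<noteq> 0" by (rule notI) (use a(3) in simp)
  then have npos: "real n * a > 0" using a by simp
  define \<rho> where "\<rho> = partition_gf (exp (- w)) * exp (- eta_main w) - 1"
  \<comment> \<open>From a <= 1/2 follows |w| <= 3/4, while \<open>partition_gf_asymp\<close> asks
    for |w| <= 1.\<close>
  have "norm \<rho> \<le> 105 * exp 105 * norm w"
    unfolding \<rho>_def using nw a by (intro partition_gf_asymp w) auto
  also have "\<dots> \<le> 105 * exp 105 * (3/2 * a)" by (intro mult_left_mono nw) auto
  also have "\<dots> \<le> B * a" using a by (simp add: B_def)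
  finally have \<rho>: "norm \<rho> \<le> B * a" .
  have P: "partition_gf (exp (- w)) = exp (eta_main w) * (1 + \<rho>)"
    by (simp add: \<rho>_def exp_minus)
  define \<delta> where "\<delta> = divisor_gf N (exp (- w)) - (euler_mascheroni - Ln (of_nat N * w)) / (of_nat N * w)"
  have \<delta>: "norm \<delta> \<le> 108" unfolding \<delta>_def by (rule divisor_gf_asymp[OF w(1) N])
  have "Ln (of_nat N * w) = of_real (ln (real N * a)) + l"
    unfolding w_def l_def using Ln_times_of_real[of "real N * a" "1 + \<i> * y"] a N ne Ln_of_real[of "real N * a"]
    by (simp add: mult_ac)
  then have D: "divisor_gf N (exp (- w)) = (L - l) / (of_nat N * w) + \<delta>"
    by (simp add: \<delta>_def L_def)
  have "T0_integrand N n w = exp (eta_main w + of_nat n * w) * (1 + \<rho>) * ((L - l) / (of_nat N * w) + \<delta>)"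
    unfolding T0_integrand_def P D exp_add by (simp add: mult_ac)
  also have "exp (eta_main w + of_nat n * w) = K * X * (of_nat N * w)"
    unfolding w_def K_def X_def l_def by (rule saddle_exponent) (use a N in auto)
  also have "K * X * (of_nat N * w) * (1 + \<rho>) * ((L - l) / (of_nat N * w) + \<delta>)
     = K * (X * (L - l)) + K * (X * (\<rho> * (L - l) + (1 + \<rho>) * (of_nat N * w * \<delta>)))"
    using w N by (simp add: field_simps)
  finally have "T0_integrand N n w - K * (X * (L - l)) = K * (X * (\<rho> * (L - l) + (1 + \<rho>) * (of_nat N * w * \<delta>)))"
    by simp
  then have "norm (T0_integrand N n w - K * (X * (L - l))) = K * (norm X * norm (\<rho> * (L - l) + (1 + \<rho>) * (of_nat N * w * \<delta>)))"
    using K by (simp add: norm_mult)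
  also have "\<dots> \<le> K * (3 * exp (- (real n * a * y ^ 2) / 2) * (B * a * (2 * (1 + \<bar>L\<bar>)) + (1 + B) * (real N * (3/2 * a) * 108)))"
  proof (intro mult_left_mono mult_mono)
    show "norm X \<le> 3 * exp (- (real n * a * y ^ 2) / 2)"
      unfolding X_def l_def by (rule saddle_expansion(1)[OF y npos])
    have "norm l \<le> 2 * \<bar>y\<bar>" unfolding l_def by (rule amplitude_expansion(1)[OF y])
    then have Ll: "norm (of_real L - l) \<le> 2 * (1 + \<bar>L\<bar>)"
      using norm_triangle_ineq4[of "of_real L" l] y by simp
    have "norm (1 + \<rho>) \<le> 1 + norm \<rho>" using norm_triangle_ineq[of 1 \<rho>] by simp
    also have "B * a \<le> B * 1" using a B by (intro mult_left_mono) auto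
    then have "1 + norm \<rho> \<le> 1 + B" using \<rho> by linarith
    finally have r1: "norm (1 + \<rho>) \<le> 1 + B" .
    show "norm (\<rho> * (L - l) + (1 + \<rho>) * (of_nat N * w * \<delta>)) \<le> B * a * (2 * (1 + \<bar>L\<bar>)) + (1 + B) * (real N * (3/2 * a) * 108)"
    proof (rule norm_triangle_mono)
      show "norm (\<rho> * (L - l)) \<le> B * a * (2 * (1 + \<bar>L\<bar>))"
        unfolding norm_mult using B a by (intro mult_mono \<rho> Ll) auto
      show "norm ((1 + \<rho>) * (of_nat N * w * \<delta>)) \<le> (1 + B) * (real N * (3/2 * a) * 108)"
        unfolding norm_mult norm_of_nat using B a by (intro mult_mono r1 nw \<delta>) auto
    qed
  qed (use K in auto)
  also have "\<dots> \<le> K * (3 * exp (- (real n * a * y ^ 2) / 2) * (B * a * (2 * (1 + \<bar>L\<bar>)) + (1 + B) * (real N * (3/2 * a) * 108) * (1 + \<bar>L\<bar>)))"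
  proof -
    have "(1 + B) * (real N * (3/2 * a) * 108) * 1 \<le> (1 + B) * (real N * (3/2 * a) * 108) * (1 + \<bar>L\<bar>)"
      using B a by (intro mult_left_mono) auto
    then have Q: "(1 + B) * (real N * (3/2 * a) * 108) \<le> (1 + B) * (real N * (3/2 * a) * 108) * (1 + \<bar>L\<bar>)"
      by (simp only: mult_1_right)
    show ?thesis by (rule mult_left_mono[OF mult_left_mono[OF add_left_mono[OF Q]]]) (use K in auto)
  qed
  also have "\<dots> = K * ((6 * B + 486 * (1 + B) * real N) * a * (1 + \<bar>L\<bar>) * exp (- (real n * a * y ^ 2) / 2))"
    by (simp add: algebra_simps)
  finally show ?thesis by (simp only: w_def K_def B_def)
qed

text \<open>Averaging over \<open>y\<close> and \<open>- y\<close> removes the odd terms of the expansion, which are larger than the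
  error term.\<close>

lemma major_arc_sym:
  fixes N :: nat
  assumes N: "N > 0"
  obtains C where "C > 0" and
    "\<And>a n y. 0 < a \<Longrightarrow> a \<le> 1 / 2 \<Longrightarrow> real n * a ^ 2 = pi ^ 2 / 6 \<Longrightarrow> \<bar>y\<bar> \<le> 1 \<Longrightarrow>
      norm ((T0_integrand N n (of_real a * (1 + \<i> * of_real y)) + T0_integrand N n (of_real a * (1 + \<i> * of_real (- y)))) / 2
         - of_real (major_const N n a * (euler_mascheroni - ln (real N * a)) * exp (- (real n * a * y ^ 2))))
      \<le> major_const N n a * (C * (1 + \<bar>euler_mascheroni - ln (real N * a)\<bar>) / (real n * a) * exp (- (real n * a * y ^ 2) / 4))"
proof -
  define C0 where "C0 = 6 * (158 * exp 105) + 486 * (1 + 158 * exp 105) * real N"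
  have C0: "C0 > 0" by (simp add: C0_def add_pos_nonneg)
  show ?thesis
  proof (rule that[of "5000 + 2 * C0"])
    fix a n y assume a: "0 < a" "a \<le> 1 / 2" "real n * a ^ 2 = pi ^ 2 / 6" and y: "\<bar>y\<bar> \<le> (1::real)"
    define L where "L = euler_mascheroni - ln (real N * a)"
    define K where "K = major_const N n a"
    define \<kappa> where "\<kappa> = real n * a"
    define E where "E = exp (- (\<kappa> * y ^ 2) / 4)"
    have K: "K > 0" using major_const_pos N a by (simp add: K_def)
    have ka: "\<kappa> * a = pi ^ 2 / 6" using a(3) by (simp add: \<kappa>_def power2_eq_square mult_ac)
    have \<kappa>: "\<kappa> > 0" using ka a(1) by (metis pi_gt_zero zero_less_divide_iff zero_less_mult_pos2 zero_less_numeral zero_less_power)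
    \<comment> \<open>From pi^2 / 6 <= 2 follows a <= 2 / \<open>\<kappa>\<close>, which turns the
      O(a) error of \<open>major_arc\<close> into the O(1 / \<open>\<kappa>\<close>) of the saddle
      expansion.\<close>
    have "pi \<le> 16 / 5" using pi_approx by simp
    then have "pi * pi \<le> 16 / 5 * (16 / 5)" by (intro mult_mono) auto
    then have "pi ^ 2 / 6 \<le> 2" by (simp add: power2_eq_square)
    then have a2: "a \<le> 2 / \<kappa>" using ka \<kappa> by (simp add: field_simps)
    define g where "g t = L - \<i> * (L / 2 + 1) * t + \<i> * \<kappa> * L * t ^ 3" for t :: real
    \<comment> \<open>Stated for any t with t^2 = y^2, so that it applies to y and -y with the same
      Gaussian.\<close>
    have one: "norm (T0_integrand N n (of_real a * (1 + \<i> * of_real t)) - of_real K * (exp (- \<kappa> * y ^ 2) * g t))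
       \<le> K * ((5000 + 2 * C0) * (1 + \<bar>L\<bar>) / \<kappa> * E)" if t: "t ^ 2 = y ^ 2" for t
    proof -
      have t1: "\<bar>t\<bar> \<le> 1" using y t by (metis power2_eq_iff abs_minus_cancel)
      define l where "l = Ln (1 + \<i> * t)"
      define X where "X = exp (- \<kappa> * t ^ 2 / (1 + \<i> * t)) * exp (- l / 2)"
      have 1: "norm (T0_integrand N n (of_real a * (1 + \<i> * of_real t)) - K * (X * (L - l)))
         \<le> K * (C0 * a * (1 + \<bar>L\<bar>) * exp (- (\<kappa> * t ^ 2) / 2))"
        using major_arc[OF a N t1] unfolding K_def L_def C0_def X_def l_def \<kappa>_def by simp
      have 2: "norm (X * (L - l) - exp (- \<kappa> * t ^ 2) * g t) \<le> 5000 * (1 + \<bar>L\<bar>) / \<kappa> * exp (- (\<kappa> * t ^ 2) / 4)"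
        using saddle_expansion(2)[OF t1 \<kappa>, of L] unfolding X_def l_def g_def by simp
      have "norm (T0_integrand N n (of_real a * (1 + \<i> * of_real t)) - of_real K * (exp (- \<kappa> * t ^ 2) * g t))
        \<le> norm (T0_integrand N n (of_real a * (1 + \<i> * of_real t)) - K * (X * (L - l))) + norm (of_real K * (X * (L - l) - exp (- \<kappa> * t ^ 2) * g t))"
        by (rule order_trans[OF _ norm_triangle_ineq]) (simp add: algebra_simps)
      also have "\<dots> \<le> K * (C0 * a * (1 + \<bar>L\<bar>) * exp (- (\<kappa> * t ^ 2) / 2)) + K * (5000 * (1 + \<bar>L\<bar>) / \<kappa> * exp (- (\<kappa> * t ^ 2) / 4))"
      proof (rule add_mono[OF 1])
        show "norm (of_real K * (X * (L - l) - exp (- \<kappa> * t ^ 2) * g t)) \<le> K * (5000 * (1 + \<bar>L\<bar>) / \<kappa> * exp (- (\<kappa> * t ^ 2) / 4))"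
          unfolding norm_mult using K by (intro mult_mono[OF _ 2]) auto
      qed
      also have "\<dots> \<le> K * (C0 * (2 / \<kappa>) * (1 + \<bar>L\<bar>) * E) + K * (5000 * (1 + \<bar>L\<bar>) / \<kappa> * E)"
        unfolding E_def t using K C0 a2 a(1) \<kappa> by (intro add_mono mult_left_mono mult_mono order_refl) auto
      also have "\<dots> = K * ((5000 + 2 * C0) * (1 + \<bar>L\<bar>) / \<kappa> * E)" using \<kappa> by (simp add: field_simps)
      finally show ?thesis by (simp only: t)
    qed
    let ?I = "\<lambda>t. T0_integrand N n (of_real a * (1 + \<i> * of_real t))"
    have gg: "g y + g (- y) = 2 * L" by (simp add: g_def)
    have "(?I y + ?I (- y)) / 2 - of_real (K * L * exp (- (\<kappa> * y ^ 2)))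
       = ((?I y - of_real K * (exp (- \<kappa> * y ^ 2) * g y)) + (?I (- y) - of_real K * (exp (- \<kappa> * y ^ 2) * g (- y)))) / 2"
    proof -
      have "of_real K * (exp (- \<kappa> * y ^ 2) * g y) + of_real K * (exp (- \<kappa> * y ^ 2) * g (- y)) = of_real K * (complex_of_real (exp (- \<kappa> * y ^ 2)) * (g y + g (- y)))"
        by (simp only: distrib_left)
      then have e: "of_real K * (exp (- \<kappa> * y ^ 2) * g y) + of_real K * (exp (- \<kappa> * y ^ 2) * g (- y)) = 2 * of_real (K * L * exp (- (\<kappa> * y ^ 2)))"
        unfolding gg by simp
      have "\<And>p q u v s :: complex. u + v = 2 * s \<Longrightarrow> (p + q) / 2 - s = ((p - u) + (q - v)) / 2"
        by (simp add: field_simps)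
      from this[OF e] show ?thesis .
    qed
    also have "norm \<dots> \<le> (K * ((5000 + 2 * C0) * (1 + \<bar>L\<bar>) / \<kappa> * E) + K * ((5000 + 2 * C0) * (1 + \<bar>L\<bar>) / \<kappa> * E)) / 2"
      unfolding norm_divide norm_numeral
      by (rule divide_right_mono[OF norm_triangle_mono[OF one[of y] one[of "- y"]]]) simp_all
    also have "\<dots> = K * ((5000 + 2 * C0) * (1 + \<bar>L\<bar>) / \<kappa> * E)" by simp
    finally show "norm ((?I y + ?I (- y)) / 2 - of_real (major_const N n a * (euler_mascheroni - ln (real N * a)) * exp (- (real n * a * y ^ 2))))
      \<le> major_const N n a * ((5000 + 2 * C0) * (1 + \<bar>euler_mascheroni - ln (real N * a)\<bar>) / (real n * a) * exp (- (real n * a * y ^ 2) / 4))"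
      by (simp only: K_def L_def \<kappa>_def E_def)
  qed (use C0 in simp)
qed

text \<open>The saving exp (-1 / (33 a)) is used only as O(a^3). The Gaussian peak has width of
  order sqrt (a / n), that is a^(3/2), so a^3 still gains more than a factor a over it.\<close>

lemma minor_arc:
  fixes \<theta> a :: real
  assumes N: "N > 0" and a: "0 < a" "a \<le> 1" and \<theta>: "a \<le> \<bar>\<theta>\<bar>" "\<bar>\<theta>\<bar> \<le> pi"
  shows "norm (T0_integrand N n (of_real a + \<i> * of_real \<theta>)) \<le> norm (T0_integrand N n (of_real a)) * (300000 * a ^ 3)"
proof -
  define z where "z = exp (- (of_real a + \<i> * of_real \<theta>))"
  have nz: "norm z = exp (- a)" by (simp add: z_def)
  have z1: "norm z < 1" using a by (simp add: nz)
  have z0: "complex_of_real (norm z) = exp (- of_real a)" by (simp add: nz flip: exp_of_real)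
  have "exp (norm z / norm (1 - z) - norm z / (1 - norm z)) \<le> exp (- ((1 / 33) / a))"
    using minor_arc_exponent[OF a \<theta> z_def] by simp
  also have "\<dots> \<le> 300000 * a ^ 3"
  proof -
    define v where "v = 4 * ((1 / 33) / a)"
    have v: "v > 0" using a by (simp add: v_def)
    have "v ^ 3 \<le> 384 * exp (v / 4)" by (rule power_le_exp(3)) (use v in simp)
    then have "v ^ 3 * exp (- (v / 4)) \<le> 384" by (simp add: exp_minus field_simps)
    then have "exp (- (v / 4)) \<le> 384 / v ^ 3" using v by (simp add: field_simps)
    also have "384 / v ^ 3 = 384 * (33 / 4) ^ 3 * a ^ 3" using a by (simp add: v_def power_divide power_mult_distrib)
    \<comment> \<open>384 * (33/4)^3 = 215622.\<close>
    also have "\<dots> \<le> 300000 * a ^ 3" using a by (intro mult_right_mono) (auto simp: power_divide)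
    finally show ?thesis by (simp add: v_def)
  qed
  finally have e: "exp (norm z / norm (1 - z) - norm z / (1 - norm z)) \<le> 300000 * a ^ 3" .
  have "norm (T0_integrand N n (of_real a + \<i> * of_real \<theta>)) = norm (partition_gf z) * norm (divisor_gf N z) * exp (real n * a)"
    by (simp add: T0_integrand_def norm_mult z_def)
  also have "\<dots> \<le> (norm (partition_gf (of_real (norm z))) * (300000 * a ^ 3)) * norm (divisor_gf N (of_real (norm z))) * exp (real n * a)"
    using order_trans[OF partition_gf_minor[OF z1] mult_left_mono[OF e]] divisor_gf_minor[OF N z1] a
    by (intro mult_right_mono mult_mono) auto
  also have "\<dots> = norm (T0_integrand N n (of_real a)) * (300000 * a ^ 3)"
    by (simp add: T0_integrand_def norm_mult z0)
  finally show ?thesis .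
qed

section \<open>Integration over the circle\<close>

lemma T0_integrand_has_integral:
  assumes N: "N > 0" and a: "a > 0"
  shows "((\<lambda>\<theta>. (T0_integrand N n (of_real a + \<i> * of_real \<theta>) + T0_integrand N n (of_real a + \<i> * of_real (- \<theta>))) / 2)
     has_integral of_real (2 * pi * real (T0 N n))) {-pi..pi}"
proof -
  let ?f = "\<lambda>\<theta>. T0_integrand N n (of_real a + \<i> * of_real \<theta>)"
  have *: "(?f has_integral of_real (2 * pi * real (T0 N n))) {-pi..pi}"
    using power_series_coeff_integral[where c = "\<lambda>n. of_nat (T0 N n)" and n = n, OF T0_sums[OF N] a]
    by (simp add: T0_integrand_def)
  \<comment> \<open>The interval is symmetric, so averaging over both signs keeps the integral and
    puts the integrand in the form of \<open>major_arc_sym\<close>.\<close>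
  moreover have "((\<lambda>\<theta>. ?f (- \<theta>)) has_integral of_real (2 * pi * real (T0 N n))) {-pi..pi}"
    using has_integral_reflect_real[of ?f _ pi "-pi"] * by (simp only: minus_minus)
  ultimately have "((\<lambda>\<theta>. (?f \<theta> + ?f (- \<theta>)) / 2) has_integral
      ((of_real (2 * pi * real (T0 N n)) + of_real (2 * pi * real (T0 N n))) / 2)) {-pi..pi}"
    by (intro has_integral_divide has_integral_add)
  moreover have "(c + c) / 2 = c" for c :: complex by simp
  ultimately show ?thesis by (simp only:)
qed

text \<open>A single bound on the whole real line, with y = \<open>\<theta>\<close> / a: extended by
  0 outside [-pi, pi], the integrand can be compared with a Gaussian on \<open>UNIV\<close>. The
  first error term covers the major arc and the Gaussian tails, the second the minor arc.\<close>

lemma T0_integrand_pointwise: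
  fixes N :: nat
  assumes N: "N > 0"
  obtains C where "C > 0" and
    "\<And>a n \<theta>. 0 < a \<Longrightarrow> a \<le> 1 / 2 \<Longrightarrow> real n * a ^ 2 = pi ^ 2 / 6 \<Longrightarrow>
      norm ((if \<theta> \<in> {-pi..pi} then (T0_integrand N n (of_real a + \<i> * of_real \<theta>) + T0_integrand N n (of_real a + \<i> * of_real (- \<theta>))) / 2 else 0)
         - of_real (major_const N n a * (euler_mascheroni - ln (real N * a)) * exp (- (real n / a) * \<theta> ^ 2)))
      \<le> major_const N n a * (1 + \<bar>euler_mascheroni - ln (real N * a)\<bar>) * C *
          (1 / (real n * a) * exp (- (real n / (4 * a)) * \<theta> ^ 2) + (if \<theta> \<in> {-pi..pi} then a ^ 3 else 0))"
proof -
  obtain C0 where C0: "C0 > 0" and maj: 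
    "\<And>a n y. 0 < a \<Longrightarrow> a \<le> 1 / 2 \<Longrightarrow> real n * a ^ 2 = pi ^ 2 / 6 \<Longrightarrow> \<bar>y\<bar> \<le> 1 \<Longrightarrow>
      norm ((T0_integrand N n (of_real a * (1 + \<i> * of_real y)) + T0_integrand N n (of_real a * (1 + \<i> * of_real (- y)))) / 2
         - of_real (major_const N n a * (euler_mascheroni - ln (real N * a)) * exp (- (real n * a * y ^ 2))))
      \<le> major_const N n a * (C0 * (1 + \<bar>euler_mascheroni - ln (real N * a)\<bar>) / (real n * a) * exp (- (real n * a * y ^ 2) / 4))"
    by (rule major_arc_sym[OF N]) blast
  \<comment> \<open>One summand for each source of error: minor arc, Gaussian tail, major
    arc.\<close>
  define C where "C = 300000 * (1 + C0) + 4 + C0"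
  show ?thesis
  proof (rule that[of C])
    fix a n \<theta> assume a: "0 < a" "a \<le> 1 / 2" "real n * a ^ 2 = pi ^ 2 / 6"
    define L where "L = euler_mascheroni - ln (real N * a)"
    define K where "K = major_const N n a"
    define \<kappa> where "\<kappa> = real n * a"
    define y where "y = \<theta> / a"
    define v where "v = \<kappa> * y ^ 2"
    define h where "h = (T0_integrand N n (of_real a + \<i> * of_real \<theta>) + T0_integrand N n (of_real a + \<i> * of_real (- \<theta>))) / 2"
    define A where "A = 1 / \<kappa> * exp (- v / 4)"
    have K: "K > 0" using major_const_pos N a by (simp add: K_def)
    have KL: "0 \<le> K * (1 + \<bar>L\<bar>)" using K by simp
    have ka: "\<kappa> * a = pi ^ 2 / 6" using a(3) by (simp add: \<kappa>_def power2_eq_square mult_ac)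
    \<comment> \<open>If \<open>\<kappa>\<close> < 1 then \<open>\<kappa>\<close> a <= 1/2, whereas
      pi^2 / 6 >= 3/2.\<close>
    have \<kappa>1: "\<kappa> \<ge> 1"
    proof (rule ccontr)
      assume "\<not> \<kappa> \<ge> 1"
      then have "\<kappa> * a \<le> 1 * (1/2)" using a by (intro mult_mono) auto
      moreover have "3 * 3 \<le> pi * pi" using pi_gt3 by (intro mult_mono) auto
      ultimately show False using ka by (simp add: power2_eq_square)
    qed
    have v: "v \<ge> 0" using \<kappa>1 by (simp add: v_def)
    have vth: "v = real n / a * \<theta> ^ 2" using a by (simp add: v_def \<kappa>_def y_def power_divide power2_eq_square)
    have A0: "A \<ge> 0" using \<kappa>1 by (simp add: A_def)
    have w: "of_real a * (1 + \<i> * of_real (t / a)) = of_real a + \<i> * of_real t" for t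
      using a by (simp add: field_simps)
    \<comment> \<open>For |y| >= 1 the main term is itself of the size of the error:
      \<open>\<kappa>\<close> <= v, so a quarter of the Gaussian exponent yields the factor 4 /
      \<open>\<kappa>\<close>.\<close>
    have tail: "K * \<bar>L\<bar> * exp (- v) \<le> K * (1 + \<bar>L\<bar>) * 4 * A" if "\<bar>y\<bar> \<ge> 1"
    proof -
      have "1 \<le> y ^ 2" using that by (simp add: abs_square_le_1 abs_le_square_iff[of 1 y, simplified])
      then have "\<kappa> * 1 \<le> v" unfolding v_def using \<kappa>1 by (intro mult_left_mono) auto
      then have "\<kappa> \<le> 4 * exp (v / 4)" using power_le_exp(1)[OF v] by linarith
      then have "exp (- v / 4) \<le> 4 / \<kappa>" using \<kappa>1 by (simp add: exp_minus field_simps)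
      then have "exp (- v / 4) * exp (- v / 4) \<le> 4 / \<kappa> * exp (- v / 4)" by (intro mult_right_mono) auto
      moreover have "exp (- v) \<le> exp (- v / 4) * exp (- v / 4)" using v by (simp flip: exp_add)
      ultimately have "exp (- v) \<le> 4 * A" by (simp add: A_def)
      then have "K * \<bar>L\<bar> * exp (- v) \<le> K * (1 + \<bar>L\<bar>) * (4 * A)"
        using K by (intro mult_mono) auto
      then show ?thesis by simp
    qed
    have nKL: "norm (complex_of_real (K * L * exp (- v))) = K * \<bar>L\<bar> * exp (- v)" using K by (simp only: norm_of_real abs_mult) simp
    have main: "norm ((if \<theta> \<in> {-pi..pi} then h else 0) - of_real (K * L * exp (- v)))
       \<le> K * (1 + \<bar>L\<bar>) * C * (A + (if \<theta> \<in> {-pi..pi} then a ^ 3 else 0))"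
    proof (cases "\<bar>y\<bar> \<le> 1")
      case True
      then have "\<bar>\<theta>\<bar> \<le> a" using a by (simp add: y_def abs_divide)
      then have th: "\<theta> \<in> {-pi..pi}" using a pi_gt3 by auto
      have "norm (h - of_real (K * L * exp (- v))) \<le> K * (C0 * (1 + \<bar>L\<bar>) / \<kappa> * exp (- v / 4))"
        using maj[OF a True] w[of \<theta>] w[of "- \<theta>"] unfolding h_def K_def L_def v_def \<kappa>_def y_def by simp
      also have "\<dots> = K * (1 + \<bar>L\<bar>) * (C0 * A)" by (simp add: A_def)
      also have "\<dots> \<le> K * (1 + \<bar>L\<bar>) * (C * (A + a ^ 3))"
        using KL A0 C0 a by (intro mult_left_mono mult_mono) (auto simp: C_def)
      finally show ?thesis using th by (simp add: mult_ac)
    next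
      case False
      then have y1: "\<bar>y\<bar> \<ge> 1" by simp
      show ?thesis
      proof (cases "\<theta> \<in> {-pi..pi}")
        case False
        then have "norm ((if \<theta> \<in> {-pi..pi} then h else 0) - of_real (K * L * exp (- v))) = K * \<bar>L\<bar> * exp (- v)"
          using nKL by (simp only: if_False diff_0 norm_minus_cancel)
        also have "\<dots> \<le> K * (1 + \<bar>L\<bar>) * (4 * A)" using tail[OF y1] by simp
        also have "\<dots> \<le> K * (1 + \<bar>L\<bar>) * (C * A)"
          using KL A0 C0 by (intro mult_left_mono mult_right_mono) (auto simp: C_def)
        finally show ?thesis by (simp only: \<open>\<theta> \<notin> {-pi..pi}\<close> if_False add_0_right mult.assoc)
      next
        case True
        have ay: "a \<le> \<bar>\<theta>\<bar>" "\<bar>\<theta>\<bar> \<le> pi" using y1 a True by (auto simp: y_def abs_divide)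
        \<comment> \<open>The major arc bound at y = 0 gives the size of the integrand on the real
          axis, with which the minor arc is compared.\<close>
        have "norm (T0_integrand N n (of_real a) - of_real (K * L)) \<le> K * (C0 * (1 + \<bar>L\<bar>) / \<kappa>)"
          using maj[OF a, of 0] unfolding K_def L_def \<kappa>_def by simp
        also have "\<dots> \<le> K * (C0 * (1 + \<bar>L\<bar>) / 1)"
          using K C0 \<kappa>1 by (intro mult_left_mono divide_left_mono) auto
        finally have "norm (T0_integrand N n (of_real a)) \<le> norm (complex_of_real (K * L)) + K * (C0 * (1 + \<bar>L\<bar>) / 1)"
          using norm_triangle_sub[of "T0_integrand N n (of_real a)" "of_real (K * L)"] by linarith
        also have "\<dots> = K * \<bar>L\<bar> + K * (C0 * (1 + \<bar>L\<bar>))" using K by (simp add: norm_mult)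
        also have "\<dots> \<le> K * (1 + \<bar>L\<bar>) * (1 + C0)" using K by (simp add: algebra_simps)
        finally have I0: "norm (T0_integrand N n (of_real a)) \<le> K * (1 + \<bar>L\<bar>) * (1 + C0)" .
        have one: "norm (T0_integrand N n (of_real a + \<i> * of_real t)) \<le> K * (1 + \<bar>L\<bar>) * (1 + C0) * (300000 * a ^ 3)"
          if "\<bar>t\<bar> = \<bar>\<theta>\<bar>" for t
        proof (rule order_trans)
          show "norm (T0_integrand N n (of_real a + \<i> * of_real t)) \<le> norm (T0_integrand N n (of_real a)) * (300000 * a ^ 3)"
            by (rule minor_arc[OF N a(1)]) (use that ay a in auto)
          show "norm (T0_integrand N n (of_real a)) * (300000 * a ^ 3) \<le> K * (1 + \<bar>L\<bar>) * (1 + C0) * (300000 * a ^ 3)"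
            by (rule mult_right_mono[OF I0]) (use a in simp)
        qed
        have "norm h \<le> (norm (T0_integrand N n (of_real a + \<i> * of_real \<theta>)) + norm (T0_integrand N n (of_real a + \<i> * of_real (- \<theta>)))) / 2"
          unfolding h_def norm_divide by (simp add: norm_triangle_ineq divide_right_mono)
        also have "\<dots> \<le> K * (1 + \<bar>L\<bar>) * (1 + C0) * (300000 * a ^ 3)"
          using one[of \<theta>] one[of "- \<theta>"] by simp
        finally have h: "norm h \<le> K * (1 + \<bar>L\<bar>) * (300000 * (1 + C0) * a ^ 3)" by (simp only: mult_ac)
        have "norm (h - of_real (K * L * exp (- v))) \<le> norm h + K * \<bar>L\<bar> * exp (- v)"
          using norm_triangle_ineq4[of h "of_real (K * L * exp (- v))"] nKL by simp
        also have "\<dots> \<le> K * (1 + \<bar>L\<bar>) * (300000 * (1 + C0) * a ^ 3) + K * (1 + \<bar>L\<bar>) * (4 * A)"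
          using h tail[OF y1] by (intro add_mono) auto
        also have "\<dots> \<le> K * (1 + \<bar>L\<bar>) * (C * a ^ 3) + K * (1 + \<bar>L\<bar>) * (C * A)"
          using KL A0 C0 a by (intro add_mono mult_left_mono mult_right_mono) (auto simp: C_def)
        also have "\<dots> = K * (1 + \<bar>L\<bar>) * C * (A + a ^ 3)" by (simp add: algebra_simps)
        finally show ?thesis using True by simp
      qed
    qed
    have ev: "- (real n / a) * \<theta> ^ 2 = - v" "- (real n / (4 * a)) * \<theta> ^ 2 = - v / 4" by (simp_all add: vth)
    show "norm ((if \<theta> \<in> {-pi..pi} then (T0_integrand N n (of_real a + \<i> * of_real \<theta>) + T0_integrand N n (of_real a + \<i> * of_real (- \<theta>))) / 2 else 0)
         - of_real (major_const N n a * (euler_mascheroni - ln (real N * a)) * exp (- (real n / a) * \<theta> ^ 2)))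
      \<le> major_const N n a * (1 + \<bar>euler_mascheroni - ln (real N * a)\<bar>) * C *
          (1 / (real n * a) * exp (- (real n / (4 * a)) * \<theta> ^ 2) + (if \<theta> \<in> {-pi..pi} then a ^ 3 else 0))"
      using main unfolding ev h_def K_def L_def A_def \<kappa>_def .
  qed (use C0 in \<open>simp add: C_def\<close>)
qed

text \<open>The pointwise bound is integrated. The Gaussian with parameter n / a has integral sqrt
  (pi a / n); the one in the error term, with a quarter of that parameter, has twice this
  integral.\<close>

lemma T0_estimate:
  fixes N :: nat
  assumes N: "N > 0"
  obtains C where "C > 0" and
    "\<And>a n. 0 < a \<Longrightarrow> a \<le> 1 / 2 \<Longrightarrow> real n * a ^ 2 = pi ^ 2 / 6 \<Longrightarrow>
      \<bar>2 * pi * real (T0 N n) - major_const N n a * (euler_mascheroni - ln (real N * a)) * sqrt (pi * a / real n)\<bar>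
      \<le> major_const N n a * (1 + \<bar>euler_mascheroni - ln (real N * a)\<bar>) * C *
          (1 / (real n * a) * (2 * sqrt (pi * a / real n)) + 2 * pi * a ^ 3)"
proof -
  obtain C where C: "C > 0" and pw: 
    "\<And>a n \<theta>. 0 < a \<Longrightarrow> a \<le> 1 / 2 \<Longrightarrow> real n * a ^ 2 = pi ^ 2 / 6 \<Longrightarrow>
      norm ((if \<theta> \<in> {-pi..pi} then (T0_integrand N n (of_real a + \<i> * of_real \<theta>) + T0_integrand N n (of_real a + \<i> * of_real (- \<theta>))) / 2 else 0)
         - of_real (major_const N n a * (euler_mascheroni - ln (real N * a)) * exp (- (real n / a) * \<theta> ^ 2)))
      \<le> major_const N n a * (1 + \<bar>euler_mascheroni - ln (real N * a)\<bar>) * C *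
          (1 / (real n * a) * exp (- (real n / (4 * a)) * \<theta> ^ 2) + (if \<theta> \<in> {-pi..pi} then a ^ 3 else 0))"
    by (rule T0_integrand_pointwise[OF N]) blast
  show ?thesis
  proof (rule that[OF C])
    fix a n assume a: "0 < a" "a \<le> 1 / 2" "real n * a ^ 2 = pi ^ 2 / 6"
    define L where "L = euler_mascheroni - ln (real N * a)"
    define K where "K = major_const N n a"
    define s where "s = sqrt (pi * a / real n)"
    have "n \<noteq> 0" by (rule notI) (use a(3) in simp)
    then have n: "real n > 0" by simp
    let ?h = "\<lambda>\<theta>. (T0_integrand N n (of_real a + \<i> * of_real \<theta>) + T0_integrand N n (of_real a + \<i> * of_real (- \<theta>))) / 2"
    have 1: "((\<lambda>\<theta>. if \<theta> \<in> {-pi..pi} then ?h \<theta> else 0) has_integral of_real (2 * pi * real (T0 N n))) UNIV"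
      unfolding has_integral_restrict_UNIV by (rule T0_integrand_has_integral[OF N a(1)])
    have "((\<lambda>\<theta>. exp (- (real n / a) * \<theta> ^ 2)) has_integral sqrt (pi / (real n / a))) UNIV"
      using n a by (intro gaussian_has_integral) simp
    also have "pi / (real n / a) = pi * a / real n" by simp
    finally have "((\<lambda>\<theta>. K * L * exp (- (real n / a) * \<theta> ^ 2)) has_integral K * L * s) UNIV"
      unfolding s_def by (rule has_integral_mult_right)
    from has_integral_linear[OF this bounded_linear_of_real]
    have 2: "((\<lambda>\<theta>. complex_of_real (K * L * exp (- (real n / a) * \<theta> ^ 2))) has_integral of_real (K * L * s)) UNIV"
      by (simp only: o_def)
    have "((\<lambda>\<theta>. exp (- (real n / (4 * a)) * \<theta> ^ 2)) has_integral sqrt (pi / (real n / (4 * a)))) UNIV"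
      using n a by (intro gaussian_has_integral) simp
    also have "sqrt (pi / (real n / (4 * a))) = 2 * s"
      by (simp add: s_def real_sqrt_mult real_sqrt_divide)
    finally have g4: "((\<lambda>\<theta>. exp (- (real n / (4 * a)) * \<theta> ^ 2)) has_integral 2 * s) UNIV" .
    have "((\<lambda>\<theta>. a ^ 3) has_integral (2 * pi) * a ^ 3) {-pi..pi}"
      using has_integral_const_real[of "a ^ 3" "-pi" pi] by simp
    then have "((\<lambda>\<theta>. if \<theta> \<in> {-pi..pi} then a ^ 3 else 0) has_integral (2 * pi) * a ^ 3) UNIV"
      by (simp only: has_integral_restrict_UNIV)
    then have 3: "((\<lambda>\<theta>. K * (1 + \<bar>L\<bar>) * C * (1 / (real n * a) * exp (- (real n / (4 * a)) * \<theta> ^ 2) + (if \<theta> \<in> {-pi..pi} then a ^ 3 else 0)))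
      has_integral K * (1 + \<bar>L\<bar>) * C * (1 / (real n * a) * (2 * s) + 2 * pi * a ^ 3)) UNIV"
      by (intro has_integral_mult_right has_integral_add g4)
    note 12 = has_integral_diff[OF 1 2]
    have "norm (integral UNIV (\<lambda>\<theta>. (if \<theta> \<in> {-pi..pi} then ?h \<theta> else 0) - complex_of_real (K * L * exp (- (real n / a) * \<theta> ^ 2))))
       \<le> integral UNIV (\<lambda>\<theta>. K * (1 + \<bar>L\<bar>) * C * (1 / (real n * a) * exp (- (real n / (4 * a)) * \<theta> ^ 2) + (if \<theta> \<in> {-pi..pi} then a ^ 3 else 0)))"
      using pw[OF a] 12 3 unfolding K_def L_def
      by (intro integral_norm_bound_integral) (auto simp only: integrable_on_def)
    then have "norm (complex_of_real (2 * pi * real (T0 N n)) - of_real (K * L * s)) \<le> K * (1 + \<bar>L\<bar>) * C * (1 / (real n * a) * (2 * s) + 2 * pi * a ^ 3)"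
      unfolding integral_unique[OF 12] integral_unique[OF 3] .
    then show "\<bar>2 * pi * real (T0 N n) - major_const N n a * (euler_mascheroni - ln (real N * a)) * sqrt (pi * a / real n)\<bar>
      \<le> major_const N n a * (1 + \<bar>euler_mascheroni - ln (real N * a)\<bar>) * C *
          (1 / (real n * a) * (2 * sqrt (pi * a / real n)) + 2 * pi * a ^ 3)"
      by (simp only: K_def L_def s_def norm_of_real flip: of_real_diff)
  qed
qed

text \<open>For this a, 2 n a = 2 pi sqrt (n / 6), and the remaining powers of a cancel. The factor
  4 pi is 2 pi from Cauchy's formula times 2, because the bracket of the theorem is twice gamma -
  log (N a).\<close>

lemma major_const_eq:
  assumes N: "N > 0" and n: "n > 0" and a: "a = pi / sqrt (6 * real n)"
  shows "major_const N n a * sqrt (pi * a / real n) =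
     4 * pi * (exp (2 * pi * sqrt (real n / 6)) * real n powr (- 1 / 2) / (4 * pi * real N * sqrt 2))"
proof -
  have n0: "real n > 0" using n by simp
  have a0: "a > 0" using n by (simp add: a)
  have f1: "2 * (real n * a) = 2 * pi * sqrt (real n / 6)"
    using n0 by (simp add: a real_sqrt_mult real_sqrt_divide field_simps)
  have f2: "exp (ln a / 2 - ln (2 * pi) / 2) = sqrt a / sqrt (2 * pi)"
    using a0 by (simp add: exp_diff ln_sqrt [symmetric])
  have f3: "real n powr (- 1 / 2) = 1 / sqrt (real n)"
  proof -
    have "real n powr (- 1 / 2) = real n powr (- (1 / 2))" by simp
    also have "\<dots> = inverse (real n powr (1 / 2))" by (rule powr_minus)
    also have "\<dots> = 1 / sqrt (real n)" using n0 by (simp only: powr_half_sqrt inverse_eq_divide less_imp_le)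
    finally show ?thesis .
  qed
  have f4: "sqrt a / sqrt (2 * pi) / (real N * a) * sqrt (pi * a / real n) = 1 / (real N * sqrt 2 * sqrt (real n))"
  proof -
    have "sqrt a / sqrt (2 * pi) / (real N * a) * sqrt (pi * a / real n) = (sqrt a * sqrt a) / a / (real N * sqrt 2 * sqrt (real n))"
      by (simp add: real_sqrt_mult real_sqrt_divide)
    then show ?thesis using a0 by simp
  qed
  have "major_const N n a * sqrt (pi * a / real n) = exp (2 * pi * sqrt (real n / 6)) *
      (sqrt a / sqrt (2 * pi) / (real N * a) * sqrt (pi * a / real n))"
    unfolding major_const_def f1 f2 by simp
  then show ?thesis unfolding f3 f4 by simp
qed

theorem theorem1p2:
  fixes N :: nat
  assumes "N > 0"
  shows "\<exists>E :: nat \<Rightarrow> real.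
           E \<in> O(\<lambda>n. real n powr (-1/2) * ln (real n)) \<and>
           (\<forall>n\<ge>1. real (T0 N n) =
              exp (2 * pi * sqrt (real n / 6)) * real n powr (-1/2) / (4 * pi * real N * sqrt 2) *
              (ln (real n) - ln (pi\<^sup>2 / 6) + 2 * euler_mascheroni - 2 * ln (real N) + E n))"
proof -
  define Q where "Q n = exp (2 * pi * sqrt (real n / 6)) * real n powr (-1/2) / (4 * pi * real N * sqrt 2)" for n
  define M where "M n = ln (real n) - ln (pi\<^sup>2 / 6) + 2 * euler_mascheroni - 2 * ln (real N)" for n
  \<comment> \<open>Solving for the error makes the identity hold for every n >= 1; only the growth
    of \<open>E\<close> remains to be proved.\<close>
  define E where "E n = real (T0 N n) / Q n - M n" for n
  have Q: "Q n > 0" if "n \<ge> 1" for n using that assms by (simp add: Q_def)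
  obtain C where C: "C > 0" and est: 
    "\<And>a n. 0 < a \<Longrightarrow> a \<le> 1 / 2 \<Longrightarrow> real n * a ^ 2 = pi ^ 2 / 6 \<Longrightarrow>
      \<bar>2 * pi * real (T0 N n) - major_const N n a * (euler_mascheroni - ln (real N * a)) * sqrt (pi * a / real n)\<bar>
      \<le> major_const N n a * (1 + \<bar>euler_mascheroni - ln (real N * a)\<bar>) * C *
          (1 / (real n * a) * (2 * sqrt (pi * a / real n)) + 2 * pi * a ^ 3)"
    by (rule T0_estimate[OF assms]) blast
  define a where "a n = pi / sqrt (6 * real n)" for n :: nat
  define d where "d = 1 + \<bar>euler_mascheroni - ln (real N) - ln (pi\<^sup>2 / 6) / 2\<bar>"
  define r where "r n = (d + ln (real n) / 2) * (2 / (real n * a n) + 2 * pi * a n ^ 3 / sqrt (pi * a n / real n))" for n :: nat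
  \<comment> \<open>From n >= 27 and pi < 4 follows \<open>a n\<close> <= 1/2, with room to
    spare.\<close>
  have bound: "\<bar>E n\<bar> \<le> 2 * C * r n" if n: "n \<ge> 27" for n
  proof -
    define s where "s = sqrt (pi * a n / real n)"
    define L where "L = euler_mascheroni - ln (real N * a n)"
    have n0: "real n > 0" using n by simp
    have a0: "a n > 0" using n0 by (simp add: a_def)
    have s0: "s > 0" using n0 a0 by (simp add: s_def)
    have sq: "a n ^ 2 = pi ^ 2 / (6 * real n)" using n0 by (simp add: a_def power_divide)
    then have na: "real n * a n ^ 2 = pi ^ 2 / 6" using n0 by simp
    have "a n \<le> 1 / 2"
    proof (rule power2_le_imp_le)
      have "pi ^ 2 \<le> 4 ^ 2" using pi_less_4 by (intro power_mono) auto
      then show "a n ^ 2 \<le> (1 / 2) ^ 2" unfolding sq using n by (simp add: field_simps power2_eq_square)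
    qed simp
    note e = est[OF a0 this na, folded s_def L_def]
    have K: "major_const N n (a n) * s = 4 * pi * Q n"
      unfolding s_def Q_def using major_const_eq[OF assms _ a_def, of n] n by simp
    have ln_a: "ln (a n) = ln (pi\<^sup>2 / 6) / 2 - ln (real n) / 2"
    proof -
      have "2 * ln (a n) = ln (a n ^ 2)" using a0 by (simp add: ln_realpow)
      also have "\<dots> = ln (pi\<^sup>2 / 6) - ln (real n)"
        unfolding sq using n0 by (simp add: ln_div ln_mult)
      finally show ?thesis by simp
    qed
    \<comment> \<open>The origin of the bracket: log a = (log (pi^2 / 6) - log n) / 2 inserted into
      2 (gamma - log (N a)).\<close>
    have M2: "M n = 2 * L"
      using assms a0 by (simp add: M_def L_def ln_mult ln_a)
    have dL: "1 + \<bar>L\<bar> \<le> d + ln (real n) / 2"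
    proof -
      have "L = (euler_mascheroni - ln (real N) - ln (pi\<^sup>2 / 6) / 2) + ln (real n) / 2"
        using assms a0 by (simp add: L_def ln_mult ln_a)
      moreover have "ln (real n) \<ge> 0" using n by simp
      ultimately show ?thesis unfolding d_def by linarith
    qed
    have "2 * pi * Q n * \<bar>E n\<bar> = \<bar>2 * pi * Q n * E n\<bar>" using Q[of n] n by (simp add: abs_mult)
    also have "2 * pi * Q n * E n = 2 * pi * real (T0 N n) - (major_const N n (a n) * s) * L"
      unfolding K using Q[of n] n by (simp add: E_def M2 field_simps)
    also have "\<bar>2 * pi * real (T0 N n) - (major_const N n (a n) * s) * L\<bar>
       \<le> major_const N n (a n) * (1 + \<bar>L\<bar>) * C * (1 / (real n * a n) * (2 * s) + 2 * pi * a n ^ 3)"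
      using e by (simp only: mult_ac)
    also have "\<dots> = (major_const N n (a n) * s) * C * ((1 + \<bar>L\<bar>) * (2 / (real n * a n) + 2 * pi * a n ^ 3 / s))"
      using s0 by (simp add: field_simps)
    also have "\<dots> \<le> (major_const N n (a n) * s) * C * r n"
      unfolding r_def s_def [symmetric]
      using dL C s0 a0 n0 Q[of n] n unfolding K by (intro mult_left_mono mult_right_mono) auto
    also have "\<dots> = 2 * pi * Q n * (2 * C * r n)" unfolding K by simp
    finally show ?thesis using Q[of n] n by (simp add: mult_le_cancel_left)
  qed
  have "d > 0" by (simp add: d_def)
  \<comment> \<open>The two terms of \<open>r\<close> are of order n^(-1/2) log n and n^(-3/4) log
    n.\<close>
  then have r: "r \<in> O(\<lambda>n. real n powr (-1/2) * ln (real n))"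
    unfolding r_def a_def by real_asymp
  have "E \<in> O(r)"
  proof (rule bigoI)
    show "\<forall>\<^sub>F n in sequentially. norm (E n) \<le> 2 * C * norm (r n)"
      using eventually_ge_at_top[of 27]
    proof eventually_elim
      case (elim n)
      have "2 * C * r n \<le> 2 * C * \<bar>r n\<bar>" using C by simp
      then show ?case using bound[OF elim] by simp
    qed
  qed
  then have "E \<in> O(\<lambda>n. real n powr (-1/2) * ln (real n))" using r by (rule landau_o.big_trans)
  moreover have "real (T0 N n) = Q n * (M n + E n)" if "n \<ge> 1" for n
    using Q[OF that] by (simp add: E_def)
  ultimately show ?thesis unfolding Q_def M_def by (intro exI[of _ E]) auto
qed

end
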